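(* Let $k\ge2$ and $\Gamma=\Gamma(2^k)$. Let $F$ be a rational boundary component of $\mathfrak h_n$ and $\gamma\in\Gamma(2^k)$ with $F^\gamma\neq\emptyset$. Then there exists $\gamma_1\in\Gamma(2^k)$ such that $F^\gamma=F^{\gamma_1}$ and $F^{\gamma_1}$ is contained in the closure $\overline{\mathfrak h_n^{\gamma_1}}$ in the Satake partial compactification $\overline{\mathfrak h}_n$.
   Context: $\mathbf{Sp}(2n,\mathbb R)$: real matrices $g=\begin{pmatrix}A&B\\C&D\end{pmatrix}$ with ${}^tgJg=J$, $J=\begin{pmatrix}0&I\\-I&0\end{pmatrix}$, acting on $\mathfrak h_n=\{Z\in M_n(\mathbb C):{}^tZ=Z,\mathrm{Im}Z>0\}$ by $gZ=(AZ+B)(CZ+D)^{-1}$. $\tau\begin{pmatrix}A&B\\C&D\end{pmatrix}=\begin{pmatrix}A&-B\\-C&D\end{pmatrix}$ and $\tau(Z)=-\overline Z$; $\mathfrak h_n^\gamma=\{Z:\gamma Z=\tau(Z)\}$. $\Gamma(N)=\{\gamma\in\mathbf{Sp}(2n,\mathbb Z):\gamma\equiv I\bmod N\}$. $\overline{\mathfrak h}_n$ is the Satake partial compactification (all rational boundary components attached, Satake topology), on which $\mathbf{Sp}(2n,\mathbb Q)$ acts and to which $\tau$ extends with $\tau(gx)=\tau(g)\tau(x)$. For $0\le q<n$ the standard boundary component $F_q$ is the image of $\mathfrak h_q$ ($\mathfrak h_0$ a point) under $Z\mapsto\lim_Y\begin{pmatrix}Z&0\\0&iY\end{pmatrix}$,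 the limit as the positive definite $(n-q)\times(n-q)$ matrix $Y$ goes to infinity; a rational boundary component of rank $q$ is a set $gF_q$ with $g\in\mathbf{Sp}(2n,\mathbb Q)$. For a boundary component $F$, $F^\gamma=\{x\in F:\tau(x)=\gamma x\}$. *)

theory Defs
  imports Complex_Main
begin

text \<open>Conventions. Matrices are functions nat => nat => 'a with an explicit size,
  required to vanish outside the relevant index range. Vectors of C^(2n) are
  functions nat => complex vanishing at indices >= 2n. A point of the Satake
  partial compactification is modelled as a complex Lagrangian subspace of C^(2n)
  (the column space of [Z; I] for Z in h_n; boundary points are images of the
  limiting column spaces of [Z1 0; 0 I; I 0; 0 0] for Z1 in h_q).\<close>

definition zero_outside :: "nat \<Rightarrow> nat \<Rightarrow> (nat \<Rightarrow> nat \<Rightarrow> 'a::zero) \<Rightarrow> bool" where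
  "zero_outside r c M \<longleftrightarrow> (\<forall>i j. (r \<le> i \<or> c \<le> j) \<longrightarrow> M i j = 0)"

definition siegel :: "nat \<Rightarrow> (nat \<Rightarrow> nat \<Rightarrow> complex) set" where
  "siegel n = {Z. zero_outside n n Z \<and> (\<forall>i<n. \<forall>j<n. Z i j = Z j i) \<and>
     (\<forall>x::nat \<Rightarrow> real. (\<exists>i<n. x i \<noteq> 0) \<longrightarrow>
        (\<Sum>i<n. \<Sum>j<n. x i * Im (Z i j) * x j) > 0)}"

definition Jmat :: "nat \<Rightarrow> nat \<Rightarrow> nat \<Rightarrow> real" where
  "Jmat n i j = (if i < n \<and> j = i + n then 1 else if j < n \<and> i = j + n then -1 else 0)"

definition symplectic :: "nat \<Rightarrow> (nat \<Rightarrow> nat \<Rightarrow> real) \<Rightarrow> bool" where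
  "symplectic n g \<longleftrightarrow> zero_outside (2*n) (2*n) g \<and>
     (\<forall>i<2*n. \<forall>j<2*n. (\<Sum>k<2*n. \<Sum>l<2*n. g k i * Jmat n k l * g l j) = Jmat n i j)"

definition SpQ :: "nat \<Rightarrow> (nat \<Rightarrow> nat \<Rightarrow> real) set" where
  "SpQ n = {g. symplectic n g \<and> (\<forall>i j. g i j \<in> \<rat>)}"

definition SpZ :: "nat \<Rightarrow> (nat \<Rightarrow> nat \<Rightarrow> real) set" where
  "SpZ n = {g. symplectic n g \<and> (\<forall>i j. g i j \<in> \<int>)}"

definition Gamma :: "nat \<Rightarrow> int \<Rightarrow> (nat \<Rightarrow> nat \<Rightarrow> real) set" where
  "Gamma n N = {g \<in> SpZ n. \<forall>i<2*n. \<forall>j<2*n.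
      \<exists>m::int. g i j - (if i = j then 1 else 0) = of_int (N * m)}"

text \<open>Action gZ = (AZ+B)(CZ+D)^(-1) on h_n.\<close>
definition mob :: "nat \<Rightarrow> (nat \<Rightarrow> nat \<Rightarrow> real) \<Rightarrow> (nat \<Rightarrow> nat \<Rightarrow> complex) \<Rightarrow> (nat \<Rightarrow> nat \<Rightarrow> complex)" where
  "mob n g Z = (THE W. zero_outside n n W \<and>
     (\<forall>i<n. \<forall>j<n.
        (\<Sum>k<n. W i k * ((\<Sum>l<n. of_real (g (n+k) l) * Z l j) + of_real (g (n+k) (n+j))))
        = (\<Sum>l<n. of_real (g i l) * Z l j) + of_real (g i (n+j))))"

definition tauZ :: "(nat \<Rightarrow> nat \<Rightarrow> complex) \<Rightarrow> (nat \<Rightarrow> nat \<Rightarrow> complex)" where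
  "tauZ Z = (\<lambda>i j. - cnj (Z i j))"

definition hfix :: "nat \<Rightarrow> (nat \<Rightarrow> nat \<Rightarrow> real) \<Rightarrow> (nat \<Rightarrow> nat \<Rightarrow> complex) set" where
  "hfix n \<gamma> = {Z \<in> siegel n. mob n \<gamma> Z = tauZ Z}"

definition colspace :: "nat \<Rightarrow> (nat \<Rightarrow> nat \<Rightarrow> complex) \<Rightarrow> (nat \<Rightarrow> complex) set" where
  "colspace n M = {(\<lambda>i. if i < 2*n then (\<Sum>j<n. M i j * a j) else 0) | a. True}"

definition embZ :: "nat \<Rightarrow> (nat \<Rightarrow> nat \<Rightarrow> complex) \<Rightarrow> (nat \<Rightarrow> complex) set" where
  "embZ n Z = colspace n (\<lambda>i j. if i < n then Z i j else if i = n + j then 1 else 0)"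

text \<open>Standard boundary component F_q: the point lim_Y diag(W, iY) for W in h_q
  is the column space of [W 0; 0 I; I 0; 0 0].\<close>
definition Mq :: "nat \<Rightarrow> nat \<Rightarrow> (nat \<Rightarrow> nat \<Rightarrow> complex) \<Rightarrow> (nat \<Rightarrow> nat \<Rightarrow> complex)" where
  "Mq n q W = (\<lambda>i j. if i < n then (if j < q then W i j else if i = j then 1 else 0)
                     else (if j < q \<and> i = n + j then 1 else 0))"

definition Fstd :: "nat \<Rightarrow> nat \<Rightarrow> (nat \<Rightarrow> complex) set set" where
  "Fstd n q = (\<lambda>W. colspace n (Mq n q W)) ` siegel q"

definition actv :: "nat \<Rightarrow> (nat \<Rightarrow> nat \<Rightarrow> real) \<Rightarrow> (nat \<Rightarrow> complex) \<Rightarrow> (nat \<Rightarrow> complex)" where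
  "actv n g v = (\<lambda>i. if i < 2*n then (\<Sum>j<2*n. of_real (g i j) * v j) else 0)"

definition act :: "nat \<Rightarrow> (nat \<Rightarrow> nat \<Rightarrow> real) \<Rightarrow> (nat \<Rightarrow> complex) set \<Rightarrow> (nat \<Rightarrow> complex) set" where
  "act n g P = actv n g ` P"

definition tauP :: "nat \<Rightarrow> (nat \<Rightarrow> complex) set \<Rightarrow> (nat \<Rightarrow> complex) set" where
  "tauP n P = (\<lambda>v i. if i < n then - cnj (v i) else if i < 2*n then cnj (v i) else 0) ` P"

definition is_bcomp :: "nat \<Rightarrow> (nat \<Rightarrow> complex) set set \<Rightarrow> bool" where
  "is_bcomp n F \<longleftrightarrow> (\<exists>g q. g \<in> SpQ n \<and> q < n \<and> F = act n g ` Fstd n q)"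

definition hbar :: "nat \<Rightarrow> (nat \<Rightarrow> complex) set set" where
  "hbar n = embZ n ` siegel n \<union> \<Union>{F. is_bcomp n F}"

definition Ffix :: "nat \<Rightarrow> (nat \<Rightarrow> complex) set set \<Rightarrow> (nat \<Rightarrow> nat \<Rightarrow> real) \<Rightarrow> (nat \<Rightarrow> complex) set set" where
  "Ffix n F \<gamma> = {x \<in> F. tauP n x = act n \<gamma> x}"

text \<open>Satake topology. Hf is the Hermitian form (1/2i) omega(v, conj v).\<close>
definition Hf :: "nat \<Rightarrow> (nat \<Rightarrow> complex) \<Rightarrow> real" where
  "Hf n v = Im (\<Sum>i<n. v i * cnj (v (n + i)))"

text \<open>Projection to L_q^perp / L_q, where L_q is spanned by e_q,...,e_(n-1).\<close>
definition projset :: "nat \<Rightarrow> nat \<Rightarrow> (nat \<Rightarrow> complex) set \<Rightarrow> (nat \<Rightarrow> complex) set" where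
  "projset n q P = {(\<lambda>i. if i < q then v i else if i < 2*q then v (n + i - q) else 0) | v.
      v \<in> P \<and> (\<forall>j. q \<le> j \<and> j < n \<longrightarrow> v (n + j) = 0)}"

definition hq_open :: "nat \<Rightarrow> (nat \<Rightarrow> nat \<Rightarrow> complex) set \<Rightarrow> bool" where
  "hq_open q V \<longleftrightarrow> V \<subseteq> siegel q \<and> (\<forall>W\<in>V. \<exists>e>0. \<forall>W'\<in>siegel q.
      (\<forall>i<q. \<forall>j<q. cmod (W' i j - W i j) < e) \<longrightarrow> W' \<in> V)"

text \<open>Standard (Gamma_F-saturated Siegel-type) neighbourhoods of points of F_q:
  projection lies in V, and the Schur complement of Im Z with respect to the
  first q coordinates has arithmetic minimum at least K.\<close>
definition Ustd :: "nat \<Rightarrow> nat \<Rightarrow> (nat \<Rightarrow> nat \<Rightarrow> complex) set \<Rightarrow> real \<Rightarrow> (nat \<Rightarrow> complex) set set" where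
  "Ustd n q V K = {P \<in> hbar n. (\<exists>W\<in>V. projset n q P = embZ q W) \<and>
      (\<forall>m::nat \<Rightarrow> int. (\<exists>j. q \<le> j \<and> j < n \<and> m j \<noteq> 0) \<longrightarrow>
         (\<forall>v\<in>P. (\<forall>j. q \<le> j \<and> j < n \<longrightarrow> v (n + j) = of_int (m j)) \<longrightarrow> Hf n v \<ge> K))}"

definition basic_nbhd :: "nat \<Rightarrow> (nat \<Rightarrow> complex) set \<Rightarrow> (nat \<Rightarrow> complex) set set \<Rightarrow> bool" where
  "basic_nbhd n x N \<longleftrightarrow>
     (\<exists>Z e. Z \<in> siegel n \<and> x = embZ n Z \<and> e > 0 \<and>
        N = embZ n ` {W \<in> siegel n. \<forall>i<n. \<forall>j<n. cmod (W i j - Z i j) < e}) \<or>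
     (\<exists>g q V K. g \<in> SpQ n \<and> q < n \<and> hq_open q V \<and> x \<in> act n g ` Fstd n q \<and>
        x \<in> act n g ` Ustd n q V K \<and> N = act n g ` Ustd n q V K)"

definition satake_open :: "nat \<Rightarrow> (nat \<Rightarrow> complex) set set \<Rightarrow> bool" where
  "satake_open n U \<longleftrightarrow> U \<subseteq> hbar n \<and> (\<forall>x\<in>U. \<exists>N. basic_nbhd n x N \<and> N \<subseteq> U)"

definition satake_closure :: "nat \<Rightarrow> (nat \<Rightarrow> complex) set set \<Rightarrow> (nat \<Rightarrow> complex) set set" where
  "satake_closure n S = {x \<in> hbar n. \<forall>U. satake_open n U \<and> x \<in> U \<longrightarrow> U \<inter> S \<noteq> {}}"

end

theory Submission
  imports Defs "Jordan_Normal_Form.Determinant"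
begin

text \<open>
  Write \<open>\<epsilon> = diag(-1, 1)\<close>, so that \<open>\<tau>(v) = \<epsilon> conj(v)\<close> on \<open>C^(2n)\<close>, and put \<open>\<sigma> = \<epsilon> \<gamma>\<close>. This is an integral
  anti-symplectic matrix with \<open>\<sigma> \<equiv> 1 mod 2\<close> and \<open>\<sigma>^2 \<equiv> 1 mod 2^(k+1)\<close>, and \<open>\<tau>(x) = \<gamma> x\<close> means
  \<open>conj(x) = \<sigma> x\<close>. Let \<open>L\<close> be the rational isotropic subspace of \<open>F\<close>; it is the null space of the Hermitian form
  on any \<open>x \<in> F\<close>, so \<open>\<sigma>\<close> preserves \<open>L\<close> once \<open>F^\<gamma>\<close> is nonempty. As \<open>\<sigma>^2\<close> fixes a point of \<open>F\<close> and is
  \<open>1 mod 4\<close>, Minkowski's argument shows that it is trivial on \<open>L^perp / L\<close>.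

  The required \<open>\<gamma>1 = \<epsilon> \<sigma>1\<close> comes from an involution \<open>\<sigma>1 \<equiv> \<sigma> mod 2^k\<close> inducing the same map on \<open>L^perp / L\<close>.
  On \<open>L\<close> one lifts the idempotent \<open>(1 + \<sigma>) / 2 mod 2^(k-1)\<close> to an integral idempotent. This changes \<open>\<sigma>\<close> by a
  Levi element that is \<open>1 mod 2^k\<close>; afterwards \<open>\<sigma>^2\<close> is unipotent and \<open>1 mod 2^(k+1)\<close>, and \<open>\<sigma>1 = \<sigma> (\<sigma>^2)^(-1/2)\<close>.

  Since \<open>\<sigma>1\<close> is an involution, \<open>L^perp\<close> has a \<open>\<sigma>1\<close>-stable isotropic complement \<open>L'\<close>. For \<open>x\<close> in \<open>F^\<gamma>1\<close> the
  Lagrangians spanned by the part of \<open>x\<close> orthogonal to \<open>L'\<close> and by the graph of \<open>i t Y : L' \<rightarrow> L\<close>, with \<open>Y\<close> an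
  invariant positive form, are fixed points in the upper half space that tend to \<open>x\<close> as \<open>t \<rightarrow> \<infinity>\<close>.
\<close>

section \<open>Matrices of finite support\<close>

text \<open>The obstacle is integrality. The usual iteration \<open>3 a^2 - 2 a^3\<close> for
  lifting idempotents converges only 2-adically, so the integral lift splits off one rank at a time,
  starting from an odd entry. The series \<open>(1 + v)^(-1/2)\<close> has denominators 2 and 8; it
  stays in the congruence class because \<open>v\<close> is divisible by \<open>2^(k+1)\<close>, one
  power of 2 more than \<sigma> - \<epsilon>. This gain comes from \<sigma> and \<epsilon> being 1
  mod 2, which makes the cross terms of a square even. Congruences pass to L and to Levi factors
  only in an integral symplectic frame, so the rational basis of L is replaced by a saturated
  integral one with an integral dual.

  Two complements of L occur: an integral one for the congruences and a \<sigma>1-stable one, built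
  with division by 2, for the approximation. The data of a boundary point are therefore kept apart
  from the choice of complement. The fixed-point sets agree because \<sigma>1 and \<sigma> differ on
  L^perp only by vectors of L, and every point of F contains L.\<close>

text \<open>
  Infinite matrices of finite support form a ring, so that matrices of all shapes live in one type and
  products need no dimension side conditions. The shape enters only through the predicates \<open>rws\<close> (at most \<open>r\<close> rows) and
  \<open>cls\<close>, and \<open>idm n\<close> is a unit only for matrices of matching shape. Vectors are matrices with one column.
\<close>

typedef (overloaded) 'a fmat = "{M :: nat \<Rightarrow> nat \<Rightarrow> 'a::zero. \<exists>N. zero_outside N N M}"
  morphisms entry Fmat
  by (rule exI[of _ "\<lambda>i j. 0"]) (simp add: zero_outside_def)

lemma fmat_eqI: "(\<And>i j. entry A i j = entry B i j) \<Longrightarrow> A = B"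
  by (metis entry_inject ext)

lemma entry_Fmat: "zero_outside r c M \<Longrightarrow> entry (Fmat M) = M"
  by (rule Fmat_inverse) (auto simp: zero_outside_def intro!: exI[of _ "max r c"])

lemma entry_bound: obtains N where "\<And>i j. N \<le> i \<or> N \<le> j \<Longrightarrow> entry A i j = 0"
  using entry[of A] by (auto simp: zero_outside_def)

definition mk :: "nat \<Rightarrow> nat \<Rightarrow> (nat \<Rightarrow> nat \<Rightarrow> 'a::zero) \<Rightarrow> 'a fmat" where
  "mk r c f = Fmat (\<lambda>i j. if i < r \<and> j < c then f i j else 0)"

lemma entry_mk [simp]: "entry (mk r c f) i j = (if i < r \<and> j < c then f i j else 0)"
  unfolding mk_def by (subst entry_Fmat[of r c]) (auto simp: zero_outside_def)

definition rws :: "nat \<Rightarrow> 'a::zero fmat \<Rightarrow> bool" where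
  "rws r A \<longleftrightarrow> (\<forall>i j. r \<le> i \<longrightarrow> entry A i j = 0)"

definition cls :: "nat \<Rightarrow> 'a::zero fmat \<Rightarrow> bool" where
  "cls c A \<longleftrightarrow> (\<forall>i j. c \<le> j \<longrightarrow> entry A i j = 0)"

lemma rws_mk [simp]: "r \<le> r' \<Longrightarrow> rws r' (mk r c f)"
  and cls_mk [simp]: "c \<le> c' \<Longrightarrow> cls c' (mk r c f)"
  by (auto simp: rws_def cls_def)

lemma rws_cls_ex: obtains N where "rws N A" "cls N A"
  by (rule entry_bound[of A]) (auto simp: rws_def cls_def)

instantiation fmat :: (comm_ring_1) ring
begin

definition zero_fmat :: "'a fmat" where "0 = Fmat (\<lambda>i j. 0)"
definition plus_fmat :: "'a fmat \<Rightarrow> 'a fmat \<Rightarrow> 'a fmat" where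
  "A + B = Fmat (\<lambda>i j. entry A i j + entry B i j)"
definition uminus_fmat :: "'a fmat \<Rightarrow> 'a fmat" where
  "- A = Fmat (\<lambda>i j. - entry A i j)"
definition minus_fmat :: "'a fmat \<Rightarrow> 'a fmat \<Rightarrow> 'a fmat" where
  "A - B = Fmat (\<lambda>i j. entry A i j - entry B i j)"
text \<open>The support of row \<open>i\<close> of \<open>A\<close> is a finite index set that
  exists without any size; \<open>entry_times\<close> replaces it by any bound on the columns of
  \<open>A\<close> or the rows of \<open>B\<close>.\<close>

definition times_fmat :: "'a fmat \<Rightarrow> 'a fmat \<Rightarrow> 'a fmat" where
  "A * B = Fmat (\<lambda>i j. \<Sum>k | entry A i k \<noteq> 0. entry A i k * entry B k j)"

lemma entry_zero: "entry (0 :: 'a fmat) i j = 0"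
  unfolding zero_fmat_def by (subst entry_Fmat[of 0 0]) (auto simp: zero_outside_def)

lemma entry_plus: "entry (A + B :: 'a fmat) i j = entry A i j + entry B i j"
proof -
  obtain M N where "rws M A" "cls M A" "rws N B" "cls N B" by (metis rws_cls_ex)
  then show ?thesis unfolding plus_fmat_def
    by (subst entry_Fmat[of "max M N" "max M N"]) (auto simp: zero_outside_def rws_def cls_def)
qed

lemma entry_uminus: "entry (- A :: 'a fmat) i j = - entry A i j"
proof -
  obtain M where "rws M A" "cls M A" by (metis rws_cls_ex)
  then show ?thesis unfolding uminus_fmat_def
    by (subst entry_Fmat[of M M]) (auto simp: zero_outside_def rws_def cls_def)
qed

lemma entry_minus: "entry (A - B :: 'a fmat) i j = entry A i j - entry B i j"
proof -
  obtain M N where "rws M A" "cls M A" "rws N B" "cls N B" by (metis rws_cls_ex)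
  then show ?thesis unfolding minus_fmat_def
    by (subst entry_Fmat[of "max M N" "max M N"]) (auto simp: zero_outside_def rws_def cls_def)
qed

lemma entry_times0:
  "entry (A * B :: 'a fmat) i j = (\<Sum>k | entry A i k \<noteq> 0. entry A i k * entry B k j)"
proof -
  obtain M N where "rws M A" "cls M A" "rws N B" "cls N B" by (metis rws_cls_ex)
  then show ?thesis unfolding times_fmat_def
    by (subst entry_Fmat[of M N]) (auto simp: zero_outside_def rws_def cls_def)
qed

lemma entry_times_cls:
  assumes "cls N (A :: 'a fmat)"
  shows "entry (A * B) i j = (\<Sum>k<N. entry A i k * entry B k j)"
  unfolding entry_times0
proof (rule sum.mono_neutral_left)
  show "{k. entry A i k \<noteq> 0} \<subseteq> {..<N}"
    using assms by (auto simp: cls_def) (meson not_le_imp_less)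
qed auto

instance
proof
  fix A B C :: "'a fmat"
  note [simp] = entry_zero entry_plus entry_minus entry_uminus
  show "A + B + C = A + (B + C)" "A + B = B + A" "0 + A = A" "- A + A = 0" "A - B = A + - B"
    by (auto intro!: fmat_eqI)
  obtain M N where M: "cls M A" and N: "cls N B" by (metis rws_cls_ex)
  have MN: "cls N (A * B)"
    using N by (auto simp: cls_def entry_times0)
  show "A * B * C = A * (B * C)"
  proof (rule fmat_eqI)
    fix i j
    have "entry (A * B * C) i j = (\<Sum>l<N. \<Sum>k<M. entry A i k * entry B k l * entry C l j)"
      by (simp add: entry_times_cls[OF MN] entry_times_cls[OF M] sum_distrib_right)
    also have "\<dots> = (\<Sum>k<M. \<Sum>l<N. entry A i k * entry B k l * entry C l j)"
      by (rule sum.swap)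
    also have "\<dots> = entry (A * (B * C)) i j"
      by (simp add: entry_times_cls[OF M] entry_times_cls[OF N] sum_distrib_left mult.assoc)
    finally show "entry (A * B * C) i j = entry (A * (B * C)) i j" .
  qed
  obtain M' where M': "cls M' A" "cls M' B"
  proof -
    have "cls (max M N) A" "cls (max M N) B" using M N by (auto simp: cls_def)
    then show ?thesis using that by blast
  qed
  then have "cls M' (A + B)" by (auto simp: cls_def)
  then show "(A + B) * C = A * C + B * C"
    by (intro fmat_eqI) (simp add: entry_times_cls[OF \<open>cls M' (A + B)\<close>] entry_times_cls[OF M'(1)]
      entry_times_cls[OF M'(2)] sum.distrib distrib_right)
  show "A * (B + C) = A * B + A * C"
    by (intro fmat_eqI) (simp add: entry_times_cls[OF M] sum.distrib distrib_left)
qed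

end

lemmas entry_simps [simp] = entry_zero entry_plus entry_minus entry_uminus

lemma entry_times: "cls N A \<or> rws N B \<Longrightarrow> entry (A * B) i j = (\<Sum>k<N. entry A i k * entry B k j)"
proof (cases "cls N A")
  case True
  then show ?thesis by (rule entry_times_cls)
next
  case False
  assume "cls N A \<or> rws N B"
  with False have B: "rws N B" by simp
  obtain M where "cls M A" by (metis rws_cls_ex)
  then have M: "cls (max M N) A" by (auto simp: cls_def)
  show ?thesis unfolding entry_times_cls[OF M]
    by (rule sum.mono_neutral_right) (use B in \<open>auto simp: rws_def\<close>)
qed

lemma rws_simps [simp]: "rws r 0" "rws r A \<Longrightarrow> rws r B \<Longrightarrow> rws r (A + B)"
  "rws r A \<Longrightarrow> rws r B \<Longrightarrow> rws r (A - B)" "rws r A \<Longrightarrow> rws r (- A)" "rws r A \<Longrightarrow> rws r (A * B)"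
  by (auto simp: rws_def entry_times0)

lemma cls_simps [simp]: "cls r 0" "cls r A \<Longrightarrow> cls r B \<Longrightarrow> cls r (A + B)"
  "cls r A \<Longrightarrow> cls r B \<Longrightarrow> cls r (A - B)" "cls r A \<Longrightarrow> cls r (- A)" "cls r B \<Longrightarrow> cls r (A * B)"
  by (auto simp: cls_def entry_times0)

lemma rws_mono: "rws r A \<Longrightarrow> r \<le> r' \<Longrightarrow> rws r' A"
  and cls_mono: "cls r A \<Longrightarrow> r \<le> r' \<Longrightarrow> cls r' A"
  by (auto simp: rws_def cls_def)

definition idm :: "nat \<Rightarrow> 'a::comm_ring_1 fmat" where
  "idm n = mk n n (\<lambda>i j. if i = j then 1 else 0)"

lemma entry_idm [simp]: "entry (idm n) i j = (if i = j \<and> i < n then 1 else 0)"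
  by (auto simp: idm_def)

lemma rws_idm [simp]: "n \<le> m \<Longrightarrow> rws m (idm n)"
  and cls_idm [simp]: "n \<le> m \<Longrightarrow> cls m (idm n)"
  by (auto simp: idm_def)

lemma idm_mult [simp]: "rws n A \<Longrightarrow> idm n * A = A"
proof (rule fmat_eqI)
  fix i j
  assume "rws n A"
  have "entry (idm n * A) i j = (\<Sum>k<n. if k = i then entry A k j else 0)"
    unfolding entry_times[OF disjI1, OF cls_idm[OF order.refl]] by (rule sum.cong) auto
  then show "entry (idm n * A) i j = entry A i j"
    using \<open>rws n A\<close> by (auto simp: rws_def)
qed

lemma mult_idm [simp]: "cls n A \<Longrightarrow> A * idm n = A"
proof (rule fmat_eqI)
  fix i j
  assume A: "cls n A"
  have "entry (A * idm n) i j = (\<Sum>k<n. if k = j then entry A i k else 0)"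
    unfolding entry_times[OF disjI1, OF A] by (rule sum.cong) auto
  then show "entry (A * idm n) i j = entry A i j"
    using A by (auto simp: cls_def)
qed

definition tr :: "'a::comm_ring_1 fmat \<Rightarrow> 'a fmat" where
  "tr A = Fmat (\<lambda>i j. entry A j i)"

lemma entry_tr [simp]: "entry (tr A) i j = entry A j i"
proof -
  obtain M where "rws M A" "cls M A" by (metis rws_cls_ex)
  then show ?thesis unfolding tr_def
    by (subst entry_Fmat[of M M]) (auto simp: zero_outside_def rws_def cls_def)
qed

lemma rws_tr [simp]: "rws r (tr A) = cls r A"
  and cls_tr [simp]: "cls r (tr A) = rws r A"
  by (auto simp: rws_def cls_def)

lemma tr_simps [simp]: "tr 0 = 0" "tr (A + B) = tr A + tr B" "tr (A - B) = tr A - tr B"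
  "tr (- A) = - tr A" "tr (tr A) = A" "tr (idm n) = idm n"
  by (auto intro!: fmat_eqI)

lemma tr_mult [simp]: "tr (A * B) = tr B * tr A"
proof -
  obtain M where "cls M A" by (metis rws_cls_ex)
  then show ?thesis by (intro fmat_eqI) (simp add: entry_times[of M] mult.commute)
qed

definition scl :: "'a::comm_ring_1 \<Rightarrow> 'a fmat \<Rightarrow> 'a fmat" where
  "scl c A = Fmat (\<lambda>i j. c * entry A i j)"

lemma entry_scl [simp]: "entry (scl c A) i j = c * entry A i j"
proof -
  obtain M where "rws M A" "cls M A" by (metis rws_cls_ex)
  then show ?thesis unfolding scl_def
    by (subst entry_Fmat[of M M]) (auto simp: zero_outside_def rws_def cls_def)
qed

lemma rws_scl [simp]: "rws r A \<Longrightarrow> rws r (scl c A)"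
  and cls_scl [simp]: "cls r A \<Longrightarrow> cls r (scl c A)"
  by (auto simp: rws_def cls_def)

lemma scl_simps [simp]: "scl c 0 = 0" "scl 0 A = 0" "scl 1 A = A" "scl c (scl d A) = scl (c * d) A"
  "tr (scl c A) = scl c (tr A)"
  by (auto intro!: fmat_eqI)

lemma scl_distribs: "scl c (A + B) = scl c A + scl c B" "scl c (A - B) = scl c A - scl c B"
  "scl c (- A) = - scl c A" "scl (- c) A = - scl c A"
  "scl (c + d) A = scl c A + scl d A" "scl (c - d) A = scl c A - scl d A"
  by (auto intro!: fmat_eqI simp: algebra_simps)

lemma scl_mult_left [simp]: "scl c A * B = scl c (A * B)"
proof -
  obtain M where "cls M A" by (metis rws_cls_ex)
  then show ?thesis
    by (intro fmat_eqI) (simp add: entry_times[of M] sum_distrib_left mult.assoc)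
qed

lemma scl_mult_right [simp]: "A * scl c B = scl c (A * B)"
proof -
  obtain M where "cls M A" by (metis rws_cls_ex)
  then show ?thesis
    by (intro fmat_eqI) (simp add: entry_times[of M] sum_distrib_left mult.left_commute)
qed

lemma mult_assoc_eq: "A * B = C \<Longrightarrow> A * (B * X) = C * (X :: 'a::semigroup_mult)"
  by (simp add: mult.assoc[symmetric])

lemmas mdistribs = distrib_left distrib_right left_diff_distrib right_diff_distrib mult.assoc

section \<open>Entrywise maps between real, complex and integral matrices; congruences and
  inverses\<close>

definition mapm :: "('a::comm_ring_1 \<Rightarrow> 'b::comm_ring_1) \<Rightarrow> 'a fmat \<Rightarrow> 'b fmat" where
  "mapm f A = Fmat (\<lambda>i j. f (entry A i j))"

lemma entry_mapm: "f 0 = 0 \<Longrightarrow> entry (mapm f A) i j = f (entry A i j)"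
proof -
  assume f: "f 0 = 0"
  obtain M where "rws M A" "cls M A" by (metis rws_cls_ex)
  with f show ?thesis unfolding mapm_def
    by (subst entry_Fmat[of M M]) (auto simp: zero_outside_def rws_def cls_def)
qed

lemma mapm_mult:
  assumes "f 0 = 0" "\<And>x y. f (x + y) = f x + f y" "\<And>x y. f (x * y) = f x * f y"
  shows "mapm f (A * B) = mapm f A * mapm f B"
proof -
  obtain M where M: "cls M A" by (metis rws_cls_ex)
  then have M': "cls M (mapm f A)" using assms(1) by (auto simp: cls_def entry_mapm)
  have s: "f (\<Sum>k<K. g k) = (\<Sum>k<K. f (g k))" for K :: nat and g
    by (induction K) (auto simp: assms)
  from M M' show ?thesis using assms
    by (intro fmat_eqI) (simp add: entry_times[of M] entry_mapm s)
qed

abbreviation cm :: "real fmat \<Rightarrow> complex fmat" where "cm \<equiv> mapm complex_of_real"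
abbreviation cj :: "complex fmat \<Rightarrow> complex fmat" where "cj \<equiv> mapm cnj"
abbreviation zr :: "int fmat \<Rightarrow> real fmat" where "zr \<equiv> mapm real_of_int"

lemma entry_maps [simp]: "entry (cm A) i j = of_real (entry A i j)"
  "entry (cj C) i j = cnj (entry C i j)" "entry (zr Z) i j = of_int (entry Z i j)"
  by (simp_all add: entry_mapm)

lemma maps_simps [simp]:
  "cm (A * B) = cm A * cm B" "cj (C * D) = cj C * cj D" "zr (X * Y) = zr X * zr Y"
  "cm (A + B) = cm A + cm B" "cj (C + D) = cj C + cj D" "zr (X + Y) = zr X + zr Y"
  "cm (A - B) = cm A - cm B" "cj (C - D) = cj C - cj D" "zr (X - Y) = zr X - zr Y"
  "cm (- A) = - cm A" "cj (- C) = - cj C"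
  "cm 0 = 0" "cj 0 = 0" "cm (idm n) = idm n" "cj (idm n) = idm n" "zr (idm n) = idm n"
  "cj (cm A) = cm A" "cj (cj C) = C"
  "cm (tr A) = tr (cm A)" "cj (tr C) = tr (cj C)"
  "cm (scl r A) = scl (of_real r) (cm A)" "cj (scl c C) = scl (cnj c) (cj C)"
  "zr (scl z X) = scl (of_int z) (zr X)"
  by (simp_all add: mapm_mult) (auto intro!: fmat_eqI)

lemma maps_dims [simp]: "rws r (cm A) = rws r A" "cls r (cm A) = cls r A"
  "rws r (cj C) = rws r C" "cls r (cj C) = cls r C" "rws r (zr X) = rws r X" "cls r (zr X) = cls r X"
  by (auto simp: rws_def cls_def)

lemma cm_inject [simp]: "cm A = cm B \<longleftrightarrow> A = B"
proof
  assume "cm A = cm B"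
  then have "entry (cm A) i j = entry (cm B) i j" for i j by simp
  then show "A = B" by (intro fmat_eqI) simp
qed simp

text \<open>Congruence to 0 modulo \<open>N\<close>, with \<open>dvm 1\<close> as integrality. The
  modulus is real so that division by 2, 4 or 8 is again a scaling, handled by
  \<open>dvm_scl\<close>.\<close>

definition dvm :: "real \<Rightarrow> real fmat \<Rightarrow> bool" where
  "dvm N A \<longleftrightarrow> (\<forall>i j. \<exists>z::int. entry A i j = N * of_int z)"

lemma dvm_ex: "dvm N A \<Longrightarrow> \<exists>C. dvm 1 C \<and> A = scl N C"
proof -
  assume d: "dvm N A"
  show ?thesis
  proof (cases "N = 0")
    case True
    with d have "A = 0" by (auto simp: dvm_def intro!: fmat_eqI)
    then show ?thesis by (intro exI[of _ 0]) (auto simp: dvm_def intro: exI[of _ 0])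
  next
    case False
    have "dvm 1 (scl (1/N) A)" "A = scl N (scl (1/N) A)"
      using d False by (auto simp: dvm_def intro!: fmat_eqI) (metis False nonzero_mult_div_cancel_left)
    then show ?thesis by blast
  qed
qed

lemma dvm_simps [simp]: "dvm N 0" "dvm N A \<Longrightarrow> dvm N B \<Longrightarrow> dvm N (A + B)"
  "dvm N A \<Longrightarrow> dvm N B \<Longrightarrow> dvm N (A - B)" "dvm N A \<Longrightarrow> dvm N (- A)" "dvm N (tr A) = dvm N A" "dvm 1 (idm n)"
  "dvm 1 (zr Z)"
proof -
  show "dvm N A \<Longrightarrow> dvm N B \<Longrightarrow> dvm N (A + B)"
    unfolding dvm_def by (auto, metis distrib_left of_int_add)
  show "dvm N A \<Longrightarrow> dvm N B \<Longrightarrow> dvm N (A - B)"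
    unfolding dvm_def by (auto, metis right_diff_distrib of_int_diff)
  show "dvm N A \<Longrightarrow> dvm N (- A)"
    unfolding dvm_def by (auto, metis mult_minus_right of_int_minus)
qed (auto simp: dvm_def intro: exI[of _ 0] exI[of _ 1])

lemma sum_mult_int: "\<forall>k<n. \<exists>z::int. f k = N * of_int z \<Longrightarrow> \<exists>z::int. (\<Sum>k<n. f k) = (N::real) * of_int z" for n :: nat
proof (induction n)
  case 0
  then show ?case by (auto intro: exI[of _ 0])
next
  case (Suc n)
  then obtain y z :: int where "(\<Sum>k<n. f k) = N * of_int y" "f n = N * of_int z"
    by (metis lessI less_Suc_eq)
  then show ?case by (auto simp: distrib_left intro!: exI[of _ "y + z"])
qed

lemma dvm_mult: "dvm N A \<Longrightarrow> dvm M B \<Longrightarrow> dvm (N * M) (A * B)"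
proof -
  assume A: "dvm N A" and B: "dvm M B"
  obtain K where K: "cls K A" by (metis rws_cls_ex)
  have "\<exists>z::int. entry A i k * entry B k j = N * M * of_int z" for i j k
  proof -
    obtain x y :: int where "entry A i k = N * of_int x" "entry B k j = M * of_int y"
      using A B unfolding dvm_def by meson
    then show ?thesis by (intro exI[of _ "x * y"]) simp
  qed
  then show ?thesis unfolding dvm_def entry_times[OF disjI1[OF K]]
    by (intro allI sum_mult_int) auto
qed

lemma dvm_mult_simps [simp]: "dvm N A \<Longrightarrow> dvm 1 B \<Longrightarrow> dvm N (A * B)" "dvm 1 A \<Longrightarrow> dvm N B \<Longrightarrow> dvm N (A * B)"
  using dvm_mult[of N A 1 B] dvm_mult[of 1 A N B] by simp_all

lemma dvm_scl: "dvm N A \<Longrightarrow> dvm (c * N) (scl c A)"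
  unfolding dvm_def entry_scl by (metis mult.assoc)

lemma dvm_weaken: "dvm (N * of_int k) A \<Longrightarrow> dvm N A"
  unfolding dvm_def by (metis mult.assoc of_int_mult)

lemma zr_ex: "dvm 1 A \<Longrightarrow> \<exists>Z. A = zr Z"
proof -
  assume "dvm 1 A"
  obtain M where M: "rws M A" "cls M A" by (metis rws_cls_ex)
  have "A = zr (mk M M (\<lambda>i j. \<lfloor>entry A i j\<rfloor>))"
  proof (rule fmat_eqI)
    fix i j
    obtain z :: int where "entry A i j = of_int z" using \<open>dvm 1 A\<close> by (auto simp: dvm_def)
    then show "entry A i j = entry (zr (mk M M (\<lambda>i j. \<lfloor>entry A i j\<rfloor>))) i j"
      using M by (auto simp: rws_def cls_def not_less)
  qed
  then show ?thesis by blast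
qed

text \<open>Transfer to matrices with a fixed size: a vanishing determinant would give a kernel
  vector against \<open>inj\<close>, and a nonzero one gives a two-sided inverse.\<close>

lemma inverse_ex:
  fixes A :: "'a::field fmat"
  assumes A: "rws n A" "cls n A"
    and inj: "\<And>a. rws n a \<Longrightarrow> cls 1 a \<Longrightarrow> A * a = 0 \<Longrightarrow> a = 0"
  obtains B where "rws n B" "cls n B" "A * B = idm n" "B * A = idm n"
proof -
  define M where "M = mat n n (\<lambda>(i, j). entry A i j)"
  have M: "M \<in> carrier_mat n n" by (simp add: M_def)
  have "det M \<noteq> 0"
  proof
    assume "det M = 0"
    then obtain v where v: "v \<in> carrier_vec n" "v \<noteq> 0\<^sub>v n" "M *\<^sub>v v = 0\<^sub>v n"
      using det_0_iff_vec_prod_zero[OF M] by blast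
    define a where "a = mk n 1 (\<lambda>i j. v $ i)"
    have "A * a = 0"
    proof (rule fmat_eqI)
      fix i j
      show "entry (A * a) i j = entry 0 i j"
      proof (cases "i < n \<and> j < 1")
        case True
        have "(M *\<^sub>v v) $ i = (\<Sum>k<n. entry A i k * v $ k)"
          using True v(1) by (simp add: M_def scalar_prod_def lessThan_atLeast0)
        with True show ?thesis by (simp add: entry_times[of n] A a_def v(3))
      next
        case False
        then show ?thesis using A(1) by (auto simp: entry_times[of n] A a_def rws_def)
      qed
    qed
    then have "a = 0" using inj[of a] by (simp add: a_def)
    then have z: "entry a i 0 = 0" for i by simp
    have "v $ i = 0" if "i < n" for i using z[of i] that by (simp add: a_def)
    then have "v = 0\<^sub>v n" using v(1) by (intro eq_vecI) auto
    with v(2) show False by simp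
  qed
  \<comment> \<open>\<open>undefined\<close> fills the record-extension slot of
    \<open>ring_mat\<close>.\<close>
  from det_non_zero_imp_unit[OF M this, of undefined]
  obtain N where N: "N \<in> carrier_mat n n" "M * N = 1\<^sub>m n" "N * M = 1\<^sub>m n"
    by (auto simp: Units_def ring_mat_def)
  define B where "B = mk n n (\<lambda>i j. N $$ (i, j))"
  have "entry (A * B) i j = entry (idm n) i j" for i j
  proof (cases "i < n \<and> j < n")
    case True
    then have "(M * N) $$ (i, j) = (\<Sum>k<n. entry A i k * N $$ (k, j))"
      using N(1) by (simp add: M_def scalar_prod_def lessThan_atLeast0)
    with True show ?thesis by (simp add: entry_times[of n] A B_def N(2))
  qed (use A in \<open>auto simp: entry_times[of n] A B_def rws_def\<close>)
  moreover have "entry (B * A) i j = entry (idm n) i j" for i j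
  proof (cases "i < n \<and> j < n")
    case True
    then have "(N * M) $$ (i, j) = (\<Sum>k<n. N $$ (i, k) * entry A k j)"
      using N(1) by (simp add: M_def scalar_prod_def lessThan_atLeast0)
    with True show ?thesis by (simp add: entry_times[of n] A B_def N(3))
  qed (use A in \<open>auto simp: entry_times[of n] A B_def cls_def\<close>)
  ultimately show ?thesis by (intro that[of B] fmat_eqI) (auto simp: B_def)
qed

section \<open>Integral lifts and saturated bases\<close>

text \<open>Idempotents are lifted over \<open>int\<close>, where parity and Bezout are at hand;
  \<open>zr\<close> carries the result back to real matrices.\<close>

definition dvd_fmat :: "int \<Rightarrow> int fmat \<Rightarrow> bool" where
  "dvd_fmat M A \<longleftrightarrow> (\<exists>C. A = scl M C)"

lemma dvd_fmat_simps [simp]: "dvd_fmat M 0" "dvd_fmat M A \<Longrightarrow> dvd_fmat M B \<Longrightarrow> dvd_fmat M (A + B)"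
  "dvd_fmat M A \<Longrightarrow> dvd_fmat M B \<Longrightarrow> dvd_fmat M (A - B)" "dvd_fmat M A \<Longrightarrow> dvd_fmat M (- A)"
  "dvd_fmat M A \<Longrightarrow> dvd_fmat M (A * B)" "dvd_fmat M A \<Longrightarrow> dvd_fmat M (B * A)" "dvd_fmat M (scl M A)"
  unfolding dvd_fmat_def
  by (metis scl_simps(1) scl_distribs scl_mult_left scl_mult_right)+

lemma dvd_fmat_scl: "dvd_fmat M A \<Longrightarrow> dvd_fmat M (scl c A)"
  unfolding dvd_fmat_def by (metis mult.commute scl_simps(4))

definition unit_fmat :: "nat \<Rightarrow> nat \<Rightarrow> 'a::comm_ring_1 fmat" where
  "unit_fmat i j = mk (Suc i) (Suc j) (\<lambda>a b. if a = i \<and> b = j then 1 else 0)"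

lemma entry_unit_fmat [simp]: "entry (unit_fmat i j) a b = (if a = i \<and> b = j then 1 else 0)"
  by (auto simp: unit_fmat_def)

lemma unit_fmat_dims [simp]: "rws r (unit_fmat i j) \<longleftrightarrow> i < r" "cls r (unit_fmat i j) \<longleftrightarrow> j < r"
  by (auto simp: rws_def cls_def) (metis not_le)+

lemma entry_mult_unit_fmat [simp]: "entry (A * unit_fmat i j) a b = (if b = j then entry A a i else 0)"
proof -
  obtain M where M: "rws M A" "cls M A" by (metis rws_cls_ex)
  have "entry (A * unit_fmat i j) a b = (\<Sum>k<max M (Suc i). entry A a k * entry (unit_fmat i j) k b)"
    by (rule entry_times) (use M cls_mono in \<open>auto\<close>)
  also have "\<dots> = (\<Sum>k<max M (Suc i). if k = i then (if b = j then entry A a i else 0) else 0)"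
    by (rule sum.cong) auto
  finally show ?thesis by (simp add: less_max_iff_disj)
qed

lemma entry_unit_fmat_mult [simp]: "entry (unit_fmat i j * A) a b = (if a = i then entry A j b else 0)"
proof -
  have "entry (unit_fmat i j * A) a b = (\<Sum>k<Suc j. entry (unit_fmat i j) a k * entry A k b)"
    by (rule entry_times) auto
  also have "\<dots> = (\<Sum>k<Suc j. if k = j then (if a = i then entry A j b else 0) else 0)"
    by (rule sum.cong) auto
  finally show ?thesis by simp
qed

lemma unit_fmat_mult_unit_fmat [simp]: "unit_fmat i j * unit_fmat k l = (if j = k then unit_fmat i l else 0)"
  by (rule fmat_eqI) auto

text \<open>The coordinate projection for an arbitrary finite index set, since the lifting induction
  removes whichever index carries an odd entry.\<close>

definition diag_fmat :: "nat set \<Rightarrow> 'a::comm_ring_1 fmat" where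
  "diag_fmat S = Fmat (\<lambda>i j. if i = j \<and> i \<in> S then 1 else 0)"

lemma entry_diag_fmat: "finite S \<Longrightarrow> entry (diag_fmat S) i j = (if i = j \<and> i \<in> S then 1 else 0)"
proof -
  assume "finite S"
  then obtain N where "S \<subseteq> {..<N}"
    by (meson finite_nat_iff_bounded)
  then show ?thesis
    unfolding diag_fmat_def by (subst entry_Fmat[of N N]) (auto simp: zero_outside_def)
qed

lemma entry_diag_fmat_mult:
  fixes A :: "'a::comm_ring_1 fmat"
  assumes "finite S"
  shows "entry (diag_fmat S * A) i j = (if i \<in> S then entry A i j else 0)"
proof -
  obtain N where N: "S \<subseteq> {..<N}" using assms by (meson finite_nat_iff_bounded)
  have "cls N (diag_fmat S :: 'a fmat)" using assms N by (auto simp: cls_def entry_diag_fmat)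
  then have "entry (diag_fmat S * A) i j = (\<Sum>k<N. entry (diag_fmat S) i k * entry A k j)"
    by (intro entry_times) simp
  also have "\<dots> = (\<Sum>k<N. if k = i then (if i \<in> S then entry A i j else 0) else 0)"
    by (rule sum.cong) (auto simp: entry_diag_fmat assms)
  finally show ?thesis using N by auto
qed

lemma tr_diag_fmat: "finite S \<Longrightarrow> tr (diag_fmat S) = diag_fmat S"
  by (rule fmat_eqI) (auto simp: entry_diag_fmat)

lemma entry_mult_diag_fmat: assumes "finite S"
  shows "entry (A * diag_fmat S) i j = (if j \<in> S then entry A i j else 0)"
proof -
  have "entry (A * diag_fmat S) i j = entry (tr (diag_fmat S) * tr A) j i"
    by (simp flip: tr_mult)
  then show ?thesis by (simp add: tr_diag_fmat entry_diag_fmat_mult assms)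
qed

text \<open>Modulo \<open>2^j\<close> the matrix equals its square, and if \<open>2^i\<close> and 2
  both divide \<open>a\<close>, then \<open>2^(i+1)\<close> divides \<open>a * a\<close>; so the
  power of 2 dividing \<open>a\<close> climbs up to \<open>j\<close>.\<close>

lemma even_idempotent_zero:
  assumes "dvd_fmat 2 a" "dvd_fmat (2 ^ j) (a * a - a)"
  shows "dvd_fmat (2 ^ j) a"
proof -
  have "i \<le> j \<Longrightarrow> dvd_fmat (2 ^ i) a" for i
  proof (induction i)
    case 0
    have "a = scl (2 ^ 0) a" by simp
    then show ?case unfolding dvd_fmat_def by blast
  next
    case (Suc i)
    have "dvd_fmat (2 ^ i) a" using Suc by simp
    then obtain b c d where b: "a = scl (2 ^ i) b" and c: "a * a - a = scl (2 ^ j) c" and d: "a = scl 2 d"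
      using assms unfolding dvd_fmat_def by blast
    have "a = a * a - scl (2 ^ j) c" using c by (simp add: algebra_simps)
    also have "a * a = scl (2 ^ Suc i) (b * d)"
      by (subst (1) b, subst (1) d) (simp add: mult.commute)
    also have "scl (2 ^ j) c = scl (2 ^ Suc i) (scl (2 ^ (j - Suc i)) c)"
      using Suc.prems by (simp flip: power_Suc power_add)
    finally show ?case by (metis dvd_fmat_simps(3,7))
  qed
  then show ?thesis by simp
qed

text \<open>
  The column \<open>V\<close> is an eigenvector of \<open>a\<close> modulo \<open>M\<close> with entry 1 in the place \<open>e\<close>; conjugating by the unipotent
  \<open>P + V - e\<close> makes \<open>a\<close> block triangular modulo \<open>M\<close>, and only the smaller block \<open>p a p\<close> has to be lifted.
\<close>

lemma idempotent_step:
  fixes a V e P p b1 :: "int fmat"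
  assumes P: "P * a = a" "a * P = a" "P * e = e" "e * P = e" "P * V = V" "V * P = V" "P * P = P"
    and e: "e * e = e" "V * e = V" "e * V = e"
    and p: "p = P - e"
    and idem: "dvd_fmat M (a * a - a)" and aV: "dvd_fmat M (a * V - V)"
    and IH: "\<And>b. p * b = b \<Longrightarrow> b * p = b \<Longrightarrow> dvd_fmat M (b * b - b) \<Longrightarrow>
      \<exists>b1. p * b1 = b1 \<and> b1 * p = b1 \<and> b1 * b1 = b1 \<and> dvd_fmat M (b1 - b)"
  shows "\<exists>a1. P * a1 = a1 \<and> a1 * P = a1 \<and> a1 * a1 = a1 \<and> dvd_fmat M (a1 - a)"
proof -
  note PA = P P[THEN mult_assoc_eq] e e[THEN mult_assoc_eq]
  have VV: "V * V = V" using e by (metis mult.assoc)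
  note PA = PA VV VV[THEN mult_assoc_eq]
  \<comment> \<open>The square of \<open>V - e\<close> is 0, so \<open>h\<close> and
    \<open>h'\<close> are mutually inverse in the corner ring with unit \<open>P\<close>.\<close>
  define h where "h = P + V - e"
  define h' where "h' = P - V + e"
  have hh: "h * h' = P" "h' * h = P" "P * h = h" "h * P = h" "P * h' = h'" "h' * P = h'"
    by (simp_all add: h_def h'_def mdistribs PA)
  define a' where "a' = h' * a * h"
  have he: "h * e = V" "h' * V = e" by (simp_all add: h_def h'_def mdistribs PA)
  note hs = hh hh[THEN mult_assoc_eq] he he[THEN mult_assoc_eq]
  have a'P: "P * a' = a'" "a' * P = a'" by (simp_all add: a'_def hs PA mdistribs)
  have "a' * e - e = h' * (a * V - V)"
    by (simp add: a'_def mdistribs hs)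
  then have a'e: "dvd_fmat M (a' * e - e)" using aV by simp
  have "a' * a' - a' = h' * (a * a - a) * h"
    by (simp add: a'_def mdistribs hs PA)
  then have a'a': "dvd_fmat M (a' * a' - a')" using idem by simp
  have pe: "p * e = 0" "e * p = 0" "p * p = p" "p * P = p" "P * p = p"
    by (simp_all add: p mdistribs PA)
  note pair_span = PA pe pe[THEN mult_assoc_eq] a'P a'P[THEN mult_assoc_eq]
  define b where "b = p * a' * p"
  have a'pa': "a' * (p * X) = a' * X - a' * (e * X)" for X
  proof -
    have "a' * (p * X) = a' * P * X - a' * (e * X)" unfolding p by (simp add: mdistribs)
    then show ?thesis by (simp add: a'P)
  qed
  have "b * b - b = p * (a' * a' - a') * p - p * (a' * e - e) * a' * p"
    by (simp add: b_def mdistribs pair_span a'pa')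
  then have "dvd_fmat M (b * b - b)" using a'a' a'e by simp
  moreover have "p * b = b" "b * p = b" by (simp_all add: b_def pair_span mdistribs)
  ultimately obtain b1 where b1: "p * b1 = b1" "b1 * p = b1" "b1 * b1 = b1" "dvd_fmat M (b1 - b)"
    using IH by blast
  have b1e: "b1 * e = 0" "e * b1 = 0"
    using b1(1,2) pe by (metis mult.assoc mult_zero_right) (metis b1(1) mult.assoc mult_zero_left pe(2))
  note bs = pair_span b1(1-3) b1(1-3)[THEN mult_assoc_eq] b1e b1e[THEN mult_assoc_eq]
  \<comment> \<open>Modulo \<open>M\<close> the conjugate \<open>a'\<close> is block triangular with
    diagonal blocks \<open>e\<close> and \<open>b\<close> and off-diagonal block
    \<open>r\<close>.\<close>
  define r where "r = e * a' * p"
  \<comment> \<open>With \<open>r\<close> itself in the corner the matrix would be idempotent only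
    if \<open>r * b1 = 0\<close>, which holds merely modulo \<open>M\<close>. The factor
    \<open>p - b1\<close> makes it exact and changes nothing modulo \<open>M\<close>.\<close>
  define a1 where "a1 = e + r * (p - b1) + b1"
  have Pb1: "P * b1 = b1" "b1 * P = b1" using b1 pe by (metis mult.assoc)+
  have a1: "a1 * a1 = a1" "P * a1 = a1" "a1 * P = a1"
    by (simp_all add: a1_def r_def mdistribs bs Pb1)
  have rb: "r * b = e * (a' * a' - a') * p - e * (a' * e - e) * a' * p"
    by (simp add: r_def b_def mdistribs pair_span a'pa')
  have a'eq: "a' = a' * e + r + b"
  proof -
    have "a' = (p + e) * a' * (p + e)" by (simp add: p mdistribs a'P)
    also have "\<dots> = (p + e) * (a' * e) + r + b" unfolding r_def b_def by (simp add: mdistribs)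
    also have "p + e = P" by (simp add: p)
    finally show ?thesis by (simp add: mult.assoc[symmetric] a'P)
  qed
  have "r * p = r" by (simp add: r_def mdistribs pair_span)
  then have "a1 - (a' * e + r + b) = (b1 - b) - (a' * e - e) - r * (b1 - b) - r * b"
    by (simp add: a1_def right_diff_distrib)
  then have "a1 - a' = (b1 - b) - (a' * e - e) - r * (b1 - b) - r * b"
    using a'eq by simp
  then have d: "dvd_fmat M (a1 - a')"
    unfolding rb using b1(4) a'a' a'e by simp
  define a2 where "a2 = h * a1 * h'"
  have ea: "a = h * a' * h'" by (simp add: a'_def mdistribs hs PA)
  have "a2 - a = h * (a1 - a') * h'" by (subst ea) (simp add: a2_def mdistribs)
  then have "dvd_fmat M (a2 - a)" using d by simp
  moreover have "a2 * a2 = a2" "P * a2 = a2" "a2 * P = a2"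
    by (simp_all add: a2_def mdistribs hs a1 a1[THEN mult_assoc_eq])
  ultimately show ?thesis by blast
qed

text \<open>Induction on the number of coordinates. An even \<open>a\<close> is congruent to 0,
  which is its lift; otherwise an odd entry, being invertible modulo \<open>2^j\<close>, yields a
  fixed vector that can be split off by \<open>idempotent_step\<close>.\<close>

lemma idempotent_lift_supp:
  fixes a :: "int fmat"
  assumes "finite S" "diag_fmat S * a = a" "a * diag_fmat S = a" "dvd_fmat (2 ^ j) (a * a - a)"
  shows "\<exists>a1. diag_fmat S * a1 = a1 \<and> a1 * diag_fmat S = a1 \<and> a1 * a1 = a1 \<and> dvd_fmat (2 ^ j) (a1 - a)"
  using assms
proof (induction "card S" arbitrary: S a rule: less_induct)
  case less
  show ?case
  proof (cases "dvd_fmat 2 a")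
    case True
    then have "dvd_fmat (2 ^ j) (0 - a)" using even_idempotent_zero[OF True less.prems(4)] by simp
    then show ?thesis by (metis mult_zero_left mult_zero_right)
  next
    case False
    have "\<exists>k l. odd (entry a k l)"
    proof (rule ccontr)
      assume ev: "\<not> ?thesis"
      obtain N where "rws N a" "cls N a" by (metis rws_cls_ex)
      then have "a = scl 2 (mk N N (\<lambda>i j. entry a i j div 2))"
        using ev by (intro fmat_eqI) (auto simp: rws_def cls_def not_less)
      with False show False unfolding dvd_fmat_def by blast
    qed
    then obtain k l where kl: "odd (entry a k l)" by blast
    then have "entry a k l \<noteq> 0" by auto
    then have kS: "k \<in> S" using entry_diag_fmat_mult[OF less.prems(1), of a k l] less.prems(2) by (auto split: if_splits)
    have "coprime (entry a k l) (2 ^ j)" using kl by simp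
    then obtain u w where uw: "u * entry a k l + w * 2 ^ j = 1"
      by (metis bezout_int coprime_imp_gcd_eq_1)
    let ?e = "unit_fmat k k :: int fmat" and ?P = "diag_fmat S :: int fmat"
    \<comment> \<open>Column \<open>l\<close> of \<open>a\<close>, moved to column \<open>k\<close>
      and scaled by the inverse \<open>u\<close> of the odd entry, is fixed by \<open>a\<close>
      modulo \<open>2^j\<close> because \<open>a\<close> is idempotent there. Its entry at
      \<open>k\<close> is \<open>1 - w * 2^j\<close>, and the multiple of \<open>?e\<close> added in
      \<open>V\<close> makes it exactly 1.\<close>
    define V0 where "V0 = scl u (a * unit_fmat l k)"
    define V where "V = V0 + scl (w * 2 ^ j) ?e"
    have Ve: "V * ?e = V" by (simp add: V_def V0_def mdistribs)
    have PV: "?P * V = V" "V * ?P = V" "?P * ?e = ?e" "?e * ?P = ?e" "?P * ?P = ?P"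
      using kS less.prems(1)
      by (auto intro!: fmat_eqI simp: entry_diag_fmat_mult entry_mult_diag_fmat V_def V0_def entry_diag_fmat)
        (metis entry_diag_fmat_mult less.prems(1,2))+
    have eV: "?e * V = ?e"
      using uw by (auto intro!: fmat_eqI simp: V_def V0_def)
    have "a * V - V = scl u ((a * a - a) * unit_fmat l k) + scl (2 ^ j) (scl w (a * ?e - ?e))"
      by (simp add: V_def V0_def mdistribs scl_distribs mult.commute)
    then have aV: "dvd_fmat (2 ^ j) (a * V - V)"
      using less.prems(4) by (metis dvd_fmat_scl dvd_fmat_simps(2,5,7))
    have p: "diag_fmat (S - {k}) = ?P - ?e"
      using kS less.prems(1) by (auto intro!: fmat_eqI simp: entry_diag_fmat)
    have c: "card (S - {k}) < card S" using kS less.prems(1) by (metis card_Diff1_less)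
    show ?thesis
    proof (rule idempotent_step[OF less.prems(2,3) PV(3,4,1,2,5) _ Ve eV p less.prems(4) aV])
      show "?e * ?e = ?e" by simp
      show "\<exists>b1. diag_fmat (S - {k}) * b1 = b1 \<and> b1 * diag_fmat (S - {k}) = b1 \<and> b1 * b1 = b1 \<and> dvd_fmat (2 ^ j) (b1 - b)"
        if "diag_fmat (S - {k}) * b = b" "b * diag_fmat (S - {k}) = b" "dvd_fmat (2 ^ j) (b * b - b)" for b
        using less.hyps[OF c _ that] less.prems(1) by simp
    qed
  qed
qed

lemma diag_fmat_lessThan: "diag_fmat {..<m} = idm m"
  by (rule fmat_eqI) (auto simp: entry_diag_fmat)

text \<open>Involutions that are 1 mod 2 correspond to idempotents by \<open>A = 2 a - 1\<close>,
  with \<open>A^2 - 1 = 4 (a^2 - a)\<close>. So the hypothesis modulo \<open>4 * 2^j\<close> is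
  idempotency modulo \<open>2^j\<close>, and a lift modulo \<open>2^j\<close> changes
  \<open>A\<close> by a multiple of \<open>2 * 2^j\<close>.\<close>

lemma involution_lift:
  fixes A :: "real fmat"
  assumes "rws m A" "cls m A" "dvm 2 (A - idm m)" "dvm (4 * 2 ^ j) (A * A - idm m)"
  obtains B where "rws m B" "cls m B" "B * B = idm m" "dvm 1 B" "dvm (2 * 2 ^ j) (B - A)"
proof -
  obtain C where C: "dvm 1 C" "A - idm m = scl 2 C" using dvm_ex[OF assms(3)] by blast
  define a where "a = C + idm m"
  have A: "A = idm m + scl 2 C" using C(2) by (simp add: algebra_simps)
  have Aeq: "A = scl 2 a - idm m"
    unfolding A a_def by (rule fmat_eqI) auto
  have aC: "C = scl (1/2) (A - idm m)" by (simp add: C(2))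
  have ad: "rws m a" "cls m a" unfolding a_def aC using assms(1,2) by simp_all
  have "dvm 1 a" using C by (simp add: a_def)
  then obtain z where z: "a = zr z" using zr_ex by blast
  have zd: "rws m z" "cls m z" using ad by (simp_all add: z)
  have "A * A - idm m = scl 4 (a * a - a)"
    unfolding Aeq by (auto simp: mdistribs ad scl_distribs intro!: fmat_eqI)
  then have "a * a - a = scl (1/4) (A * A - idm m)" by simp
  then have "dvm (1/4 * (4 * 2 ^ j)) (a * a - a)" using dvm_scl[OF assms(4)] by metis
  then obtain D where D: "dvm 1 D" "a * a - a = scl (2 ^ j) D" using dvm_ex by force
  then obtain y where y: "D = zr y" using zr_ex by blast
  have "zr (z * z - z) = zr (scl (2 ^ j) y)" using D z y by simp
  then have "entry (zr (z * z - z)) i k = entry (zr (scl (2 ^ j) y)) i k" for i k by simp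
  then have zz: "z * z - z = scl (2 ^ j) y"
    by (intro fmat_eqI) (simp only: entry_maps of_int_eq_iff)
  have "diag_fmat {..<m} * z = z" "z * diag_fmat {..<m} = z" "dvd_fmat (2 ^ j) (z * z - z)"
    using zd zz by (auto simp: diag_fmat_lessThan)
  then obtain z1 where z1: "diag_fmat {..<m} * z1 = z1" "z1 * diag_fmat {..<m} = z1" "z1 * z1 = z1" "dvd_fmat (2 ^ j) (z1 - z)"
    using idempotent_lift_supp[of "{..<m}" z j] by auto
  have z1d: "rws m z1" "cls m z1"
    using z1(1,2) by (metis diag_fmat_lessThan order.refl rws_idm rws_simps(5)) (metis z1(2) diag_fmat_lessThan order.refl cls_idm cls_simps(5))
  define B where "B = scl 2 (zr z1) - idm m"
  have zz1: "zr z1 * zr z1 = zr z1" using z1(3) by (metis maps_simps(3))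
  have "B * B = idm m"
    by (auto simp: B_def mdistribs z1d scl_distribs zz1 intro!: fmat_eqI)
  moreover obtain x where x: "z1 - z = scl (2 ^ j) x" using z1(4) by (auto simp: dvd_fmat_def)
  have "B - A = scl 2 (zr (z1 - z))" by (simp add: B_def Aeq z scl_distribs)
  then have "dvm (2 * 2 ^ j) (B - A)"
    unfolding x by (auto simp: dvm_def)
  moreover have "dvm 1 B"
  proof -
    have "B = zr (scl 2 z1 - idm m)" by (simp add: B_def)
    then show ?thesis by (metis dvm_simps(7))
  qed
  ultimately show ?thesis by (intro that[of B]) (auto simp: B_def z1d)
qed

section \<open>Primitive vectors and saturated integral bases of rational subspaces\<close>

lemma bezout_vector: "\<exists>u d. (\<Sum>i<N. u i * w i) = (d::int) \<and> (\<forall>i<N. d dvd w i)" for N :: nat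
proof (induction N)
  case 0
  then show ?case by simp
next
  case (Suc N)
  then obtain u d where ud: "(\<Sum>i<N. u i * w i) = d" "\<forall>i<N. d dvd w i" by blast
  obtain x y where xy: "x * d + y * w N = gcd d (w N)" using bezout_int by blast
  define u' where "u' = (\<lambda>i. if i < N then x * u i else y)"
  have "(\<Sum>i<N. u' i * w i) = x * d"
    unfolding ud(1)[symmetric] sum_distrib_left by (rule sum.cong) (auto simp: u'_def)
  then have "(\<Sum>i<Suc N. u' i * w i) = gcd d (w N)" using xy by (simp add: u'_def)
  moreover have "\<forall>i<Suc N. gcd d (w N) dvd w i"
    using ud(2) by (metis dvd_trans gcd_dvd1 gcd_dvd2 less_Suc_eq)
  ultimately show ?case by blast
qed

lemma common_denominator:
  fixes v :: "nat \<Rightarrow> real"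
  shows "(\<forall>i<N. v i \<in> \<rat>) \<Longrightarrow> \<exists>D::int. D > 0 \<and> (\<forall>i<N. \<exists>z::int. of_int D * v i = of_int z)"
proof (induction N)
  case 0
  then show ?case by (auto intro: exI[of _ 1])
next
  case (Suc N)
  then obtain D where D: "D > 0" "\<forall>i<N. \<exists>z::int. of_int D * v i = of_int z" by auto
  have "v N \<in> \<rat>" using Suc.prems by simp
  then obtain a b :: int where ab: "b > 0" "v N = of_int a / of_int b"
    by (elim Rats_cases') auto
  have "\<exists>z::int. of_int (D * b) * v i = of_int z" if "i < Suc N" for i
  proof (cases "i = N")
    case True
    then show ?thesis using ab by (intro exI[of _ "D * a"]) simp
  next
    case False
    then have "i < N" using \<open>i < Suc N\<close> by simp
    then obtain z :: int where z: "of_int D * v i = of_int z" using D(2) by blast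
    have "of_int (D * b) * v i = of_int b * (of_int D * v i)" by simp
    then show ?thesis unfolding z by (intro exI[of _ "b * z"]) simp
  qed
  with D(1) ab(1) show ?case by (intro exI[of _ "D * b"]) auto
qed

text \<open>Clearing denominators by \<open>D\<close> and dividing by the gcd \<open>d\<close>
  leaves coprime integers, whose Bezout coefficients form the row \<open>g\<close>. Here
  \<open>unit_fmat 0 0\<close> is the 1 by 1 identity.\<close>

lemma primitive_multiple:
  fixes b :: "real fmat"
  assumes "rws r b" "cls 1 b" "b \<noteq> 0" "\<And>i j. entry b i j \<in> \<rat>"
  obtains \<rho> g where "\<rho> \<noteq> 0" "dvm 1 (scl \<rho> b)" "dvm 1 g" "rws 1 g" "cls r g" "g * scl \<rho> b = unit_fmat 0 0"
proof -
  obtain D :: int where D: "D > 0" "\<forall>i<r. \<exists>z::int. of_int D * entry b i 0 = of_int z"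
    using common_denominator[of r "\<lambda>i. entry b i 0"] assms(4) by auto
  then obtain w :: "nat \<Rightarrow> int" where w: "\<And>i. i < r \<Longrightarrow> of_int D * entry b i 0 = of_int (w i)" by metis
  obtain u d where ud: "(\<Sum>i<r. u i * w i) = d" "\<forall>i<r. d dvd w i" using bezout_vector by blast
  have "\<exists>i<r. entry b i 0 \<noteq> 0"
  proof (rule ccontr)
    assume "\<not> ?thesis"
    then have "entry b i j = 0" for i j
      using assms(1,2) by (cases "i < r \<and> j = 0") (auto simp: rws_def cls_def)
    then show False using assms(3) by (metis entry_zero fmat_eqI)
  qed
  then obtain i0 where "i0 < r" "entry b i0 0 \<noteq> 0" by blast
  then have "w i0 \<noteq> 0" using w[of i0] D(1) by auto
  then have d0: "d \<noteq> 0" using ud(2) \<open>i0 < r\<close> by auto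
  define \<rho> where "\<rho> = of_int D / (of_int d :: real)"
  have e: "\<rho> * entry b i 0 = of_int (w i div d)" if "i < r" for i
  proof -
    have "of_int (w i div d) = (of_int (w i) / of_int d :: real)"
      using ud(2) that by (simp add: real_of_int_div)
    then show ?thesis using w[OF that] by (simp add: \<rho>_def)
  qed
  define g where "g = mk 1 r (\<lambda>i j. real_of_int (u j))"
  have "(\<Sum>i<r. u i * (w i div d)) = 1"
  proof -
    have "d * (\<Sum>i<r. u i * (w i div d)) = (\<Sum>i<r. u i * w i)"
      unfolding sum_distrib_left by (rule sum.cong) (use ud(2) in auto)
    then show ?thesis using ud(1) d0 by simp
  qed
  then have s: "(\<Sum>i<r. real_of_int (u i) * of_int (w i div d)) = 1"
    by (metis (no_types, lifting) of_int_1 of_int_mult of_int_sum sum.cong)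
  have "g * scl \<rho> b = unit_fmat 0 0"
  proof (rule fmat_eqI)
    fix i j
    show "entry (g * scl \<rho> b) i j = entry (unit_fmat 0 0) i j"
    proof (cases "i = 0 \<and> j = 0")
      case True
      have "entry (g * scl \<rho> b) 0 0 = (\<Sum>k<r. entry g 0 k * entry (scl \<rho> b) k 0)"
        by (rule entry_times) (simp add: g_def)
      also have "\<dots> = (\<Sum>i<r. real_of_int (u i) * of_int (w i div d))"
        by (rule sum.cong) (auto simp: g_def e)
      finally show ?thesis using True s by simp
    next
      case False
      then have "1 \<le> i \<or> 1 \<le> j" by auto
      moreover have "rws 1 (g * scl \<rho> b)" "cls 1 (g * scl \<rho> b)"
        using assms(2) by (simp_all add: g_def)
      ultimately have "entry (g * scl \<rho> b) i j = 0" unfolding rws_def cls_def by blast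
      with False show ?thesis by auto
    qed
  qed
  moreover have "dvm 1 (scl \<rho> b)"
    unfolding dvm_def
  proof (intro allI)
    fix i j
    show "\<exists>z::int. entry (scl \<rho> b) i j = 1 * of_int z"
    proof (cases "i < r \<and> j = 0")
      case True
      then show ?thesis using e by auto
    next
      case False
      then have "entry b i j = 0" using assms(1,2) by (auto simp: rws_def cls_def)
      then show ?thesis by (auto intro: exI[of _ 0])
    qed
  qed
  moreover have "dvm 1 g" by (auto simp: dvm_def g_def intro: exI[of _ 0])
  moreover have "\<rho> \<noteq> 0" using D(1) d0 by (simp add: \<rho>_def)
  ultimately show ?thesis by (intro that[of \<rho> g]) (auto simp: g_def)
qed

lemma rational_sum: "(\<And>k. k < n \<Longrightarrow> f k \<in> \<rat>) \<Longrightarrow> (\<Sum>k<n. f k) \<in> (\<rat>::real set)" for n :: nat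
  by (induction n) auto

lemma rational_mult:
  "(\<And>i j. entry A i j \<in> \<rat>) \<Longrightarrow> (\<And>i j. entry B i j \<in> \<rat>) \<Longrightarrow> entry (A * B :: real fmat) i j \<in> \<rat>"
proof -
  assume "\<And>i j. entry A i j \<in> \<rat>" "\<And>i j. entry B i j \<in> \<rat>"
  moreover obtain M where "cls M A" by (metis rws_cls_ex)
  ultimately show ?thesis by (auto simp: entry_times[of M] intro!: rational_sum)
qed

lemma dvm_rational: "dvm 1 A \<Longrightarrow> entry A i j \<in> \<rat>"
  unfolding dvm_def by (metis mult_1 Rats_of_int)

text \<open>
  Columns are added one at a time: the new column is projected to the kernel of \<open>G\<close>, scaled to a primitive
  integral vector, and dualised by Bezout.
\<close>

lemma saturated_basis:
  fixes B G0 :: "real fmat"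
  assumes B: "rws r B" "cls m B" "G0 * B = idm m" and rat: "\<And>i j. entry B i j \<in> \<rat>"
  shows "\<exists>E G T T'. rws r E \<and> cls m E \<and> rws m G \<and> cls r G \<and> dvm 1 E \<and> dvm 1 G \<and> G * E = idm m
    \<and> B = E * T \<and> E = B * T' \<and> rws m T \<and> cls m T \<and> rws m T' \<and> cls m T'"
proof -
  \<comment> \<open>\<open>B * idm k\<close> keeps the first \<open>k\<close> columns of
    \<open>B\<close>; \<open>T\<close> and \<open>T'\<close> record that the old and the new columns
    have the same span.\<close>
  have "k \<le> m \<Longrightarrow> \<exists>E G T T'. rws r E \<and> cls k E \<and> rws k G \<and> cls r G \<and> dvm 1 E \<and> dvm 1 G \<and> G * E = idm k
    \<and> B * idm k = E * T \<and> E = B * T' \<and> rws k T \<and> cls k T \<and> rws k T' \<and> cls k T'" for k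
  proof (induction k)
    case 0
    have "idm 0 = (0 :: real fmat)" by (rule fmat_eqI) auto
    then show ?case by (intro exI[of _ 0]) simp
  next
    case (Suc k)
    then obtain E G T T' where E: "rws r E" "cls k E" "rws k G" "cls r G" "dvm 1 E" "dvm 1 G" "G * E = idm k"
      "B * idm k = E * T" "E = B * T'" "rws k T" "cls k T" "rws k T'" "cls k T'" by auto
    define b where "b = B * unit_fmat k 0"
    define b' where "b' = b - E * G * b"
    \<comment> \<open>Otherwise column \<open>k\<close> of \<open>B\<close> would be a combination
      of the earlier columns, against the left inverse \<open>G0\<close>.\<close>
    have b0: "b' \<noteq> 0"
    proof
      assume "b' = 0"
      then have "b = B * (T' * G * b)" using E(9) by (simp add: b'_def mult.assoc)
      then have "G0 * b = (G0 * B) * (T' * G * b)" by (metis mult.assoc)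
      moreover have "G0 * b = (G0 * B) * unit_fmat k 0" by (simp add: b_def mult.assoc)
      ultimately have "idm m * unit_fmat k 0 = idm m * (T' * G * b)" using B(3) by simp
      moreover have "rws m T'" using E(12) Suc.prems rws_mono by (metis Suc_leD)
      ultimately have "unit_fmat k 0 = T' * G * b" using Suc.prems by simp
      then have "entry (unit_fmat k 0 :: real fmat) k 0 = entry (T' * G * b) k 0" by simp
      moreover have "rws k (T' * G * b)" using E by simp
      ultimately show False by (simp add: rws_def)
    qed
    have bd: "rws r b'" "cls 1 b'" using B E by (simp_all add: b'_def b_def)
    have b'r: "entry b' i j \<in> \<rat>" for i j
    proof -
      have "entry b i j \<in> \<rat>" for i j using rat by (simp add: b_def)
      moreover from this have "entry (E * G * b) i j \<in> \<rat>" for i j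
        using E(5,6) by (intro rational_mult) (auto intro: dvm_rational)
      ultimately show ?thesis by (simp add: b'_def)
    qed
    obtain \<rho> g where g: "\<rho> \<noteq> 0" "dvm 1 (scl \<rho> b')" "dvm 1 g" "rws 1 g" "cls r g" "g * scl \<rho> b' = unit_fmat 0 0"
      using primitive_multiple[OF bd b0 b'r] by blast
    define e where "e = scl \<rho> b'"
    have ed: "rws r e" "cls 1 e" "dvm 1 e" "g * e = unit_fmat 0 0" using bd g by (simp_all add: e_def)
    have Ge: "G * e = 0"
      using E(7) E(3) by (simp add: e_def b'_def mdistribs E(7)[THEN mult_assoc_eq])
    have b_eq: "b = E * G * b + scl (1/\<rho>) e" using g(1) by (simp add: e_def b'_def)
    \<comment> \<open>The correction makes the new dual row vanish on the old columns; its value on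
      \<open>e\<close> stays 1 because \<open>G * e = 0\<close>.\<close>
    define g' where "g' = g - g * E * G"
    have g': "g' * E = 0" "g' * e = unit_fmat 0 0" "rws 1 g'" "cls r g'" "dvm 1 g'"
      using E(1-7) g ed by (simp_all add: g'_def mdistribs Ge)
    have id_Suc: "idm (Suc k) = (idm k + unit_fmat k 0 * unit_fmat 0 k :: real fmat)"
      by (rule fmat_eqI) auto
    have Eu: "E * unit_fmat k j = 0" for j using E(2) by (auto intro!: fmat_eqI simp: cls_def)
    have uT: "unit_fmat i k * T = 0" "unit_fmat i k * G = 0" for i
      using E(3,10) by (auto intro!: fmat_eqI simp: rws_def)
    define E1 where "E1 = E + e * unit_fmat 0 k"
    define G1 where "G1 = G + unit_fmat k 0 * g'"
    define T1 where "T1 = T + G * b * unit_fmat 0 k + scl (1/\<rho>) (unit_fmat k 0 * unit_fmat 0 k)"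
    define T1' where "T1' = T' + scl \<rho> (unit_fmat k 0 * unit_fmat 0 k - T' * G * b * unit_fmat 0 k)"
    have "G1 * E1 = idm (Suc k)"
    proof -
      have "G1 * E1 = G * E + G * e * unit_fmat 0 k + unit_fmat k 0 * (g' * E) + unit_fmat k 0 * (g' * e) * unit_fmat 0 k"
        by (simp add: G1_def E1_def mdistribs add.assoc)
      then show ?thesis by (simp add: E(7) Ge g' id_Suc)
    qed
    moreover have "B * idm (Suc k) = E1 * T1"
    proof -
      have "B * idm (Suc k) = E * T + b * unit_fmat 0 k"
        by (simp only: id_Suc distrib_left E(8) b_def mult.assoc)
      also have "\<dots> = E * T + E * G * b * unit_fmat 0 k + scl (1/\<rho>) (e * unit_fmat 0 k)"
        by (subst b_eq) (simp add: distrib_right)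
      also have "\<dots> = E1 * T1"
        by (simp add: E1_def T1_def mdistribs Eu Eu[THEN mult_assoc_eq] uT uT[THEN mult_assoc_eq] b_def)
      finally show ?thesis .
    qed
    moreover have "E1 = B * T1'"
    proof -
      have "B * T1' = E + scl \<rho> (b * unit_fmat 0 k - E * G * b * unit_fmat 0 k)"
        by (simp add: T1'_def mdistribs b_def E(9) scl_distribs)
      also have "\<dots> = E1" by (simp add: E1_def e_def b'_def left_diff_distrib)
      finally show ?thesis by simp
    qed
    moreover have "rws r E1" "cls (Suc k) E1" "rws (Suc k) G1" "cls r G1" "dvm 1 E1" "dvm 1 G1"
      "rws (Suc k) T1" "cls (Suc k) T1" "rws (Suc k) T1'" "cls (Suc k) T1'"
    proof -
      have m: "cls (Suc k) E" "rws (Suc k) G" "rws (Suc k) T" "cls (Suc k) T" "rws (Suc k) T'" "cls (Suc k) T'"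
        using E rws_mono cls_mono by (metis le_SucI order.refl)+
      have "dvm 1 (unit_fmat i j)" for i j unfolding dvm_def by (auto intro: exI[of _ 0] exI[of _ 1])
      with m E(1,3-6) ed g'(3-5) show "rws r E1" "cls (Suc k) E1" "rws (Suc k) G1" "cls r G1" "dvm 1 E1" "dvm 1 G1"
        "rws (Suc k) T1" "cls (Suc k) T1" "rws (Suc k) T1'" "cls (Suc k) T1'"
        by (simp_all add: E1_def G1_def T1_def T1'_def)
    qed
    ultimately show ?case
      by (intro exI[of _ E1] exI[of _ G1] exI[of _ T1] exI[of _ T1'] conjI)
  qed
  from this[of m] show ?thesis using B(2) by simp
qed

section \<open>Correction of an anti-symplectic matrix to an involution\<close>

definition Jm :: "nat \<Rightarrow> real fmat" where
  "Jm n = mk (2*n) (2*n) (Jmat n)"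

lemma entry_Jm: "entry (Jm n) i j = Jmat n i j"
  by (auto simp: Jm_def Jmat_def)

lemma Jm_dims [simp]: "rws (2*n) (Jm n)" "cls (2*n) (Jm n)" "dvm 1 (Jm n)"
  by (simp_all add: Jm_def) (auto simp: dvm_def Jmat_def intro: exI[of _ 0] exI[of _ 1] exI[of _ "-1"])

lemma tr_Jm [simp]: "tr (Jm n) = - Jm n"
  by (rule fmat_eqI) (auto simp: entry_Jm Jmat_def)

lemma entry_Jm_mult:
  "entry (Jm n * A) i j = (if i < n then entry A (i + n) j else if i < 2*n then - entry A (i - n) j else 0)"
proof -
  have "entry (Jm n * A) i j = (\<Sum>k<2*n. Jmat n i k * entry A k j)"
    unfolding entry_Jm[symmetric] by (intro entry_times disjI1 Jm_dims)
  also have "\<dots> = (\<Sum>k<2*n. if k = (if i < n then i + n else i - n) then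
      (if i < n then entry A (i + n) j else if i < 2*n then - entry A (i - n) j else 0) else 0)"
    by (rule sum.cong) (auto simp: Jmat_def)
  finally show ?thesis by auto
qed

lemma Jm_Jm [simp]: "Jm n * Jm n = - idm (2*n)"
  by (rule fmat_eqI) (auto simp: entry_Jm_mult entry_Jm Jmat_def)

lemma Jm_Jm_mult [simp]: "rws (2*n) A \<Longrightarrow> Jm n * (Jm n * A) = - A"
  by (simp add: mult.assoc[symmetric])

lemma anti_inverse:
  assumes s: "rws (2*n) s" "cls (2*n) s" and "tr s * Jm n * s = - Jm n"
  shows "Jm n * tr s * Jm n * s = idm (2*n)"
proof -
  have "Jm n * tr s * Jm n * s = Jm n * (tr s * Jm n * s)" by (simp add: mult.assoc)
  then show ?thesis using assms by simp
qed

lemma left_inverse_right: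
  fixes A B :: "'a::field fmat"
  assumes "rws n A" "cls n A" "rws n B" "cls n B" "B * A = idm n"
  shows "A * B = idm n"
proof -
  obtain C where C: "rws n C" "cls n C" "A * C = idm n" "C * A = idm n"
  proof (rule inverse_ex[OF assms(1,2)])
    fix a :: "'a fmat" assume a: "rws n a" "A * a = 0"
    have "a = B * A * a" using a assms by simp
    also have "\<dots> = 0" using a by (simp add: mult.assoc)
    finally show "a = 0" .
  qed auto
  have "B = B * (A * C)" using C assms by simp
  also have "\<dots> = (B * A) * C" by (simp only: mult.assoc)
  also have "\<dots> = C" using C assms(5) by simp
  finally show ?thesis using C by simp
qed

lemma dvm_diffD: "dvm N (A - B) \<Longrightarrow> dvm N B \<Longrightarrow> dvm N A"
  by (metis diff_add_cancel dvm_simps(2))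

locale frame =
  fixes n m :: nat and E F :: "real fmat"
  assumes E_dims [simp]: "rws (2*n) E" "cls m E" and F_dims [simp]: "rws (2*n) F" "cls m F"
    and EJE: "tr E * Jm n * E = 0" and EJF: "tr E * Jm n * F = idm m" and FJF: "tr F * Jm n * F = 0"
begin

text \<open>The coordinate functionals of the frame: \<open>K\<close> reads the coordinates along
  \<open>F\<close> and has kernel L^perp for L spanned by \<open>E\<close>, while \<open>G\<close>
  reads those along \<open>E\<close>. Thus \<open>idm (2*n) - F * K\<close> projects onto L^perp
  along \<open>F\<close>, and \<open>idm (2*n) - E * G\<close> kills L.\<close>

definition "K = tr E * Jm n"
definition "G = - (tr F * Jm n)"

lemma KG_dims [simp]: "rws m K" "cls (2*n) K" "rws m G" "cls (2*n) G"
  by (simp_all add: K_def G_def)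

lemma KE: "K * E = 0" and KF: "K * F = idm m" and GF: "G * F = 0"
  by (simp_all add: K_def G_def EJE EJF FJF)

lemma GE: "G * E = idm m"
proof -
  have "tr (tr E * Jm n * F) = idm m" by (simp add: EJF)
  then show ?thesis by (simp add: G_def mult.assoc)
qed

lemma JE: "Jm n * E = - tr K" and JF: "Jm n * F = tr G"
  by (simp_all add: K_def G_def)

lemmas frs = KE KF GE GF KE[THEN mult_assoc_eq] KF[THEN mult_assoc_eq] GE[THEN mult_assoc_eq] GF[THEN mult_assoc_eq]

text \<open>\<open>d\<close> acts as \<open>D\<close> on \<open>E\<close>, as \<open>tr D'\<close>
  on \<open>F\<close>, and trivially on the vectors orthogonal to both. The pairing of
  \<open>E\<close> with \<open>F\<close> survives exactly because
  \<open>D' * D = idm m\<close>.\<close>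

lemma levi_symplectic:
  assumes D: "rws m D" "cls m D" "rws m D'" "cls m D'" "D' * D = idm m"
  defines "d \<equiv> idm (2*n) + E * (D - idm m) * G + F * (tr D' - idm m) * K"
  shows "tr d * Jm n * d = Jm n"
proof -
  define x where "x = D - idm m"
  define y where "y = tr D' - idm m"
  have xd[simp]: "rws m x" "cls m x" "rws m y" "cls m y" using D by (simp_all add: x_def y_def)
  have xy: "tr y * x = - x - tr y"
    using D by (simp add: x_def y_def mdistribs)
  have yx: "tr x * y = - y - tr x"
  proof -
    have "tr x * y = - tr x - y" using arg_cong[OF xy, of tr] by simp
    then show ?thesis by (metis minus_diff_commute)
  qed
  have t: "tr E * tr K = 0" "tr E * tr G = idm m" "tr F * tr K = idm m" "tr F * tr G = 0"
    using arg_cong[OF KE, of tr] arg_cong[OF GE, of tr] arg_cong[OF KF, of tr] arg_cong[OF GF, of tr] by simp_all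
  note ts = t t[THEN mult_assoc_eq]
  have d: "d = idm (2*n) + E * x * G + F * y * K" by (simp add: d_def x_def y_def)
  have Jd: "Jm n * d = Jm n - tr K * x * G + tr G * y * K"
    unfolding d by (simp add: mdistribs JE[THEN mult_assoc_eq] JF[THEN mult_assoc_eq])
  have td: "tr d = idm (2*n) + tr G * tr x * tr E + tr K * tr y * tr F"
    unfolding d by (simp add: mdistribs)
  have EK: "tr E * Jm n = K" "tr F * Jm n = - G" by (simp_all add: K_def G_def)
  have "tr d * (Jm n * d) = Jm n - tr K * x * G + tr G * y * K
     + tr G * tr x * (tr E * Jm n - tr E * tr K * x * G + tr E * tr G * y * K)
     + tr K * tr y * (tr F * Jm n - tr F * tr K * x * G + tr F * tr G * y * K)"
    unfolding Jd td by (simp add: distrib_right distrib_left left_diff_distrib right_diff_distrib mult.assoc)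
  also have "\<dots> = Jm n - tr K * x * G + tr G * y * K
     + tr G * (tr x * K) + tr G * ((tr x * y) * K) - tr K * (tr y * G) - tr K * ((tr y * x) * G)"
    unfolding EK t by (simp add: mdistribs)
  also have "\<dots> = Jm n"
    unfolding xy yx by (simp add: mdistribs)
  finally show ?thesis by (simp add: mult.assoc)
qed

text \<open>\<open>p\<close> is the binomial series of \<open>(1 + v)^(-1/2)\<close>, truncated because \<open>v^3 = 0\<close>.\<close>

lemma sqrt_unipotent:
  assumes s: "rws (2*n) s" "cls (2*n) s" and anti: "tr s * Jm n * s = - Jm n"
    and nu: "v = s * s - idm (2*n)" "v * (v * v) = 0"
  defines "p \<equiv> idm (2*n) - scl (1/2) v + scl (3/8) (v * v)"
  shows "(s * p) * (s * p) = idm (2*n)" "tr (s * p) * Jm n * (s * p) = - Jm n"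
proof -
  let ?I = "idm (2*n) :: real fmat"
  have vd [simp]: "rws (2*n) v" "cls (2*n) v" using s by (simp_all add: nu)
  have ss: "s * s = ?I + v" by (simp add: nu)
  have sv: "s * v = v * s" using s by (simp add: nu mdistribs)
  have vv: "v * (v * (v * X)) = 0" for X using nu(2) by (simp add: mult.assoc[symmetric])
  note vs = vv nu(2)
  have sp: "s * p = p * s"
    using s by (simp add: p_def mdistribs sv sv[THEN mult_assoc_eq])
  have pp: "p * p = ?I - v + v * v"
    by (simp add: p_def mdistribs vs) (auto intro!: fmat_eqI simp: algebra_simps)
  have "(s * p) * (s * p) = (s * s) * (p * p)" by (metis sp mult.assoc)
  then show "(s * p) * (s * p) = ?I"
    unfolding ss pp by (simp add: mdistribs vs)
  \<comment> \<open>The square of an anti-symplectic matrix is symplectic, so the adjoint of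
    \<open>1 + v\<close> with respect to \<open>Jm n\<close> is its inverse
    \<open>1 - v + v^2\<close>; this gives \<open>tv\<close>.\<close>
  have "tr (s * s) * Jm n * (s * s) = tr s * (tr s * Jm n * s) * s" by (simp add: mult.assoc)
  then have "tr (?I + v) * Jm n * (?I + v) = Jm n" using anti by (simp add: ss)
  moreover have "tr (?I + v) * Jm n * (?I + v) = Jm n + (tr v * Jm n * (?I + v) + Jm n * v)"
    by (simp add: mdistribs add.assoc add.commute add.left_commute)
  ultimately have e: "tr v * Jm n * (?I + v) = - (Jm n * v)"
    by (simp add: eq_neg_iff_add_eq_0)
  have "tr v * Jm n = tr v * Jm n * (?I + v) * (?I - v + v * v)"
    by (simp add: mdistribs vs)
  also have "\<dots> = Jm n * (- v + v * v)" unfolding e by (simp add: mdistribs vs)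
  finally have tv: "tr v * Jm n = Jm n * (- v + v * v)" .
  have tvv: "tr v * (tr v * Jm n) = Jm n * (v * v)"
  proof -
    have "tr v * (tr v * Jm n) = tr v * (Jm n * (- v + v * v))" by (simp only: tv)
    also have "\<dots> = (tr v * Jm n) * (- v + v * v)" by (simp only: mult.assoc)
    also have "\<dots> = Jm n * (v * v)" unfolding tv by (simp add: mdistribs vs)
    finally show ?thesis .
  qed
  have "tr p * Jm n = Jm n - scl (1/2) (tr v * Jm n) + scl (3/8) (tr v * (tr v * Jm n))"
    by (simp add: p_def mdistribs)
  \<comment> \<open>The adjoint of \<open>p\<close> is the truncated series of
    \<open>(1 + v)^(1/2)\<close>, the inverse of \<open>p\<close>; hence \<open>p\<close> is
    symplectic.\<close>
  also have "\<dots> = Jm n * (?I + scl (1/2) v - scl (1/8) (v * v))"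
    unfolding tvv unfolding tv by (simp add: mdistribs scl_distribs) (auto intro!: fmat_eqI)
  finally have "tr p * Jm n * p = Jm n * (?I + scl (1/2) v - scl (1/8) (v * v)) * p" by simp
  also have "\<dots> = Jm n"
    by (simp add: p_def mdistribs vs scl_distribs) (auto intro!: fmat_eqI)
  finally have pJp: "tr p * Jm n * p = Jm n" .
  have "tr (s * p) * Jm n * (s * p) = tr p * (tr s * Jm n * s) * p" by (simp add: mult.assoc)
  then show "tr (s * p) * Jm n * (s * p) = - Jm n" using anti pJp by simp
qed

text \<open>Once \<open>s\<close> is changed to \<open>s'\<close> with an involution
  \<open>b\<close> on L, the matrix \<open>v = s' * s' - 1\<close> kills L, maps L^perp into L by
  \<open>mink\<close>, and has its image in L^perp by duality. So \<open>v^3 = 0\<close> and the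
  square root applies. The last conclusion says that \<open>t\<close> and \<open>s\<close> agree on
  L^perp modulo L.\<close>

lemma involution_correction:
  fixes s :: "real fmat" and j :: nat
  assumes s [simp]: "rws (2*n) s" "cls (2*n) s" and anti: "tr s * Jm n * s = - Jm n"
    and s2: "dvm 2 (s - idm (2*n))" and ssN: "dvm (4 * 2 ^ j) (s * s - idm (2*n))"
    and a [simp]: "rws m a" "cls m a" and sE: "s * E = E * a"
    and a' [simp]: "rws m a'" "cls m a'" and Es: "E = s * E * a'"
    and mink: "(s * s - idm (2*n)) * (idm (2*n) - F * K) = E * l"
    and Ei: "dvm 1 E" and Fi: "dvm 1 F"
  obtains t b u where "rws (2*n) t" "cls (2*n) t" "tr t * Jm n * t = - Jm n" "t * t = idm (2*n)"
    "dvm (2 * 2 ^ j) (t - s)" "t * E = E * b" "rws m b" "cls m b" "b * b = idm m"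
    "t * (idm (2*n) - F * K) = s * (idm (2*n) - F * K) + E * u"
proof -
  let ?I = "idm (2*n) :: real fmat"
  let ?N = "2 * 2 ^ j :: real"
  define p0 where "p0 = ?I - F * K"
  have si: "dvm 1 s"
  proof -
    have "dvm 1 (s - ?I)" using s2 dvm_weaken[of 1 2] by simp
    then show ?thesis by (rule dvm_diffD) simp
  qed
  have Gi: "dvm 1 G" "dvm 1 K" using Ei Fi by (simp_all add: G_def K_def)
  have aG: "a = G * s * E" using GE by (simp add: mult.assoc sE frs)
  have EaE: "x = y" if "E * x = E * y" "rws m x" "rws m y" for x y
  proof -
    have "G * (E * x) = G * (E * y)" using that by simp
    then show ?thesis using that(2,3) by (simp add: frs)
  qed
  have aa': "a * a' = idm m"
    by (rule EaE) (use Es sE in \<open>simp_all add: mult.assoc[symmetric]\<close>)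
  have inv: "Jm n * tr s * Jm n * s = ?I" by (rule anti_inverse) (use anti in simp_all)
  have E': "Jm n * tr s * Jm n * E = E * a'"
  proof -
    have "Jm n * tr s * Jm n * E = Jm n * tr s * Jm n * (s * E * a')" using Es by simp
    also have "\<dots> = (Jm n * tr s * Jm n * s) * (E * a')" by (simp only: mult.assoc)
    finally show ?thesis by (simp add: inv)
  qed
  have a'G: "a' = G * (Jm n * tr s * Jm n) * E" using E' by (simp add: mult.assoc frs)
  have a'a: "a' * a = idm m"
  proof (rule EaE)
    have "E * (a' * a) = Jm n * tr s * Jm n * (E * a)" using E' by (simp add: mult.assoc[symmetric])
    also have "\<dots> = (Jm n * tr s * Jm n * s) * E" by (simp add: sE[symmetric] mult.assoc)
    finally show "E * (a' * a) = E * idm m" by (simp add: inv)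
  qed simp_all
  have ai: "dvm 1 a" "dvm 1 a'" using si Gi Ei unfolding a'G aG by simp_all
  have "a - idm m = G * (s - ?I) * E" by (simp add: aG mdistribs GE)
  then have "dvm 2 (a - idm m)" using s2 Gi Ei by simp
  moreover have "a * a - idm m = G * (s * s - ?I) * E"
    by (simp add: mdistribs sE sE[THEN mult_assoc_eq] frs)
  then have aaN: "dvm (4 * 2 ^ j) (a * a - idm m)" using ssN Gi Ei by simp
  ultimately obtain b where b [simp]: "rws m b" "cls m b" and bb: "b * b = idm m"
    and bi: "dvm 1 b" and ba: "dvm ?N (b - a)"
    using involution_lift[of m a j] a by metis
  \<comment> \<open>Chosen so that \<open>s * d * E = E * a * D = E * b\<close>; and
    \<open>D - idm m = a' * (b - a)\<close> is small because \<open>b\<close> is close to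
    \<open>a\<close>.\<close>
  define D where "D = a' * b"
  define D' where "D' = b * a"
  have DD: "D' * D = idm m"
    by (simp add: D_def D'_def mdistribs aa'[THEN mult_assoc_eq] bb)
  define d where "d = ?I + E * (D - idm m) * G + F * (tr D' - idm m) * K"
  have Dd [simp]: "rws m D" "cls m D" "rws m D'" "cls m D'" by (simp_all add: D_def D'_def)
  have dJd: "tr d * Jm n * d = Jm n" unfolding d_def by (rule levi_symplectic) (simp_all add: DD)
  have dd [simp]: "rws (2*n) d" "cls (2*n) d" by (simp_all add: d_def)
  have "D - idm m = a' * (b - a)" by (simp add: D_def mdistribs a'a)
  then have DN: "dvm ?N (D - idm m)" using ba ai by simp
  have "D' - idm m = (b - a) * a + (a * a - idm m)" by (simp add: D'_def mdistribs)
  moreover have "dvm ?N (a * a - idm m)" using aaN dvm_weaken[of ?N 2] by (simp add: mult.commute mult.left_commute)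
  ultimately have "dvm ?N (D' - idm m)" using ba ai(1) by (metis dvm_simps(2) dvm_mult_simps(1))
  then have "dvm ?N (tr (D' - idm m))" by (simp only: dvm_simps)
  then have D'N: "dvm ?N (tr D' - idm m)" by simp
  have dN: "dvm ?N (d - ?I)" using DN D'N Ei Fi Gi by (simp add: d_def)
  define s' where "s' = s * d"
  have s'd [simp]: "rws (2*n) s'" "cls (2*n) s'" by (simp_all add: s'_def)
  have "s' - s = s * (d - ?I)" by (simp add: s'_def mdistribs)
  then have s'N: "dvm ?N (s' - s)" using dN si by simp
  have dE: "d * E = E * D" by (simp add: d_def mdistribs frs)
  have s'E: "s' * E = E * b"
    by (simp add: s'_def mdistribs dE sE[THEN mult_assoc_eq] D_def aa'[THEN mult_assoc_eq])
  have anti': "tr s' * Jm n * s' = - Jm n"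
  proof -
    have "tr s' * Jm n * s' = tr d * (tr s * Jm n * s) * d" by (simp add: s'_def mult.assoc)
    then show ?thesis using anti dJd by simp
  qed
  define v where "v = s' * s' - ?I"
  have vE: "v * E = 0" by (simp add: v_def mdistribs s'E s'E[THEN mult_assoc_eq] bb)
  \<comment> \<open>The transpose of \<open>s' * E = E * b\<close>: on the quotient by L^perp, dual
    to L, an anti-symplectic map acts by the negative transpose.\<close>
  have Ks': "K * s' = - (tr b * K)"
  proof -
    have "tr E * (tr s' * Jm n * s') = - K" using anti' by (simp add: K_def)
    moreover have "tr E * tr s' = tr b * tr E" using arg_cong[OF s'E, of tr] by simp
    ultimately have q: "tr b * K * s' = - K" by (simp add: K_def mult.assoc[symmetric])
    have "tr b * tr b = idm m" using arg_cong[OF bb, of tr] by simp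
    then have "K * s' = tr b * (tr b * K * s')" by (simp add: mult.assoc[symmetric])
    then show ?thesis by (simp add: q)
  qed
  have Kv: "K * v = 0"
  proof -
    have "tr b * tr b = idm m" using arg_cong[OF bb, of tr] by simp
    then show ?thesis
      by (simp add: v_def mdistribs Ks'[THEN mult_assoc_eq] Ks' mult_assoc_eq[of "tr b" "tr b"])
  qed
  have Kp0: "K * p0 = 0" by (simp add: p0_def mdistribs frs)
  have p0K: "p0 * X = X" if "K * X = 0" "rws (2*n) X" for X using that by (simp add: p0_def mdistribs)
  have sp0: "s' * p0 = s * p0 + E * (a * (D - idm m) * G * p0)"
    by (simp add: s'_def d_def mdistribs sE[THEN mult_assoc_eq] sE Kp0 Kp0[THEN mult_assoc_eq] p0_def frs)
  define w where "w = a * (D - idm m) * G * p0"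
  have Ksp0: "K * (s * p0) = 0"
  proof -
    have "K * (s' * p0) = 0" by (simp add: Ks'[THEN mult_assoc_eq] mult.assoc Kp0)
    then show ?thesis unfolding sp0 by (simp add: mdistribs frs)
  qed
  have p0d [simp]: "rws (2*n) p0" "cls (2*n) p0" by (simp_all add: p0_def)
  have "s' * (s' * p0) = s' * (p0 * (s * p0)) + E * (b * w)"
    unfolding sp0 w_def[symmetric] by (simp add: distrib_left p0K[OF Ksp0] s'E[THEN mult_assoc_eq] mult.assoc)
  also have "s' * (p0 * (s * p0)) = s * (p0 * (s * p0)) + E * (w * (s * p0))"
    unfolding mult.assoc[symmetric] sp0 w_def by (simp add: mdistribs)
  also have "s * (p0 * (s * p0)) = (s * s - ?I) * p0 + p0" by (simp add: p0K[OF Ksp0] mdistribs)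
  also have "(s * s - ?I) * p0 = E * l" using mink by (simp add: p0_def)
  finally have vp0: "v * p0 = E * (l + w * (s * p0) + b * w)"
    by (simp add: v_def mdistribs)
  define x where "x = l + w * (s * p0) + b * w"
  have vd [simp]: "rws (2*n) v" "cls (2*n) v" by (simp_all add: v_def)
  \<comment> \<open>\<open>K * v = 0\<close> allows \<open>p0\<close> to be inserted between the two
    factors, and \<open>v * p0\<close> lands in the span of \<open>E\<close>, which \<open>v\<close>
    kills.\<close>
  have v2: "v * v = E * (x * v)"
    using p0K[OF Kv] vp0 unfolding x_def[symmetric] by (metis mult.assoc vd(1))
  have v3: "v * (v * v) = 0" unfolding v2 by (simp add: vE[THEN mult_assoc_eq])
  define p where "p = ?I - scl (1/2) v + scl (3/8) (v * v)"
  have sq: "(s' * p) * (s' * p) = ?I" "tr (s' * p) * Jm n * (s' * p) = - Jm n"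
    unfolding p_def by (rule sqrt_unipotent[OF s'd anti' v_def v3])+
  have ssN': "dvm (2 * ?N) v"
  proof -
    obtain Y where Y: "dvm 1 Y" "s' - s = scl ?N Y" using dvm_ex[OF s'N] by blast
    obtain Z where Z: "dvm 1 Z" "s - ?I = scl 2 Z" using dvm_ex[OF s2] by blast
    have s'eq: "s' = s + scl ?N Y" using Y(2) by (simp add: algebra_simps)
    have seq: "s = ?I + scl 2 Z" using Z(2) by (simp add: algebra_simps)
    have Yd: "rws (2*n) Y" "cls (2*n) Y"
    proof -
      have "Y = scl (1/?N) (s' - s)" by (simp add: Y(2))
      then show "rws (2*n) Y" "cls (2*n) Y" by simp_all
    qed
    have "v = (s * s - ?I) + scl ?N (s * Y + Y * s) + scl (?N * ?N) (Y * Y)"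
      unfolding v_def s'eq by (simp add: mdistribs scl_distribs)
    \<comment> \<open>As \<open>s\<close> is 1 mod 2, the cross term is even. This supplies the
      extra factor 2 that pays for the denominators of the square root.\<close>
    also have "s * Y + Y * s = scl 2 (Y + Z * Y + Y * Z)"
      unfolding seq using Yd by (simp add: mdistribs scl_distribs) (auto intro!: fmat_eqI)
    finally have "v = (s * s - ?I) + scl (?N * 2) (Y + Z * Y + Y * Z) + scl (?N * ?N) (Y * Y)"
      by simp
    moreover have "dvm (2 * ?N) (scl (?N * 2) (Y + Z * Y + Y * Z))"
      using dvm_scl[of 1 "Y + Z * Y + Y * Z" "?N * 2"] Y Z by (simp add: mult.commute mult.left_commute)
    moreover have "dvm (2 * ?N) (scl (?N * ?N) (Y * Y))"
    proof -
      have "dvm ((2 * ?N) * of_int (2 ^ j)) (scl (?N * ?N) (Y * Y))"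
        using dvm_scl[of 1 "Y * Y" "?N * ?N"] Y by (simp add: mult.commute mult.left_commute)
      then show ?thesis by (rule dvm_weaken)
    qed
    moreover have "dvm (2 * ?N) (s * s - ?I)" using ssN by simp
    ultimately show ?thesis by simp
  qed
  \<comment> \<open>With \<open>v\<close> divisible by \<open>2 * ?N\<close>, the linear term is
    divisible by \<open>?N\<close> and the quadratic one by \<open>3/8 * (2 * ?N)^2\<close>, which
    is \<open>?N\<close> times the integer \<open>3 * 2^j\<close>.\<close>
  have pN: "dvm ?N (p - ?I)"
  proof -
    have "dvm ?N (scl (1/2) v)" using dvm_scl[OF ssN', of "1/2"] by simp
    moreover have "dvm ?N (scl (3/8) (v * v))"
    proof -
      have "dvm (3/8 * (2 * ?N * (2 * ?N))) (scl (3/8) (v * v))"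
        by (intro dvm_scl dvm_mult ssN')
      moreover have "3/8 * (2 * ?N * (2 * ?N)) = ?N * of_int (3 * 2 ^ j)" by simp
      ultimately show ?thesis using dvm_weaken by metis
    qed
    ultimately show ?thesis by (simp add: p_def)
  qed
  define t where "t = s' * p"
  have "t - s = s' * (p - ?I) + (s' - s)" by (simp add: t_def mdistribs)
  moreover have "dvm 1 s'"
  proof -
    have "dvm 1 (s' - s)" using dvm_weaken[of 1 "2 * 2 ^ j"] s'N by simp
    then show ?thesis using si by (rule dvm_diffD)
  qed
  ultimately have tN: "dvm ?N (t - s)" using pN s'N by (metis dvm_simps(2) dvm_mult_simps(2))
  have tE: "t * E = E * b"
    by (simp add: t_def p_def mdistribs vE vE[THEN mult_assoc_eq] s'E)
  have td: "rws (2*n) t" "cls (2*n) t" by (simp_all add: t_def p_def)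
  have tp0: "t * p0 = s * p0 + E * (w - scl (1/2) (b * x))"
  proof -
    have "t * p0 = s' * p0 - scl (1/2) (s' * (v * p0)) + scl (3/8) (s' * (v * (v * p0)))"
      by (simp add: t_def p_def mdistribs)
    also have "v * p0 = E * x" by (simp add: vp0 x_def)
    finally show ?thesis
      unfolding sp0 w_def[symmetric]
      by (simp add: mdistribs vE[THEN mult_assoc_eq] s'E[THEN mult_assoc_eq])
  qed
  show ?thesis
    using that[OF td _ _ tN tE b bb, of "w - scl (1/2) (b * x)"] sq tp0
    unfolding t_def[symmetric] p0_def by blast
qed

end

text \<open>\<open>G\<close> gives an integral \<open>F0\<close> dual to \<open>E\<close>, with a
  skew Gram matrix \<open>Om\<close>. Adding \<open>E * c\<close> removes \<open>Om\<close> as soon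
  as \<open>c - tr c = Om\<close>; the strictly upper triangular part of \<open>Om\<close> solves
  this without the division by 2 in \<open>Om / 2\<close>.\<close>

lemma frame_extension:
  assumes E: "rws (2*n) E" "cls m E" "tr E * Jm n * E = 0" "dvm 1 E"
    and G: "rws m G" "cls (2*n) G" "dvm 1 G" "G * E = idm m"
  obtains F where "frame n m E F" "dvm 1 F"
proof -
  define F0 where "F0 = - (Jm n * tr G)"
  have F0: "rws (2*n) F0" "cls m F0" "dvm 1 F0" using G by (simp_all add: F0_def)
  have EF0: "tr E * Jm n * F0 = idm m"
  proof -
    have "tr E * tr G = idm m" using arg_cong[OF G(4), of tr] by simp
    then show ?thesis using G by (simp add: F0_def mult.assoc)
  qed
  have F0E: "tr F0 * Jm n * E = - idm m"
  proof -
    have "- (tr F0 * Jm n * E) = idm m" using arg_cong[OF EF0, of tr] by (simp add: mult.assoc)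
    then show ?thesis by (metis minus_minus)
  qed
  define Om where "Om = tr F0 * Jm n * F0"
  have Omd: "rws m Om" "cls m Om" "dvm 1 Om" using F0 by (simp_all add: Om_def)
  have Omt: "tr Om = - Om" by (simp add: Om_def mult.assoc)
  define c where "c = mk m m (\<lambda>i j. if i < j then entry Om i j else 0)"
  have skew: "entry Om i j = - entry Om j i" for i j
    using arg_cong[OF Omt, of "\<lambda>A. entry A j i"] by simp
  have cc: "c - tr c = Om"
  proof (rule fmat_eqI)
    fix i j
    show "entry (c - tr c) i j = entry Om i j"
      using skew[of i j] skew[of i i] Omd(1,2) by (auto simp: c_def rws_def cls_def not_less)
  qed
  have cd: "rws m c" "cls m c" "dvm 1 c"
    using Omd(3) by (auto simp: c_def dvm_def intro: exI[of _ 0])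
  define F where "F = F0 + E * c"
  have EF: "tr E * Jm n * F = idm m" by (simp add: F_def distrib_left EF0 E(3) flip: mult.assoc)
  have "tr F * Jm n * F = Om + (tr F0 * Jm n * E) * c + tr c * (tr E * Jm n * F0) + tr c * (tr E * Jm n * E) * c"
    by (simp add: F_def Om_def mdistribs add.assoc)
  also have "\<dots> = Om - c + tr c" using cd by (simp add: F0E EF0 E(3))
  also have "\<dots> = 0" using cc by (simp add: algebra_simps)
  finally have "tr F * Jm n * F = 0" .
  then have "frame n m E F"
    by unfold_locales (use E F0 cd EF in \<open>auto simp: F_def\<close>)
  moreover have "dvm 1 F" using F0 E cd by (simp add: F_def)
  ultimately show ?thesis using that by blast
qed

section \<open>The Minkowski argument on a boundary point\<close>

abbreviation Jc :: "nat \<Rightarrow> complex fmat" where "Jc n \<equiv> cm (Jm n)"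

lemma tr_Jc [simp]: "tr (Jc n) = - Jc n"
  by (simp flip: maps_simps(19))

text \<open>The number \<open>tr v * Jc n * cj v\<close> is minus its own conjugate, hence purely
  imaginary. \<open>Hf_cv\<close> identifies this form with \<open>Hf\<close>.\<close>

definition herm :: "nat \<Rightarrow> complex fmat \<Rightarrow> real" where
  "herm n v = Im (entry (tr v * Jc n * cj v) 0 0) / 2"

lemma cj_skew: "tr w * Jc n * cj v = - tr (cj (tr v * Jc n * cj w))"
  by (simp add: mult.assoc)

lemma herm_add_orth:
  assumes "tr v * Jc n * cj w = 0"
  shows "herm n (v + w) = herm n v + herm n w"
proof -
  have "tr w * Jc n * cj v = 0" by (subst cj_skew) (simp add: assms)
  with assms show ?thesis by (simp add: herm_def distrib_left distrib_right add_divide_distrib)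
qed

lemma herm_parallelogram: "herm n (v + w) + herm n (v - w) = 2 * herm n v + 2 * herm n w"
  by (simp add: herm_def distrib_left distrib_right left_diff_distrib right_diff_distrib) (simp add: field_simps)

lemma herm_scl: "herm n (scl (of_real r) v) = r\<^sup>2 * herm n v"
  by (simp add: herm_def power2_eq_square)

lemma herm_zero [simp]: "herm n 0 = 0"
  by (simp add: herm_def)

lemma herm_symplectic: "tr g * Jm n * g = Jm n \<Longrightarrow> herm n (cm g * v) = herm n v"
proof -
  assume "tr g * Jm n * g = Jm n"
  then have "cm (tr g * Jm n * g) = Jc n" by simp
  then have "tr (cm g) * (Jc n * (cm g * X)) = Jc n * X" for X by (simp add: mult.assoc[symmetric])
  then show ?thesis by (simp add: herm_def mult.assoc)
qed

lemma herm_anti: "tr g * Jm n * g = - Jm n \<Longrightarrow> herm n (cm g * v) = - herm n v"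
proof -
  assume "tr g * Jm n * g = - Jm n"
  then have "cm (tr g * Jm n * g) = - Jc n" by simp
  then have "tr (cm g) * (Jc n * (cm g * X)) = - (Jc n * X)" for X by (simp add: mult.assoc[symmetric])
  then show ?thesis by (simp add: herm_def mult.assoc)
qed

lemma herm_cj: "herm n (cj v) = - herm n v"
proof -
  have "tr (cj v) * Jc n * v = cj (tr v * Jc n * cj v)" by simp
  then have "entry (tr (cj v) * Jc n * v) 0 0 = cnj (entry (tr v * Jc n * cj v) 0 0)"
    by (simp only: entry_maps)
  then show ?thesis by (simp add: herm_def)
qed

text \<open>Collects coefficient vectors found column by column into matrices. With
  \<open>s = 0\<close> and \<open>C = 0\<close> it serves for a single block.\<close>

lemma matrix_by_columns:
  fixes A :: "'a::comm_ring_1 fmat"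
  assumes "cls q A" "\<And>j. j < q \<Longrightarrow> \<exists>a c. rws r a \<and> rws s c \<and> A * unit_fmat j 0 = B * a + C * c"
  obtains k l where "rws r k" "cls q k" "rws s l" "cls q l" "A = B * k + C * l"
proof -
  obtain a c where ac: "\<And>j. j < q \<Longrightarrow> rws r (a j) \<and> rws s (c j) \<and> A * unit_fmat j 0 = B * a j + C * c j"
    using assms(2) by metis
  define k where "k = mk r q (\<lambda>i j. entry (a j) i 0)"
  define l where "l = mk s q (\<lambda>i j. entry (c j) i 0)"
  have "A = B * k + C * l"
  proof (rule fmat_eqI)
    fix i j
    show "entry A i j = entry (B * k + C * l) i j"
    proof (cases "j < q")
      case True
      have k: "entry k x j = entry (a j) x 0" for x using ac[OF True] True by (auto simp: k_def rws_def)
      have l: "entry l x j = entry (c j) x 0" for x using ac[OF True] True by (auto simp: l_def rws_def)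
      have "rws r k" "rws s l" by (simp_all add: k_def l_def)
      have "entry A i j = entry (A * unit_fmat j 0) i 0" by simp
      also have "\<dots> = (\<Sum>x<r. entry B i x * entry (a j) x 0) + (\<Sum>x<s. entry C i x * entry (c j) x 0)"
        using ac[OF True] by (simp add: entry_times[of r B] entry_times[of s C] del: entry_mult_unit_fmat)
      also have "\<dots> = entry (B * k + C * l) i j"
        using \<open>rws r k\<close> \<open>rws s l\<close> by (simp add: entry_times[of r B] entry_times[of s C] k l)
      finally show ?thesis .
    next
      case False
      moreover have "cls q (B * k + C * l)" by (simp add: k_def l_def)
      ultimately show ?thesis using assms(1) by (simp add: cls_def)
    qed
  qed
  then show ?thesis by (intro that[of k l]) (auto simp: k_def l_def)
qed

lemma entries_tendsto_mult:
  assumes "\<And>i. rws q (a i)" "\<And>k. k < q \<Longrightarrow> (\<lambda>i::nat. entry (a i) k 0) \<longlonglongrightarrow> (0::complex)"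
  shows "(\<lambda>i. entry (B * a i) r 0) \<longlonglongrightarrow> 0"
proof -
  have "(\<lambda>i. \<Sum>k<q. entry B r k * entry (a i) k 0) \<longlonglongrightarrow> (\<Sum>k<q. entry B r k * 0)"
    by (intro tendsto_sum tendsto_mult tendsto_const) (auto intro: assms)
  then show ?thesis using assms(1) by (simp add: entry_times[of q])
qed

lemma integer_null_sequence: "(\<lambda>i. real_of_int (z i)) \<longlonglongrightarrow> 0 \<Longrightarrow> \<forall>\<^sub>F i in sequentially. z i = 0"
proof -
  assume "(\<lambda>i. real_of_int (z i)) \<longlonglongrightarrow> 0"
  then have "\<forall>\<^sub>F i in sequentially. dist (real_of_int (z i)) 0 < 1" by (rule tendstoD) simp
  then show ?thesis by eventually_elim simp
qed

text \<open>
  The boundary point is \<open>{U a + E c}\<close>: the columns of \<open>E\<close> span its null space \<open>L\<close>, and \<open>K v = 0\<close> describes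
  \<open>L^perp\<close>, which the last assumption identifies with the span of the point and its conjugate.
\<close>

locale boundary_point = frame +
  fixes q :: nat and U :: "complex fmat" and c0 :: real
  assumes U_dims [simp]: "rws (2*n) U" "cls q U"
    and UJU: "tr U * Jc n * U = 0" and KU: "cm K * U = 0"
    and c0: "c0 > 0" and pos: "\<And>a k. rws q a \<Longrightarrow> cls 1 a \<Longrightarrow> herm n (U * a) \<ge> c0 * (cmod (entry a k 0))\<^sup>2"
    and perp: "\<And>v. rws (2*n) v \<Longrightarrow> cls 1 v \<Longrightarrow> cm K * v = 0 \<Longrightarrow>
      \<exists>a b c. rws q a \<and> cls 1 a \<and> rws q b \<and> cls 1 b \<and> v = U * a + cj U * b + cm E * c"
begin

lemma UJE: "tr U * Jc n * cm E = 0"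
proof -
  have "tr U * Jc n * cm E = - tr (cm K * U)"
    unfolding K_def by (simp add: mult.assoc)
  then show ?thesis by (simp add: KU)
qed

lemma EJE_c: "tr (cm E) * (Jc n * cm E) = 0"
  using arg_cong[OF EJE, of cm] by (simp add: mult.assoc)

text \<open>L is isotropic and orthogonal to \<open>U\<close>, so the form on the point depends only
  on the class modulo L.\<close>

lemma herm_UE: "herm n (U * a + cm E * c) = herm n (U * a)"
proof -
  have "tr (U * a) * Jc n * cj (cm E * c) = tr a * (tr U * Jc n * cm E) * cj c"
    by (simp add: mult.assoc)
  then have "herm n (U * a + cm E * c) = herm n (U * a) + herm n (cm E * c)"
    by (intro herm_add_orth) (simp add: UJE)
  moreover have "tr (cm E * c) * Jc n * cj (cm E * c) = tr c * (tr (cm E) * (Jc n * cm E)) * cj c"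
    by (simp add: mult.assoc)
  then have "herm n (cm E * c) = 0" by (simp add: herm_def EJE_c)
  ultimately show ?thesis by simp
qed

lemma herm_E: "herm n (cm E * c) = 0"
  using herm_UE[of 0 c] by simp

lemma herm_U_nonneg: "rws q a \<Longrightarrow> cls 1 a \<Longrightarrow> herm n (U * a) \<ge> 0"
  using pos[of a 0] c0 by (meson order_trans zero_le_power2 mult_nonneg_nonneg less_imp_le)

lemma herm_U_zero: "rws q a \<Longrightarrow> cls 1 a \<Longrightarrow> herm n (U * a) \<le> 0 \<Longrightarrow> a = 0"
proof (rule fmat_eqI)
  fix i j assume a: "rws q a" "cls 1 a" "herm n (U * a) \<le> 0"
  have "c0 * (cmod (entry a i 0))\<^sup>2 \<le> 0" using pos[OF a(1,2), of i] a(3) by simp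
  then have "entry a i 0 = 0" using c0 by (simp add: mult_le_0_iff)
  then show "entry a i j = entry 0 i j" using a(2) by (cases j) (auto simp: cls_def)
qed

lemma herm_null_iff: "rws q a \<Longrightarrow> cls 1 a \<Longrightarrow> herm n (U * a + cm E * c) = 0 \<Longrightarrow> a = 0"
  using herm_U_zero by (simp add: herm_UE)

text \<open>
  \<open>1 + 4 k\<close> is an isometry of the positive form on the point modulo \<open>L\<close>, so \<open>k\<close> contracts it by the factor 1/2.
  The powers of the integral matrix \<open>X = (s^2 - 1) / 4\<close> therefore tend to 0 modulo \<open>L\<close>, hence vanish eventually, and
  a unipotent isometry is trivial.
\<close>

lemma minkowski_trivial:
  fixes s :: "real fmat"
  assumes s [simp]: "rws (2*n) s" "cls (2*n) s" and anti: "tr s * Jm n * s = - Jm n"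
    and ss4: "dvm 4 (s * s - idm (2*n))"
    and Ei: "dvm 1 E" and Fi: "dvm 1 F"
    and sE: "s * E = E * a0" and sU: "cm s * U = cj U * k0 + cm E * l0"
    and k0 [simp]: "rws q k0" "cls q k0"
  shows "\<exists>l. (s * s - idm (2*n)) * (idm (2*n) - F * K) = E * l"
proof -
  let ?I = "idm (2*n) :: real fmat"
  define X where "X = scl (1/4) (s * s - ?I)"
  have Xd [simp]: "rws (2*n) X" "cls (2*n) X" by (simp_all add: X_def)
  have Xi: "dvm 1 X" using dvm_scl[OF ss4, of "1/4"] by (simp add: X_def)
  \<comment> \<open>Modulo L, \<open>s\<close> sends \<open>U\<close> to \<open>cj U * k0\<close>,
    and being real it sends \<open>cj U\<close> to \<open>U * cj k0\<close>; so \<open>f\<close> is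
    the matrix of \<open>s * s\<close> on the point modulo L.\<close>
  define f where "f = cj k0 * k0"
  define k where "k = scl (1/4) (f - idm q)"
  have fd [simp]: "rws q f" "cls q f" by (simp_all add: f_def)
  have kd [simp]: "rws q k" "cls q k" by (simp_all add: k_def)
  have f: "f = idm q + scl 4 k" by (simp add: k_def)
  have sEc: "cm s * cm E = cm E * cm a0" using arg_cong[OF sE, of cm] by simp
  have ssU: "cm (s * s) * U = U * f + cm E * (cj l0 * k0 + cm a0 * l0)"
  proof -
    have "cm (s * s) * U = cm s * (cm s * U)" by (simp add: mult.assoc)
    also have "\<dots> = cm s * cj U * k0 + cm s * (cm E * l0)"
      unfolding sU by (simp only: distrib_left mult.assoc)
    also have "cm s * cj U = cj (cm s * U)" by simp
    finally have "cm (s * s) * U = cj (cm s * U) * k0 + cm s * (cm E * l0)" .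
    then show ?thesis
      by (simp add: sU sEc[THEN mult_assoc_eq] f_def mdistribs)
  qed
  define la where "la = scl (1/4) (cj l0 * k0 + cm a0 * l0)"
  have XU: "cm X * U = U * k + cm E * la"
    using ssU by (simp add: X_def left_diff_distrib k_def la_def right_diff_distrib distrib_left scl_distribs)
  have XE': "cm X * cm E = cm E * cm (scl (1/4) (a0 * a0)) - scl (1/4) (cm E)"
    by (simp add: X_def left_diff_distrib scl_distribs mult.assoc sEc sEc[THEN mult_assoc_eq])
  define x0 where "x0 = cm (scl (1/4) (a0 * a0)) - scl (1/4) (idm m)"
  have XE: "cm X * cm E = cm E * x0"
    using XE' by (simp add: x0_def right_diff_distrib)
  have ssJ: "tr (s * s) * Jm n * (s * s) = Jm n"
  proof -
    have "tr (s * s) * Jm n * (s * s) = tr s * (tr s * Jm n * s) * s" by (simp add: mult.assoc)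
    then show ?thesis using anti by simp
  qed
  have hf: "herm n (U * (f * a)) = herm n (U * a)" for a
  proof -
    have "cm (s * s) * (U * a) = U * (f * a) + cm E * ((cj l0 * k0 + cm a0 * l0) * a)"
      using ssU[THEN mult_assoc_eq, of a] by (simp only: distrib_right mult.assoc)
    then show ?thesis using herm_symplectic[OF ssJ, of "U * a"] herm_UE by metis
  qed
  have hdiff: "herm n (U * (a - b)) \<le> 2 * herm n (U * a) + 2 * herm n (U * b)"
    if "rws q a" "cls 1 a" "rws q b" "cls 1 b" for a b
    using herm_parallelogram[of n "U * a" "U * b"] herm_U_nonneg[of "a + b"] that
    by (simp add: distrib_left right_diff_distrib)
  have hscl: "herm n (U * scl (of_real r) a) = r\<^sup>2 * herm n (U * a)" for r a
    by (simp add: herm_scl)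
  \<comment> \<open>\<open>4 k a\<close> is the difference of \<open>f a\<close> and
    \<open>a\<close>, which have equal form. The parallelogram law bounds its form by 4 times that
    of \<open>a\<close>, and the scaling contributes 16.\<close>
  have contr: "herm n (U * (k * a)) \<le> herm n (U * a) / 4" if a: "rws q a" "cls 1 a" for a
  proof -
    have "f * a - a = scl (of_real 4) (k * a)" using a by (simp add: f distrib_right)
    then have "herm n (U * scl (of_real 4) (k * a)) \<le> 2 * herm n (U * (f * a)) + 2 * herm n (U * a)"
      using hdiff[of "f * a" a] a by simp
    then show ?thesis unfolding hscl hf by simp
  qed
  \<comment> \<open>The ring of finitely supported matrices has no unit, hence no power operation;
    powers are iterated left multiplications.\<close>
  define it where "it = (\<lambda>i. ((*) k ^^ i))"
  have it0: "it 0 a = a" and itS: "it (Suc i) a = k * it i a" for i a by (simp_all add: it_def)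
  have itd [simp]: "rws q a \<Longrightarrow> rws q (it i a)" "cls r a \<Longrightarrow> cls r (it i a)" for a i r
    by (induction i) (simp_all add: it0 itS)
  have hit: "herm n (U * it i a) \<le> herm n (U * a) / 4 ^ i" if a: "rws q a" "cls 1 a" for a i
  proof (induction i)
    case (Suc i)
    have "herm n (U * it (Suc i) a) \<le> herm n (U * it i a) / 4"
      unfolding itS by (rule contr) (use a in simp_all)
    also have "\<dots> \<le> herm n (U * a) / 4 ^ i / 4" using Suc by simp
    finally show ?case by simp
  qed (simp add: it0)
  have lim: "(\<lambda>i. entry (it i a) x 0) \<longlonglongrightarrow> 0" if a: "rws q a" "cls 1 a" for a x
  proof -
    define C where "C = herm n (U * a) / c0"
    have le: "norm (entry (it i a) x 0) \<le> sqrt C * (1/2) ^ i" for i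
    proof -
      have "c0 * (cmod (entry (it i a) x 0))\<^sup>2 \<le> herm n (U * a) / 4 ^ i"
        using pos[of "it i a" x] hit[OF a, of i] a by simp
      then have "(cmod (entry (it i a) x 0))\<^sup>2 \<le> C * (1/4) ^ i"
        using c0 by (simp add: C_def field_simps)
      then have "cmod (entry (it i a) x 0) \<le> sqrt (C * (1/4) ^ i)"
        by (simp add: real_le_rsqrt)
      also have "\<dots> = sqrt C * (1/2) ^ i"
        by (simp add: real_sqrt_mult real_sqrt_power real_sqrt_divide)
      finally show ?thesis .
    qed
    have "(\<lambda>i. sqrt C * (1/2) ^ i) \<longlonglongrightarrow> sqrt C * 0"
      by (intro tendsto_mult tendsto_const LIMSEQ_power_zero) simp
    then have l0: "(\<lambda>i. sqrt C * (1/2) ^ i) \<longlonglongrightarrow> 0" by simp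
    have "(\<lambda>i. norm (entry (it i a) x 0)) \<longlonglongrightarrow> 0"
      by (rule tendsto_sandwich[OF _ _ tendsto_const l0]) (use le in auto)
    then show ?thesis by (rule tendsto_norm_zero_cancel)
  qed
  define p where "p = ?I - E * G"
  define p0 where "p0 = ?I - F * K"
  have pd [simp]: "rws (2*n) p" "cls (2*n) p" "rws (2*n) p0" "cls (2*n) p0" by (simp_all add: p_def p0_def)
  have pE: "cm p * cm E = 0"
  proof -
    have "p * E = 0" by (simp add: p_def mdistribs frs)
    then show ?thesis by (metis maps_simps(1,12))
  qed
  define Xp where "Xp = (\<lambda>i. ((*) X ^^ i) ?I)"
  have Xp0: "Xp 0 = ?I" and XpS: "Xp (Suc i) = X * Xp i" for i by (simp_all add: Xp_def)
  have Xpd [simp]: "rws (2*n) (Xp i)" "cls (2*n) (Xp i)" for i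
    by (induction i) (simp_all add: Xp0 XpS)
  have Xpi: "dvm 1 (Xp i)" for i by (induction i) (simp_all add: Xp0 XpS Xi)
  have XpU: "\<exists>c. cm (Xp i) * (U * a) = U * it i a + cm E * c" if "rws q a" for i a
  proof (induction i)
    case 0
    have "cm (Xp 0) * (U * a) = U * it 0 a + cm E * 0" by (simp add: Xp0 it0)
    then show ?case by blast
  next
    case (Suc i)
    then obtain c where c: "cm (Xp i) * (U * a) = U * it i a + cm E * c" by blast
    have "cm (Xp (Suc i)) * (U * a) = cm X * (cm (Xp i) * (U * a))" by (simp add: XpS mult.assoc)
    also have "\<dots> = U * it (Suc i) a + cm E * (la * it i a + x0 * c)"
      unfolding c itS by (simp add: distrib_left XU[THEN mult_assoc_eq] XE[THEN mult_assoc_eq] distrib_right mult.assoc add.assoc)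
    finally show ?case by blast
  qed
  have XpE: "\<exists>c'. cm (Xp i) * (cm E * c) = cm E * c'" for i c
  proof (induction i)
    case 0
    have "cm (Xp 0) * (cm E * c) = cm E * c" by (simp add: Xp0)
    then show ?case by blast
  next
    case (Suc i)
    then obtain c' where c': "cm (Xp i) * (cm E * c) = cm E * c'" by blast
    have "cm (Xp (Suc i)) * (cm E * c) = cm X * (cm (Xp i) * (cm E * c))" by (simp add: XpS mult.assoc)
    also have "\<dots> = cm E * (x0 * c')" unfolding c' by (simp add: XE[THEN mult_assoc_eq] mult.assoc)
    finally show ?case by blast
  qed
  have pXU: "cm (p * Xp i) * (U * a) = cm p * U * it i a" if "rws q a" for i a
  proof -
    obtain c where "cm (Xp i) * (U * a) = U * it i a + cm E * c" using XpU[OF \<open>rws q a\<close>] by blast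
    then show ?thesis by (simp add: mult.assoc distrib_left pE[THEN mult_assoc_eq])
  qed
  have pXE: "cm (p * Xp i) * (cm E * c) = 0" for i c
  proof -
    obtain c' where "cm (Xp i) * (cm E * c) = cm E * c'" using XpE by blast
    then show ?thesis by (simp add: mult.assoc pE[THEN mult_assoc_eq])
  qed
  have Kp0: "cm K * cm p0 = 0"
  proof -
    have "K * p0 = 0" by (simp add: p0_def mdistribs frs)
    then show ?thesis by (metis maps_simps(1,12))
  qed
  \<comment> \<open>The action of \<open>X^i\<close> on L^perp modulo L, written as an integral
    matrix: \<open>p0\<close> projects onto L^perp and \<open>p\<close> kills L. By
    \<open>perp\<close> each column of \<open>p0\<close> splits into a part in the point, a part in
    its conjugate and a part in L.\<close>
  define R where "R i = p * Xp i * p0" for i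
  have Rd: "rws (2*n) (R i)" "cls (2*n) (R i)" for i by (simp_all add: R_def)
  have Rint: "dvm 1 (R i)" for i
    using Xpi Ei Fi by (simp add: R_def p_def p0_def G_def K_def)
  have Rlim: "(\<lambda>i. entry (R i) x y) \<longlonglongrightarrow> 0" for x y
  proof -
    define v where "v = cm p0 * unit_fmat y 0"
    have "cm K * v = 0" by (simp add: v_def Kp0[THEN mult_assoc_eq])
    moreover have "rws (2*n) v" "cls 1 v" by (simp_all add: v_def)
    ultimately obtain a b c where abc: "rws q a" "cls 1 a" "rws q b" "cls 1 b" "v = U * a + cj U * b + cm E * c"
      using perp by blast
    \<comment> \<open>The matrices are real, so decay on the conjugate point follows from decay on
      the point.\<close>
    have "cm (p * Xp i) * (cj U * b) = cj (cm p * U * it i (cj b))" for i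
    proof -
      have "cm (p * Xp i) * (cj U * b) = cj (cm (p * Xp i) * (U * cj b))" by simp
      also have "\<dots> = cj (cm p * U * it i (cj b))"
        by (subst pXU) (use abc in simp_all)
      finally show ?thesis .
    qed
    then have Rv: "cm (R i) * unit_fmat y 0 = cm p * U * it i a + cj (cm p * U * it i (cj b))" for i
    proof -
      assume *: "\<And>i. cm (p * Xp i) * (cj U * b) = cj (cm p * U * it i (cj b))"
      have "cm (R i) * unit_fmat y 0 = cm (p * Xp i) * v" by (simp add: R_def v_def mult.assoc)
      also have "\<dots> = cm (p * Xp i) * (U * a) + cm (p * Xp i) * (cj U * b) + cm (p * Xp i) * (cm E * c)"
        unfolding abc(5) by (simp only: distrib_left)
      finally show ?thesis unfolding * pXE using pXU[OF abc(1)] by simp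
    qed
    have "(\<lambda>i. entry (cm p * U * it i a) x 0) \<longlonglongrightarrow> 0"
      by (rule entries_tendsto_mult[of q]) (use abc lim in auto)
    moreover have "(\<lambda>i. entry (cm p * U * it i (cj b)) x 0) \<longlonglongrightarrow> 0"
      by (rule entries_tendsto_mult[of q]) (use abc lim in auto)
    then have "(\<lambda>i. cnj (entry (cm p * U * it i (cj b)) x 0)) \<longlonglongrightarrow> cnj 0" by (rule tendsto_cnj)
    ultimately have "(\<lambda>i. entry (cm p * U * it i a) x 0 + cnj (entry (cm p * U * it i (cj b)) x 0)) \<longlonglongrightarrow> 0 + cnj 0"
      by (rule tendsto_add)
    moreover have "complex_of_real (entry (R i) x y) = entry (cm p * U * it i a) x 0 + cnj (entry (cm p * U * it i (cj b)) x 0)" for i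
      using arg_cong[OF Rv[of i], of "\<lambda>A. entry A x 0"]
      by (simp only: entry_plus entry_maps entry_mult_unit_fmat refl if_True)
    ultimately have "(\<lambda>i. complex_of_real (entry (R i) x y)) \<longlonglongrightarrow> 0" by simp
    from tendsto_Re[OF this] show ?thesis by simp
  qed
  have Rev: "\<forall>\<^sub>F i in sequentially. entry (R i) x y = 0" for x y
  proof -
    have "\<forall>i. \<exists>z::int. entry (R i) x y = of_int z" using Rint by (simp add: dvm_def)
    then obtain z :: "nat \<Rightarrow> int" where z: "\<And>i. entry (R i) x y = of_int (z i)" by metis
    then have "(\<lambda>i. real_of_int (z i)) \<longlonglongrightarrow> 0" using Rlim[of x y] by simp
    then have "\<forall>\<^sub>F i in sequentially. z i = 0" by (rule integer_null_sequence)
    then show ?thesis by eventually_elim (simp add: z)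
  qed
  have "\<forall>\<^sub>F i in sequentially. \<forall>x\<in>{..<2*n}. \<forall>y\<in>{..<2*n}. entry (R i) x y = 0"
    by (intro eventually_ball_finite ballI Rev finite_lessThan)
  then obtain i0 where "\<forall>x\<in>{..<2*n}. \<forall>y\<in>{..<2*n}. entry (R i0) x y = 0"
    using eventually_happens'[OF sequentially_bot] by blast
  then have R0: "R i0 = 0"
    using Rd[of i0] unfolding rws_def cls_def
    by (intro fmat_eqI) (metis entry_zero lessThan_iff not_le)
  have p0U: "cm p0 * U = U" by (simp add: p0_def left_diff_distrib mult.assoc KU)
  \<comment> \<open>\<open>R i0 = 0\<close> puts \<open>U * it i0 a\<close> into L, where the form
    vanishes, while on combinations of \<open>U\<close> it is definite.\<close>
  have nil: "it i0 a = 0" if a: "rws q a" "cls 1 a" for a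
  proof -
    have "cm (p * Xp i0) * (U * a) = cm (R i0) * (U * a)"
      by (simp add: R_def mult.assoc p0U[THEN mult_assoc_eq])
    then have "cm p * U * it i0 a = 0" using pXU[OF a(1), of i0] by (simp add: R0)
    then have "U * it i0 a = cm E * (cm G * (U * it i0 a))"
      by (simp add: p_def left_diff_distrib mult.assoc)
    then have "herm n (U * it i0 a) = 0" using herm_E by metis
    then show ?thesis using herm_U_zero[of "it i0 a"] a by simp
  qed
  \<comment> \<open>If \<open>k * k\<close> kills \<open>b\<close>, then applying \<open>f\<close>
    repeatedly to \<open>b\<close> gives \<open>b + 4 j (k b)\<close>, all of the same form. The
    form of \<open>4 j (k b)\<close> is therefore bounded in \<open>j\<close> although it grows like
    \<open>j^2\<close>, so \<open>k * b = 0\<close>.\<close>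
  have step: "k * b = 0" if b: "rws q b" "cls 1 b" and kkb: "k * (k * b) = 0" for b
  proof -
    have fj: "herm n (U * (b + scl (of_real (4 * real j)) (k * b))) = herm n (U * b)" for j
    proof (induction j)
      case (Suc j)
      have "f * (b + scl (of_real (4 * real j)) (k * b)) = b + scl (of_real (4 * real (Suc j))) (k * b)"
        using b kkb by (simp add: f distrib_right distrib_left kkb) (auto intro!: fmat_eqI simp: algebra_simps)
      then show ?case using hf Suc by metis
    qed simp
    have bd: "16 * (real j)\<^sup>2 * herm n (U * (k * b)) \<le> 4 * herm n (U * b)" for j
    proof -
      have "herm n (U * scl (of_real (4 * real j)) (k * b)) \<le> 2 * herm n (U * (b + scl (of_real (4 * real j)) (k * b))) + 2 * herm n (U * b)"
        using hdiff[of "b + scl (of_real (4 * real j)) (k * b)" b] b by simp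
      then show ?thesis unfolding fj hscl by (simp add: power_mult_distrib)
    qed
    have "herm n (U * (k * b)) \<le> 0"
    proof (rule ccontr)
      assume "\<not> ?thesis"
      then have p: "herm n (U * (k * b)) > 0" by simp
      obtain j :: nat where j: "herm n (U * b) / herm n (U * (k * b)) < real j" using reals_Archimedean2 by blast
      then have j1: "herm n (U * b) < real j * herm n (U * (k * b))" using p by (simp add: field_simps)
      have "herm n (U * b) \<ge> 0" using b by (rule herm_U_nonneg)
      then have "real j > 0" using j1 p by (metis le_less_trans mult_eq_0_iff not_gr_zero of_nat_0 of_nat_0_less_iff order_less_irrefl)
      then have "real j \<ge> 1" by simp
      then have "real j * 1 \<le> real j * real j" by (intro mult_left_mono) auto
      then have "real j * herm n (U * (k * b)) \<le> (real j)\<^sup>2 * herm n (U * (k * b))"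
        using p by (intro mult_right_mono) (auto simp: power2_eq_square)
      then show False using bd[of j] j1 \<open>herm n (U * b) \<ge> 0\<close> by linarith
    qed
    then show ?thesis using herm_U_zero[of "k * b"] b by simp
  qed
  have desc: "\<forall>a. rws q a \<longrightarrow> cls 1 a \<longrightarrow> it (Suc i) a = 0 \<Longrightarrow> \<forall>a. rws q a \<longrightarrow> cls 1 a \<longrightarrow> k * a = 0" for i
  proof (induction i)
    case 0
    then show ?case by (simp add: itS it0)
  next
    case (Suc i)
    have "it (Suc i) a = 0" if "rws q a" "cls 1 a" for a
      using step[of "it i a"] Suc.prems that by (simp add: itS)
    then show ?case using Suc.IH by blast
  qed
  have k0': "k * a = 0" if a: "rws q a" "cls 1 a" for a
    using desc[of i0] nil that by (simp add: itS)
  have XUa: "cm p * (cm X * (U * a)) = 0" if "rws q a" "cls 1 a" for a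
    using k0'[OF that] by (simp add: XU[THEN mult_assoc_eq] distrib_right distrib_left mult.assoc pE[THEN mult_assoc_eq])
  have "p * X * p0 = 0"
  proof (rule fmat_eqI)
    fix x y
    define v where "v = cm p0 * unit_fmat y 0"
    have "cm K * v = 0" by (simp add: v_def Kp0[THEN mult_assoc_eq])
    moreover have "rws (2*n) v" "cls 1 v" by (simp_all add: v_def)
    ultimately obtain a b c where abc: "rws q a" "cls 1 a" "rws q b" "cls 1 b" "v = U * a + cj U * b + cm E * c"
      using perp by blast
    have "cm p * (cm X * (cj U * b)) = cj (cm p * (cm X * (U * cj b)))" by simp
    also have "\<dots> = 0" by (subst XUa) (use abc in simp_all)
    finally have "cm p * (cm X * (cj U * b)) = 0" .
    then have "cm p * (cm X * v) = 0"
      unfolding abc(5) using XUa[OF abc(1,2)]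
      by (simp add: distrib_left XE[THEN mult_assoc_eq] pE[THEN mult_assoc_eq] mult.assoc)
    then have "entry (cm (p * X * p0) * unit_fmat y 0) x 0 = 0" by (simp add: v_def mult.assoc)
    then show "entry (p * X * p0) x y = entry 0 x y"
      by (simp only: entry_mult_unit_fmat entry_maps refl if_True of_real_eq_0_iff entry_zero)
  qed
  then have "p * (s * s - ?I) * p0 = 0"
  proof -
    have "p * (s * s - ?I) * p0 = scl 4 (p * X * p0)" by (simp add: X_def)
    then show ?thesis using \<open>p * X * p0 = 0\<close> by simp
  qed
  then have "(s * s - ?I) * p0 = E * (G * (s * s - ?I) * p0)"
    by (simp add: p_def left_diff_distrib mult.assoc)
  then show ?thesis unfolding p0_def by blast
qed

end

section \<open>Positive Lagrangians and the Siegel upper half space\<close>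

text \<open>Column \<open>j\<close> is the unit vector with index \<open>f j\<close>; products with
  \<open>sel\<close> and its transpose pick out or insert blocks of coordinates.\<close>

definition sel :: "nat \<Rightarrow> nat \<Rightarrow> (nat \<Rightarrow> nat) \<Rightarrow> 'a::comm_ring_1 fmat" where
  "sel r c f = mk r c (\<lambda>i j. if i = f j then 1 else 0)"

lemma sel_dims [simp]: "r \<le> r' \<Longrightarrow> rws r' (sel r c f)" "c \<le> c' \<Longrightarrow> cls c' (sel r c f)"
  by (simp_all add: sel_def)

lemma sel_maps [simp]: "cm (sel r c f) = sel r c f" "cj (sel r c f) = sel r c f"
  by (auto intro!: fmat_eqI simp: sel_def)

lemma entry_sel: "entry (sel r c f) i j = (if i < r \<and> j < c \<and> i = f j then 1 else 0)"
  by (auto simp: sel_def)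

lemma entry_mult_sel: "(\<And>j. j < c \<Longrightarrow> f j < r) \<Longrightarrow> entry (A * sel r c f) i j = (if j < c then entry A i (f j) else 0)"
proof -
  assume f: "\<And>j. j < c \<Longrightarrow> f j < r"
  have "entry (A * sel r c f) i j = (\<Sum>k<r. entry A i k * entry (sel r c f) k j)"
    by (rule entry_times) simp
  also have "\<dots> = (\<Sum>k<r. if k = f j then (if j < c then entry A i (f j) else 0) else 0)"
    by (rule sum.cong) (auto simp: entry_sel)
  finally show ?thesis using f[of j] by auto
qed

lemma entry_trsel_mult: "(\<And>j. j < c \<Longrightarrow> f j < r) \<Longrightarrow> entry (tr (sel r c f) * A) i j = (if i < c then entry A (f i) j else 0)"
proof -
  assume f: "\<And>j. j < c \<Longrightarrow> f j < r"
  have "entry (tr (sel r c f) * A) i j = entry (tr A * sel r c f) j i"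
    by (metis entry_tr tr_mult tr_simps(5))
  then show ?thesis using f by (simp add: entry_mult_sel)
qed

lemma entry_Jc_mult:
  "entry (Jc n * A) i j = (if i < n then entry A (i + n) j else if i < 2*n then - entry A (i - n) j else 0)"
proof -
  have "entry (Jc n * A) i j = (\<Sum>k<2*n. entry (Jc n) i k * entry A k j)"
    by (intro entry_times disjI1) simp
  also have "\<dots> = (\<Sum>k<2*n. if k = (if i < n then i + n else i - n) then
      (if i < n then entry A (i + n) j else if i < 2*n then - entry A (i - n) j else 0) else 0)"
    by (rule sum.cong) (auto simp: entry_Jm Jmat_def)
  finally show ?thesis by auto
qed

definition tp :: "nat \<Rightarrow> 'a::comm_ring_1 fmat" where "tp n = sel (2*n) n (\<lambda>j. j)"
definition bt :: "nat \<Rightarrow> 'a::comm_ring_1 fmat" where "bt n = sel (2*n) n (\<lambda>j. n + j)"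

lemma tpbt_dims [simp]: "rws (2*n) (tp n)" "cls n (tp n)" "rws (2*n) (bt n)" "cls n (bt n)"
  "cm (tp n) = tp n" "cm (bt n) = bt n" "cj (tp n) = tp n" "cj (bt n) = bt n"
  by (simp_all add: tp_def bt_def)

lemma tpbt:
  "tr (tp n) * tp n = idm n" "tr (bt n) * bt n = idm n" "tr (tp n) * bt n = 0" "tr (bt n) * tp n = 0"
  "Jc n * tp n = - bt n" "Jc n * bt n = tp n"
  by (auto intro!: fmat_eqI simp: tp_def bt_def entry_trsel_mult entry_sel entry_Jc_mult)

lemma tpbt_split: "rws (2*n) M \<Longrightarrow> M = tp n * (tr (tp n) * M) + bt n * (tr (bt n) * M)"
proof -
  assume M: "rws (2*n) M"
  have "(tp n * tr (tp n) + bt n * tr (bt n) :: 'a fmat) = idm (2*n)"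
  proof (rule fmat_eqI)
    fix i j
    have 1: "entry (tp n * tr (tp n) :: 'a fmat) i j = (\<Sum>k<n. entry (tp n) i k * entry (tp n) j k)"
      by (subst entry_times[of n]) auto
    have 2: "entry (bt n * tr (bt n) :: 'a fmat) i j = (\<Sum>k<n. entry (bt n) i k * entry (bt n) j k)"
      by (subst entry_times[of n]) auto
    have "(\<Sum>k<n. entry (tp n) i k * entry (tp n) j k :: 'a) = (\<Sum>k<n. if k = i then (if i = j then 1 else 0) else 0)"
      by (rule sum.cong) (auto simp: tp_def entry_sel)
    moreover have "(\<Sum>k<n. entry (bt n) i k * entry (bt n) j k :: 'a) = (\<Sum>k<n. if k = i - n then (if i = j \<and> n \<le> i then 1 else 0) else 0)"
      by (rule sum.cong) (auto simp: bt_def entry_sel)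
    ultimately show "entry (tp n * tr (tp n) + bt n * tr (bt n)) i j = entry (idm (2*n) :: 'a fmat) i j"
      unfolding entry_plus 1 2 by auto
  qed
  then have "(tp n * tr (tp n) + bt n * tr (bt n)) * M = M" using M by simp
  then show ?thesis by (simp add: distrib_right mult.assoc)
qed

text \<open>The block column with \<open>Z\<close> on top of the identity, whose column span is the
  Lagrangian of the point \<open>Z\<close>.\<close>

definition stk :: "nat \<Rightarrow> complex fmat \<Rightarrow> complex fmat" where
  "stk n Z = tp n * Z + bt n"

lemma stk_dims [simp]: "rws (2*n) (stk n Z)" "cls n Z \<Longrightarrow> cls n (stk n Z)"
  by (simp_all add: stk_def)

abbreviation zm :: "nat \<Rightarrow> (nat \<Rightarrow> nat \<Rightarrow> complex) \<Rightarrow> complex fmat" where "zm n Z \<equiv> mk n n Z"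

lemma stk_isotropic: "rws n Z \<Longrightarrow> cls n Z \<Longrightarrow> tr Z = Z \<Longrightarrow> tr (stk n Z) * Jc n * stk n Z = 0"
  by (simp add: stk_def mdistribs tpbt tpbt[THEN mult_assoc_eq])

section \<open>Positivity of the Hermitian form on points of the upper half space\<close>

lemma herm_stk:
  assumes "rws n Z" "cls n Z" "rws n a" "cls 1 a"
  shows "herm n (stk n Z * a) = Im (\<Sum>i<n. \<Sum>j<n. cnj (entry a i 0) * entry Z i j * entry a j 0)"
proof -
  have v: "stk n Z * a = tp n * (Z * a) + bt n * a" by (simp add: stk_def distrib_right mult.assoc)
  have "tr (stk n Z * a) * Jc n * cj (stk n Z * a) = tr (Z * a) * cj a - tr a * cj (Z * a)"
    unfolding v using assms
    by (simp add: mdistribs tpbt tpbt[THEN mult_assoc_eq])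
  moreover have "tr a * cj (Z * a) = tr (cj (tr (Z * a) * cj a))" by (simp add: mult.assoc)
  ultimately have "herm n (stk n Z * a) = Im (entry (tr (Z * a) * cj a) 0 0 - entry (tr (cj (tr (Z * a) * cj a))) 0 0) / 2"
    unfolding herm_def by (simp only: entry_minus)
  also have "\<dots> = Im (entry (tr (Z * a) * cj a) 0 0)"
    by (simp only: entry_tr entry_maps minus_complex.simps cnj.simps) simp
  also have "entry (tr (Z * a) * cj a) 0 0 = (\<Sum>i<n. (\<Sum>j<n. entry Z i j * entry a j 0) * cnj (entry a i 0))"
    using assms by (subst entry_times[of n]) (auto simp: entry_times[of n] mult.commute)
  also have "\<dots> = (\<Sum>i<n. \<Sum>j<n. cnj (entry a i 0) * entry Z i j * entry a j 0)"
    by (simp add: sum_distrib_left mult_ac)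
  finally show ?thesis .
qed

lemma siegel_zm: "Z \<in> siegel n \<Longrightarrow> tr (zm n Z) = zm n Z"
  by (rule fmat_eqI) (auto simp: siegel_def)

text \<open>The terms with the real part of \<open>Z\<close> cancel by symmetry, leaving the
  quadratic form of the imaginary part on the real and imaginary parts of \<open>a\<close>
  separately.\<close>

lemma herm_siegel:
  assumes Z: "Z \<in> siegel n" and a: "rws n a" "cls 1 a"
  shows "herm n (stk n (zm n Z) * a) =
    (\<Sum>i<n. \<Sum>j<n. Re (entry a i 0) * Im (Z i j) * Re (entry a j 0)) +
    (\<Sum>i<n. \<Sum>j<n. Im (entry a i 0) * Im (Z i j) * Im (entry a j 0))"
proof -
  have sym: "Z i j = Z j i" if "i < n" "j < n" for i j using Z that by (auto simp: siegel_def)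
  let ?x = "\<lambda>i. Re (entry a i 0)" and ?y = "\<lambda>i. Im (entry a i 0)"
  have "herm n (stk n (zm n Z) * a) = (\<Sum>i<n. \<Sum>j<n. Im (cnj (entry a i 0) * Z i j * entry a j 0))"
    using a by (subst herm_stk) auto
  also have "\<dots> = (\<Sum>i<n. \<Sum>j<n. ?x i * Im (Z i j) * ?x j + ?y i * Im (Z i j) * ?y j +
      (?x i * Re (Z i j) * ?y j - ?y i * Re (Z i j) * ?x j))"
    by (intro sum.cong refl) (simp add: algebra_simps)
  also have "\<dots> = (\<Sum>i<n. \<Sum>j<n. ?x i * Im (Z i j) * ?x j) + (\<Sum>i<n. \<Sum>j<n. ?y i * Im (Z i j) * ?y j)
     + ((\<Sum>i<n. \<Sum>j<n. ?x i * Re (Z i j) * ?y j) - (\<Sum>i<n. \<Sum>j<n. ?y i * Re (Z i j) * ?x j))"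
    by (simp add: sum.distrib sum_subtractf)
  also have "(\<Sum>i<n. \<Sum>j<n. ?y i * Re (Z i j) * ?x j) = (\<Sum>j<n. \<Sum>i<n. ?y i * Re (Z i j) * ?x j)"
    by (rule sum.swap)
  also have "\<dots> = (\<Sum>i<n. \<Sum>j<n. ?x i * Re (Z i j) * ?y j)"
    by (intro sum.cong refl) (use sym in auto)
  finally show ?thesis by simp
qed

lemma siegel_pos:
  "Z \<in> siegel n \<Longrightarrow> \<exists>i<n. x i \<noteq> 0 \<Longrightarrow> 0 < (\<Sum>i<n. \<Sum>j<n. x i * Im (Z i j) * x j)"
  by (simp add: siegel_def)

lemma siegel_imag_inverse:
  assumes "Z \<in> siegel q"
  defines "Y \<equiv> mk q q (\<lambda>i j. Im (Z i j))"
  obtains B where "rws q B" "cls q B" "Y * B = idm q" "B * Y = idm q"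
proof (rule inverse_ex[of q Y])
  show "rws q Y" "cls q Y" by (simp_all add: Y_def)
  fix a assume a: "rws q a" "cls 1 a" "Y * a = 0"
  have "\<not> (\<exists>i<q. entry a i 0 \<noteq> 0)"
  proof
    assume "\<exists>i<q. entry a i 0 \<noteq> 0"
    then have "(\<Sum>i<q. \<Sum>j<q. entry a i 0 * Im (Z i j) * entry a j 0) > 0"
      by (rule siegel_pos[OF assms(1)])
    moreover have "(\<Sum>j<q. entry a i 0 * Im (Z i j) * entry a j 0) = 0" if "i < q" for i
    proof -
      have "(\<Sum>j<q. entry Y i j * entry a j 0) = entry (Y * a) i 0"
        by (subst entry_times[of q]) (use a in auto)
      then have "(\<Sum>j<q. Im (Z i j) * entry a j 0) = 0" using a(3) that by (simp add: Y_def)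
      then show ?thesis by (simp add: mult.assoc flip: sum_distrib_left)
    qed
    ultimately show False by simp
  qed
  then show "a = 0" using a(1,2) unfolding rws_def cls_def
    by (intro fmat_eqI) (metis One_nat_def Suc_leI entry_zero neq0_conv not_le)
qed

text \<open>A Cauchy-Schwarz estimate instead of compactness. Let \<open>y k\<close> be column
  \<open>k\<close> of the inverse of the imaginary part; pairing it with \<open>x\<close> gives
  \<open>x k\<close>. Minimising the form of \<open>x - t * y k\<close> over \<open>t\<close>, at
  \<open>t = x k / y k k\<close>, gives \<open>(x k)^2 / y k k\<close> as a lower bound.\<close>

lemma siegel_quad_lower:
  assumes Z: "Z \<in> siegel q"
  obtains c where "c > 0" "\<And>(x::nat \<Rightarrow> real) k. k < q \<Longrightarrow> c * (x k)\<^sup>2 \<le> (\<Sum>i<q. \<Sum>j<q. x i * Im (Z i j) * x j)"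
proof -
  define Q where "Q x = (\<Sum>i<q. \<Sum>j<q. x i * Im (Z i j) * x j)" for x :: "nat \<Rightarrow> real"
  define Y where "Y = mk q q (\<lambda>i j. Im (Z i j))"
  obtain B where B: "rws q B" "cls q B" "Y * B = idm q" using siegel_imag_inverse[OF Z] unfolding Y_def by blast
  have sym: "Z i j = Z j i" if "i < q" "j < q" for i j using Z that by (auto simp: siegel_def)
  have Qpos: "Q x > 0" if "\<exists>i<q. x i \<noteq> 0" for x unfolding Q_def by (rule siegel_pos[OF Z that])
  have Qnn: "Q x \<ge> 0" for x
  proof (cases "\<exists>i<q. x i \<noteq> 0")
    case False
    then have "Q x = 0" unfolding Q_def by (intro sum.neutral ballI) auto
    then show ?thesis by simp
  qed (use Qpos less_imp_le in blast)
  define y where "y k i = entry B i k" for k i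
  have Yy: "(\<Sum>j<q. Im (Z i j) * y k j) = (if i = k then 1 else 0)" if "i < q" "k < q" for i k
  proof -
    have "(\<Sum>j<q. entry Y i j * entry B j k) = entry (Y * B) i k"
      by (subst entry_times[of q]) (use B in auto)
    then show ?thesis using that B(3) by (simp add: Y_def y_def)
  qed
  have cross: "(\<Sum>i<q. \<Sum>j<q. x i * Im (Z i j) * y k j) = x k" if "k < q" for x k
  proof -
    have "(\<Sum>i<q. \<Sum>j<q. x i * Im (Z i j) * y k j) = (\<Sum>i<q. x i * (if i = k then 1 else 0))"
      by (intro sum.cong refl) (use Yy that in \<open>simp add: mult.assoc flip: sum_distrib_left\<close>)
    also have "\<dots> = (\<Sum>i<q. if i = k then x i else 0)" by (rule sum.cong) auto
    finally show ?thesis using that by simp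
  qed
  have cross': "(\<Sum>i<q. \<Sum>j<q. y k i * Im (Z i j) * x j) = x k" if "k < q" for x k
  proof -
    have "(\<Sum>i<q. \<Sum>j<q. y k i * Im (Z i j) * x j) = (\<Sum>j<q. \<Sum>i<q. y k i * Im (Z i j) * x j)" by (rule sum.swap)
    also have "\<dots> = (\<Sum>i<q. \<Sum>j<q. x i * Im (Z i j) * y k j)"
      by (intro sum.cong refl) (use sym in auto)
    finally show ?thesis using cross[OF that] by simp
  qed
  have expand: "Q (\<lambda>i. x i - t * y k i) = Q x - 2 * t * x k + t\<^sup>2 * y k k" if "k < q" for x t k
  proof -
    have "Q (\<lambda>i. x i - t * y k i) = (\<Sum>i<q. \<Sum>j<q. x i * Im (Z i j) * x j - t * (x i * Im (Z i j) * y k j)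
      - t * (y k i * Im (Z i j) * x j) + t\<^sup>2 * (y k i * Im (Z i j) * y k j))"
      unfolding Q_def by (intro sum.cong refl) (simp add: algebra_simps power2_eq_square)
    also have "\<dots> = Q x - t * (\<Sum>i<q. \<Sum>j<q. x i * Im (Z i j) * y k j)
      - t * (\<Sum>i<q. \<Sum>j<q. y k i * Im (Z i j) * x j) + t\<^sup>2 * (\<Sum>i<q. \<Sum>j<q. y k i * Im (Z i j) * y k j)"
      unfolding Q_def by (simp add: sum.distrib sum_subtractf sum_distrib_left)
    finally show ?thesis unfolding cross[OF that] cross'[OF that] by simp
  qed
  have ypos: "y k k > 0" if "k < q" for k
  proof -
    have "Q (y k) = y k k" unfolding Q_def using cross[OF that, of "y k"] by simp
    moreover have "\<exists>i<q. y k i \<noteq> 0"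
    proof (rule ccontr)
      assume "\<not> ?thesis"
      then have "(\<Sum>j<q. Im (Z k j) * y k j) = 0" by (intro sum.neutral) auto
      then show False using Yy[OF that that] by simp
    qed
    ultimately show ?thesis using Qpos by metis
  qed
  have key: "(x k)\<^sup>2 / y k k \<le> Q x" if "k < q" for x k
  proof -
    have "0 \<le> Q (\<lambda>i. x i - (x k / y k k) * y k i)" by (rule Qnn)
    also have "\<dots> = Q x - (x k)\<^sup>2 / y k k"
      unfolding expand[OF that] using ypos[OF that] by (simp add: field_simps power2_eq_square)
    finally show ?thesis by simp
  qed
  \<comment> \<open>One bound for all the \<open>y k k\<close>; the summand 1 keeps it positive for
    \<open>q = 0\<close>.\<close>
  define s where "s = 1 + (\<Sum>k<q. y k k)"
  have s: "s > 0" unfolding s_def by (intro add_pos_nonneg sum_nonneg less_imp_le[OF ypos]) auto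
  have "1 / s * (x k)\<^sup>2 \<le> Q x" if "k < q" for x k
  proof -
    have "y k k \<le> (\<Sum>k<q. y k k)"
      using that ypos by (intro member_le_sum) (auto intro: less_imp_le)
    then have "y k k \<le> s" by (simp add: s_def)
    then have "(x k)\<^sup>2 / s \<le> (x k)\<^sup>2 / y k k" using ypos[OF that] by (intro divide_left_mono) auto
    then show ?thesis using key[OF that, of x] by simp
  qed
  then show ?thesis using s by (intro that[of "1/s"]) (auto simp: Q_def)
qed

lemma herm_siegel_lower:
  assumes Z: "Z \<in> siegel q"
  obtains c where "c > 0" "\<And>(a::complex fmat) k. rws q a \<Longrightarrow> cls 1 a \<Longrightarrow> c * (cmod (entry a k 0))\<^sup>2 \<le> herm q (stk q (zm q Z) * a)"
proof -
  obtain c where c: "c > 0" "\<And>(x::nat \<Rightarrow> real) k. k < q \<Longrightarrow> c * (x k)\<^sup>2 \<le> (\<Sum>i<q. \<Sum>j<q. x i * Im (Z i j) * x j)"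
    using siegel_quad_lower[OF Z] by blast
  have nn: "(\<Sum>i<q. \<Sum>j<q. x i * Im (Z i j) * x j) \<ge> 0" for x :: "nat \<Rightarrow> real"
  proof (cases "q = 0")
    case False
    then have "c * (x 0)\<^sup>2 \<le> (\<Sum>i<q. \<Sum>j<q. x i * Im (Z i j) * x j)" using c(2)[of 0 x] by simp
    moreover have "c * (x 0)\<^sup>2 \<ge> 0" using c(1) by simp
    ultimately show ?thesis by linarith
  qed simp
  show ?thesis
  proof (rule that[OF c(1)])
    fix a :: "complex fmat" and k assume a: "rws q a" "cls 1 a"
    show "c * (cmod (entry a k 0))\<^sup>2 \<le> herm q (stk q (zm q Z) * a)"
    proof (cases "k < q")
      case True
      have "c * (cmod (entry a k 0))\<^sup>2 = c * (Re (entry a k 0))\<^sup>2 + c * (Im (entry a k 0))\<^sup>2"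
        by (simp add: cmod_power2 distrib_left)
      also have "\<dots> \<le> herm q (stk q (zm q Z) * a)"
        unfolding herm_siegel[OF Z a]
        by (intro add_mono c(2)[OF True, of "\<lambda>i. Re (entry a i 0)"] c(2)[OF True, of "\<lambda>i. Im (entry a i 0)"])
      finally show ?thesis .
    next
      case False
      then have "entry a k 0 = 0" using a by (simp add: rws_def)
      then show ?thesis unfolding herm_siegel[OF Z a] by (simp add: nn add_nonneg_nonneg)
    qed
  qed
qed

text \<open>The lower block \<open>M2\<close> is invertible: if \<open>M2 * a = 0\<close>, then
  \<open>M * a\<close> lies in the Lagrangian of the first \<open>n\<close> coordinates, where the
  form vanishes. The quotient of the two blocks is symmetric because \<open>M\<close> is isotropic,
  and its imaginary part inherits positivity.\<close>

lemma positive_lagrangian: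
  assumes M: "rws (2*n) M" "cls n M" "tr M * Jc n * M = 0"
    and pos: "\<And>a. rws n a \<Longrightarrow> cls 1 a \<Longrightarrow> a \<noteq> 0 \<Longrightarrow> herm n (M * a) > 0"
  obtains Z C where "Z \<in> siegel n" "rws n C" "cls n C" "M = stk n (zm n Z) * (tr (bt n) * M)"
    "tr (bt n) * M * C = idm n" "C * (tr (bt n) * M) = idm n"
proof -
  define M1 where "M1 = tr (tp n) * M"
  define M2 where "M2 = tr (bt n) * M"
  have d [simp]: "rws n M1" "cls n M1" "rws n M2" "cls n M2" using M by (simp_all add: M1_def M2_def)
  have split: "M = tp n * M1 + bt n * M2" unfolding M1_def M2_def by (rule tpbt_split[OF M(1)])
  have sym: "tr M1 * M2 = tr M2 * M1"
  proof -
    have "tr M * Jc n * M = tr M1 * M2 - tr M2 * M1"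
      by (subst (1 2) split) (simp add: mdistribs tpbt tpbt[THEN mult_assoc_eq])
    then show ?thesis using M(3) by simp
  qed
  obtain C where C: "rws n C" "cls n C" "M2 * C = idm n" "C * M2 = idm n"
  proof (rule inverse_ex[of n M2])
    fix a assume a: "rws n a" "cls 1 a" "M2 * a = 0"
    have "M * a = tp n * (M1 * a)" by (subst split) (simp add: distrib_right mult.assoc a)
    then have "herm n (M * a) = 0" by (simp add: herm_def mult.assoc tpbt[THEN mult_assoc_eq])
    then show "a = 0" using pos[of a] a by force
  qed auto
  define Zm where "Zm = M1 * C"
  have Zd [simp]: "rws n Zm" "cls n Zm" using C by (simp_all add: Zm_def)
  define Z where "Z = entry Zm"
  have Zm: "zm n Z = Zm" unfolding Z_def using Zd by (intro fmat_eqI) (auto simp: rws_def cls_def)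
  have Zsym: "tr Zm = Zm"
  proof -
    have "tr C * tr M2 = idm n" using arg_cong[OF C(3), of tr] by simp
    then have "Zm = tr C * (tr M2 * M1) * C" by (simp add: Zm_def mult.assoc[symmetric])
    also have "\<dots> = tr C * tr M1 * (M2 * C)" by (simp add: sym[symmetric] mult.assoc)
    also have "\<dots> = tr Zm" using C(3) by (simp add: Zm_def)
    finally show ?thesis by simp
  qed
  have MS: "M = stk n Zm * M2"
    by (subst split) (simp add: stk_def Zm_def distrib_right mult.assoc C)
  have "Z \<in> siegel n" unfolding siegel_def
  proof (intro CollectI conjI allI impI)
    show "zero_outside n n Z" using Zd by (auto simp: zero_outside_def Z_def rws_def cls_def)
    show "Z i j = Z j i" for i j
      using arg_cong[OF Zsym, of "\<lambda>A. entry A j i"] by (simp add: Z_def)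
    fix x :: "nat \<Rightarrow> real" assume x: "\<exists>i<n. x i \<noteq> 0"
    define a where "a = mk n 1 (\<lambda>i j. complex_of_real (x i))"
    have a: "rws n a" "cls 1 a" by (simp_all add: a_def)
    from x obtain i where "i < n" "x i \<noteq> 0" by blast
    then have "entry a i 0 \<noteq> 0" by (simp add: a_def)
    then have "M2 * (C * a) \<noteq> 0" using C a by (auto simp: mult.assoc[symmetric])
    then have "C * a \<noteq> 0" by auto
    then have "herm n (M * (C * a)) > 0" using C a by (intro pos) auto
    also have "M * (C * a) = stk n Zm * a" by (subst MS) (simp add: mult.assoc C(3)[THEN mult_assoc_eq] a)
    also have "herm n (stk n Zm * a) = Im (\<Sum>i<n. \<Sum>j<n. cnj (entry a i 0) * entry Zm i j * entry a j 0)"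
      by (rule herm_stk) (use a in auto)
    also have "\<dots> = (\<Sum>i<n. \<Sum>j<n. x i * Im (Z i j) * x j)"
      unfolding Im_sum by (intro sum.cong refl) (simp add: a_def Z_def)
    finally show "(\<Sum>i<n. \<Sum>j<n. x i * Im (Z i j) * x j) > 0" .
  qed
  then show ?thesis using that[of Z C] C MS unfolding Zm M2_def by simp
qed

section \<open>Frames adapted to an involution\<close>

text \<open>The standard symplectic basis cut into three blocks: \<open>Sq\<close> embeds the
  symplectic space of dimension \<open>2*q\<close>, \<open>Eq\<close> spans the isotropic space of
  the standard component, and \<open>Fq\<close> is the dual block.\<close>

definition Sq :: "nat \<Rightarrow> nat \<Rightarrow> real fmat" where
  "Sq n q = sel (2*n) (2*q) (\<lambda>j. if j < q then j else n + j - q)"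
definition Eq :: "nat \<Rightarrow> nat \<Rightarrow> real fmat" where "Eq n q = sel (2*n) (n - q) (\<lambda>j. q + j)"
definition Fq :: "nat \<Rightarrow> nat \<Rightarrow> real fmat" where "Fq n q = sel (2*n) (n - q) (\<lambda>j. n + q + j)"

lemma std_dims [simp]: "rws (2*n) (Sq n q)" "cls (2*q) (Sq n q)" "rws (2*n) (Eq n q)" "cls (n - q) (Eq n q)"
  "rws (2*n) (Fq n q)" "cls (n - q) (Fq n q)"
  by (simp_all add: Sq_def Eq_def Fq_def)

lemma entry_mult_trsel:
  assumes "inj_on f {..<c}"
  shows "entry (sel r c f * tr (sel r c f)) i j = (if i = j \<and> i < r \<and> i \<in> f ` {..<c} then 1 else 0)"
proof -
  have s: "entry (sel r c f * tr (sel r c f)) i j = (\<Sum>k<c. entry (sel r c f) i k * entry (sel r c f) j k)"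
    by (subst entry_times[of c]) auto
  show ?thesis
  proof (cases "i = j \<and> i < r \<and> i \<in> f ` {..<c}")
    case True
    then obtain k0 where k0: "k0 < c" "i = f k0" by auto
    have "(\<Sum>k<c. entry (sel r c f) i k * entry (sel r c f) j k) = (\<Sum>k<c. if k = k0 then 1 else 0 :: 'a)"
      by (rule sum.cong) (use True k0 assms in \<open>auto simp: entry_sel inj_on_def\<close>)
    also have "\<dots> = 1" using k0 by simp
    finally show ?thesis by (simp only: s if_P[OF True])
  next
    case False
    then show ?thesis unfolding s by (auto intro!: sum.neutral simp: entry_sel)
  qed
qed

lemma std_relations:
  assumes "q \<le> n"
  shows "tr (Eq n q) * Jm n * Eq n q = 0" "tr (Eq n q) * Jm n * Fq n q = idm (n - q)"
    "tr (Fq n q) * Jm n * Fq n q = 0" "tr (Eq n q) * Jm n * Sq n q = 0"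
    "tr (Sq n q) * Jm n * Sq n q = Jm q" "tr (Eq n q) * Jm n = tr (Fq n q)"
proof -
  have f: "(if j < q then j else n + j - q) < 2*n" if "j < 2*q" for j
    using assms that by auto
  show "tr (Eq n q) * Jm n * Eq n q = 0" "tr (Eq n q) * Jm n * Fq n q = idm (n - q)"
    "tr (Fq n q) * Jm n * Fq n q = 0" "tr (Eq n q) * Jm n * Sq n q = 0"
    "tr (Sq n q) * Jm n * Sq n q = Jm q" "tr (Eq n q) * Jm n = tr (Fq n q)"
    using assms
    by (auto intro!: fmat_eqI simp: Eq_def Fq_def Sq_def mult.assoc entry_trsel_mult entry_mult_sel
        entry_trsel_mult[OF f] entry_mult_sel[OF f] entry_Jm Jmat_def entry_sel)
qed

lemma std_split:
  assumes "q \<le> n"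
  shows "Sq n q * tr (Sq n q) + Eq n q * tr (Eq n q) + Fq n q * tr (Fq n q) = idm (2*n)"
proof (rule fmat_eqI)
  fix i j
  let ?f = "\<lambda>j. if j < q then j else n + j - q"
  have inj: "inj_on ?f {..<2*q}" using assms by (auto simp: inj_on_def split: if_splits)
  have im: "i \<in> ?f ` {..<2*q} \<longleftrightarrow> i < q \<or> (n \<le> i \<and> i < n + q)" for i
  proof
    assume "i < q \<or> (n \<le> i \<and> i < n + q)"
    then show "i \<in> ?f ` {..<2*q}"
    proof
      assume "i < q"
      then show ?thesis by (intro image_eqI[of _ _ i]) auto
    next
      assume "n \<le> i \<and> i < n + q"
      then show ?thesis by (intro image_eqI[of _ _ "i - n + q"]) auto
    qed
  qed (use assms in \<open>auto split: if_splits\<close>)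
  have im2: "i \<in> (\<lambda>j. c + j) ` {..<d} \<longleftrightarrow> c \<le> i \<and> i < c + d" for i c d :: nat
    by (auto intro!: image_eqI[of _ _ "i - c"])
  show "entry (Sq n q * tr (Sq n q) + Eq n q * tr (Eq n q) + Fq n q * tr (Fq n q)) i j = entry (idm (2*n)) i j"
    unfolding entry_plus Sq_def Eq_def Fq_def
    by (subst entry_mult_trsel[OF inj], subst entry_mult_trsel, simp add: inj_on_def,
        subst entry_mult_trsel, simp add: inj_on_def, unfold im im2) (use assms in auto)
qed

definition symp_inv :: "nat \<Rightarrow> real fmat \<Rightarrow> real fmat" where
  "symp_inv n g = - (Jm n * tr g * Jm n)"

lemma symp_inv:
  assumes g: "rws (2*n) g" "cls (2*n) g" "tr g * Jm n * g = Jm n"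
  shows "rws (2*n) (symp_inv n g)" "cls (2*n) (symp_inv n g)" "symp_inv n g * g = idm (2*n)" "g * symp_inv n g = idm (2*n)"
    "tr (symp_inv n g) * Jm n * symp_inv n g = Jm n"
proof -
  show d: "rws (2*n) (symp_inv n g)" "cls (2*n) (symp_inv n g)" by (simp_all add: symp_inv_def)
  have "symp_inv n g * g = - (Jm n * (tr g * Jm n * g))" by (simp add: symp_inv_def mult.assoc)
  then show l: "symp_inv n g * g = idm (2*n)" using g by simp
  then show r: "g * symp_inv n g = idm (2*n)" using left_inverse_right g d by blast
  have "tr (symp_inv n g) * (tr g * Jm n * g) * symp_inv n g = (tr (g * symp_inv n g)) * Jm n * (g * symp_inv n g)"
    by (simp add: mult.assoc)
  then show "tr (symp_inv n g) * Jm n * symp_inv n g = Jm n" using g r by simp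
qed

lemma herm_embedding: "tr S * Jm n * S = Jm q \<Longrightarrow> herm n (cm S * v) = herm q v"
proof -
  assume "tr S * Jm n * S = Jm q"
  then have "cm (tr S * Jm n * S) = Jc q" by simp
  then have "tr (cm S) * (Jc n * (cm S * X)) = Jc q * X" for X by (simp add: mult.assoc[symmetric])
  then show ?thesis by (simp add: herm_def mult.assoc)
qed

text \<open>A point of the half space and its conjugate are complementary, as the difference of
  \<open>W\<close> and its conjugate is \<open>2 i\<close> times the invertible imaginary part. The
  lower block forces \<open>a + b = w2\<close>, and the upper block then determines
  \<open>a\<close>.\<close>

lemma siegel_span:
  assumes W: "W \<in> siegel q" and w: "rws (2*q) w" "cls 1 w"
  shows "\<exists>a b. rws q a \<and> cls 1 a \<and> rws q b \<and> cls 1 b \<and>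
    w = stk q (zm q W) * a + cj (stk q (zm q W)) * b"
proof -
  define Y where "Y = mk q q (\<lambda>i j. Im (W i j))"
  obtain B where B: "rws q B" "cls q B" "Y * B = idm q" using siegel_imag_inverse[OF W] unfolding Y_def by blast
  let ?W = "zm q W"
  have WY: "?W - cj ?W = scl (2 * \<i>) (cm Y)"
    by (rule fmat_eqI) (auto simp: Y_def complex_eq_iff)
  define w1 where "w1 = tr (tp q) * w"
  define w2 where "w2 = tr (bt q) * w"
  have wd: "rws q w1" "cls 1 w1" "rws q w2" "cls 1 w2" using w by (simp_all add: w1_def w2_def)
  define a where "a = scl (1 / (2 * \<i>)) (cm B * (w1 - cj ?W * w2))"
  have ad: "rws q a" "cls 1 a" using B wd by (simp_all add: a_def)
  have YB: "cm Y * cm B = idm q" using arg_cong[OF B(3), of cm] by simp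
  have "(?W - cj ?W) * a = w1 - cj ?W * w2"
    unfolding WY a_def using wd by (simp add: mult_assoc_eq[OF YB])
  then have "?W * a + cj ?W * (w2 - a) = w1" by (simp add: left_diff_distrib right_diff_distrib algebra_simps)
  then have "tp q * (?W * a) + tp q * (cj ?W * (w2 - a)) = tp q * w1" by (simp add: distrib_left[symmetric])
  moreover have "w = tp q * w1 + bt q * w2" unfolding w1_def w2_def by (rule tpbt_split[OF w(1)])
  moreover have "stk q ?W * a + cj (stk q ?W) * (w2 - a) = tp q * (?W * a) + tp q * (cj ?W * (w2 - a)) + bt q * w2"
    by (simp add: stk_def distrib_right mult.assoc right_diff_distrib)
  ultimately have "w = stk q ?W * a + cj (stk q ?W) * (w2 - a)" by simp
  then show ?thesis using ad wd by (metis rws_simps(3) cls_simps(3))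
qed

lemma boundary_point_std:
  assumes g [simp]: "rws (2*n) g" "cls (2*n) g" and gJ: "tr g * Jm n * g = Jm n" and q: "q \<le> n"
    and W: "W \<in> siegel q" and fr: "frame n (n - q) E F"
    and T: "g * Eq n q = E * T" and T': "E = g * Eq n q * T'"
  shows "\<exists>c. boundary_point n (n - q) E F q (cm g * cm (Sq n q) * stk q (zm q W)) c"
proof -
  interpret frame n "n - q" E F by fact
  let ?S = "Sq n q" and ?s = "stk q (zm q W)"
  let ?U = "cm g * cm ?S * ?s"
  note std = std_relations[OF q]
  note gi = symp_inv[OF g gJ]
  obtain c where c: "c > 0" "\<And>(a::complex fmat) k. rws q a \<Longrightarrow> cls 1 a \<Longrightarrow> c * (cmod (entry a k 0))\<^sup>2 \<le> herm q (?s * a)"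
    using herm_siegel_lower[OF W] by blast
  have "boundary_point n (n - q) E F q ?U c"
  proof
    show "rws (2*n) ?U" "cls q ?U" by (simp_all)
    have SJS: "tr (cm ?S) * (Jc n * (cm ?S * X)) = Jc q * X" for X
      using arg_cong[OF std(5), of cm] by (simp add: mult.assoc[symmetric])
    have gJc: "tr (cm g) * (Jc n * (cm g * X)) = Jc n * X" for X
      using arg_cong[OF gJ, of cm] by (simp add: mult.assoc[symmetric])
    have "tr ?U * Jc n * ?U = tr ?s * Jc q * ?s" by (simp add: mult.assoc gJc SJS)
    then show "tr ?U * Jc n * ?U = 0" using stk_isotropic[of q "zm q W"] siegel_zm[OF W] by simp
    have "K * (g * ?S) = tr T' * (tr (Eq n q) * ((tr g * Jm n * g) * ?S))"
      unfolding K_def by (subst T') (simp add: mult.assoc)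
    also have "\<dots> = 0" unfolding gJ using std(4) by (simp add: mult.assoc)
    finally have "cm (K * (g * ?S)) = 0" by simp
    then have "cm (K * (g * ?S)) * ?s = 0" by simp
    then show "cm K * ?U = 0" by (simp add: mult.assoc)
    show "c > 0" by fact
    show "c * (cmod (entry a k 0))\<^sup>2 \<le> herm n (?U * a)" if "rws q a" "cls 1 a" for a k
    proof -
      have "herm n (?U * a) = herm n (cm g * (cm ?S * (?s * a)))" by (simp add: mult.assoc)
      then show ?thesis using c(2)[OF that] by (simp only: herm_symplectic[OF gJ] herm_embedding[OF std(5)])
    qed
    fix v assume v: "rws (2*n) v" "cls 1 v" "cm K * v = 0"
    define v' where "v' = cm (symp_inv n g) * v"
    have v'd: "rws (2*n) v'" "cls 1 v'" using v gi by (simp_all add: v'_def)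
    have gv': "cm g * v' = v" using arg_cong[OF gi(4), of cm] v by (simp add: v'_def mult.assoc[symmetric])
    \<comment> \<open>The lower coordinates of \<open>v'\<close> dual to \<open>Eq n q\<close> are
      \<open>tr T\<close> times \<open>K * v\<close>, hence vanish on L^perp.\<close>
    have "tr (Fq n q) * symp_inv n g = tr (Eq n q) * (tr g * Jm n * g) * symp_inv n g" using std(6) gJ by simp
    also have "\<dots> = tr (g * Eq n q) * Jm n * (g * symp_inv n g)" by (simp add: mult.assoc)
    also have "\<dots> = tr T * K" unfolding T gi(4) by (simp add: K_def mult.assoc)
    finally have "cm (tr (Fq n q) * symp_inv n g) = cm (tr T * K)" by simp
    then have F0: "tr (cm (Fq n q)) * v' = 0" using v(3)
      by (simp add: v'_def mult.assoc[symmetric]) (simp add: mult.assoc)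
    have sp: "v' = cm ?S * (tr (cm ?S) * v') + cm (Eq n q) * (tr (cm (Eq n q)) * v')"
    proof -
      have "v' = cm (?S * tr ?S + Eq n q * tr (Eq n q) + Fq n q * tr (Fq n q)) * v'"
        unfolding std_split[OF q] using v'd by simp
      also have "\<dots> = cm ?S * (tr (cm ?S) * v') + cm (Eq n q) * (tr (cm (Eq n q)) * v') + cm (Fq n q) * (tr (cm (Fq n q)) * v')"
        by (simp add: distrib_right mult.assoc)
      finally show ?thesis unfolding F0 by simp
    qed
    obtain a b where ab: "rws q a" "cls 1 a" "rws q b" "cls 1 b" "tr (cm ?S) * v' = ?s * a + cj ?s * b"
      using siegel_span[OF W, of "tr (cm ?S) * v'"] v'd by auto
    have "v = cm g * (cm ?S * (tr (cm ?S) * v') + cm (Eq n q) * (tr (cm (Eq n q)) * v'))"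
      using arg_cong[OF sp, of "(*) (cm g)"] gv' by simp
    also have "\<dots> = cm g * (cm ?S * (tr (cm ?S) * v')) + cm (g * Eq n q) * (tr (cm (Eq n q)) * v')"
      by (simp add: distrib_left mult.assoc)
    also have "\<dots> = ?U * a + cj ?U * b + cm E * (cm T * (tr (cm (Eq n q)) * v'))"
      unfolding ab(5) T by (simp add: distrib_left mult.assoc)
    finally show "\<exists>a b c. rws q a \<and> cls 1 a \<and> rws q b \<and> cls 1 b \<and> v = ?U * a + cj ?U * b + cm E * c"
      using ab by blast
  qed
  then show ?thesis by blast
qed

text \<open>A stable complement by averaging, then a correction to isotropy. The sign and transpose
  in \<open>- (F2 * tr b)\<close> are forced by anti-symplecticity, as the complement is dual to
  L.\<close>

lemma (in frame) involution_frame: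
  assumes t [simp]: "rws (2*n) t" "cls (2*n) t" and anti: "tr t * Jm n * t = - Jm n"
    and tt: "t * t = idm (2*n)" and tE: "t * E = E * b" and b [simp]: "rws m b" "cls m b" and bb: "b * b = idm m"
  obtains F2 where "frame n m E F2" "t * F2 = - (F2 * tr b)"
proof -
  have tbb: "tr b * tr b = idm m" using arg_cong[OF bb, of tr] by simp
  have Jt: "tr t * Jm n = - (Jm n * t)"
  proof -
    have "tr t * Jm n = tr t * Jm n * (t * t)" by (simp add: tt)
    also have "\<dots> = (tr t * Jm n * t) * t" by (simp only: mult.assoc)
    finally show ?thesis by (simp add: anti)
  qed
  have EJt: "tr E * Jm n * t = - (tr b * K)"
  proof -
    have "tr E * Jm n * t = - (tr (t * E) * Jm n)" by (simp add: mult.assoc Jt)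
    then show ?thesis unfolding tE by (simp add: K_def mult.assoc)
  qed
  \<comment> \<open>\<open>X\<close> to \<open>- t * X * tr b\<close> is an involution that
    preserves the pairing with \<open>E\<close>; \<open>F1\<close> is the average of
    \<open>F\<close> over it.\<close>
  define F1 where "F1 = scl (1/2) (F - t * F * tr b)"
  have F1d [simp]: "rws (2*n) F1" "cls m F1" by (simp_all add: F1_def)
  have EF1: "tr E * Jm n * F1 = idm m"
  proof -
    have "tr E * Jm n * (F - t * F * tr b) = idm m - (tr E * Jm n * t) * F * tr b"
      by (simp only: right_diff_distrib EJF mult.assoc[symmetric])
    also have "\<dots> = idm m + tr b * (K * F) * tr b" unfolding EJt by (simp add: mult.assoc)
    also have "\<dots> = scl 2 (idm m)" by (simp add: KF tbb) (auto intro!: fmat_eqI)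
    finally show ?thesis by (simp add: F1_def)
  qed
  have tF1: "t * F1 = - (F1 * tr b)"
  proof -
    have "t * (F - t * F * tr b) = t * F - F * tr b"
      by (simp add: right_diff_distrib mult_assoc_eq[OF tt] mult.assoc)
    also have "\<dots> = - ((F - t * F * tr b) * tr b)"
      by (simp add: left_diff_distrib mult.assoc tbb)
    finally show ?thesis by (simp add: F1_def scl_distribs(3))
  qed
  define Om where "Om = tr F1 * Jm n * F1"
  have Omd [simp]: "rws m Om" "cls m Om" by (simp_all add: Om_def)
  have Omt: "tr Om = - Om" by (simp add: Om_def mult.assoc)
  have bOm: "b * Om = - (Om * tr b)"
  proof -
    have "b * Om = tr (F1 * tr b) * Jm n * F1" by (simp add: Om_def mult.assoc)
    also have "F1 * tr b = - (t * F1)" by (simp add: tF1)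
    also have "tr (- (t * F1)) * Jm n * F1 = - (tr F1 * (tr t * Jm n) * F1)" by (simp add: mult.assoc)
    also have "\<dots> = tr F1 * Jm n * (t * F1)" unfolding Jt by (simp add: mult.assoc)
    finally show ?thesis unfolding tF1 by (simp add: Om_def mult.assoc)
  qed
  \<comment> \<open>Half the Gram matrix \<open>Om\<close> restores isotropy. Unlike a triangular
    part, \<open>Om / 2\<close> inherits the relation \<open>bOm\<close>, so stability under
    \<open>t\<close> is kept.\<close>
  define F2 where "F2 = F1 + scl (1/2) (E * Om)"
  have F2d [simp]: "rws (2*n) F2" "cls m F2" by (simp_all add: F2_def)
  have F1E: "tr F1 * Jm n * E = - idm m"
  proof -
    have "- (tr F1 * Jm n * E) = idm m" using arg_cong[OF EF1, of tr] by (simp add: mult.assoc)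
    then show ?thesis by (metis minus_minus)
  qed
  have "tr E * Jm n * F2 = tr E * Jm n * F1 + scl (1/2) ((tr E * Jm n * E) * Om)"
    by (simp add: F2_def distrib_left mult.assoc)
  then have EF2: "tr E * Jm n * F2 = idm m" by (simp add: EF1 EJE)
  have "tr F2 * Jm n * F2 = Om + scl (1/2) ((tr F1 * Jm n * E) * Om) + scl (1/2) (tr Om * (tr E * Jm n * F1))
     + scl (1/4) (tr Om * (tr E * Jm n * E) * Om)"
    by (simp add: F2_def Om_def mdistribs add.assoc scl_distribs)
  also have "\<dots> = 0" unfolding F1E EF1 EJE Omt by (simp add: scl_distribs) (auto intro!: fmat_eqI)
  finally have FF2: "tr F2 * Jm n * F2 = 0" .
  have "t * F2 = - (F2 * tr b)"
    by (simp add: F2_def distrib_left distrib_right tF1 mult_assoc_eq[OF tE] mult.assoc bOm scl_distribs)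
  moreover have "frame n m E F2" by unfold_locales (simp_all add: EJE EF2 FF2)
  ultimately show ?thesis using that by blast
qed

text \<open>The graph of \<open>i \<tau> Y\<close> for \<open>Y = 1 + b b^T\<close>, which satisfies \<open>b Y b^T = Y\<close> when \<open>b^2 = 1\<close>.\<close>

definition (in frame) Vt :: "real fmat \<Rightarrow> real \<Rightarrow> complex fmat" where
  "Vt b \<tau> = cm F + scl (\<i> * of_real \<tau>) (cm E * cm (idm m + b * tr b))"

section \<open>Interior Lagrangians near a boundary point\<close>

context boundary_point
begin

text \<open>The same point modulo L, with its representatives moved into the kernels of both
  \<open>K\<close> and \<open>G\<close>, that is, orthogonal to the whole frame.\<close>

definition "U2 = U - cm E * cm G * U"

lemma U2_dims [simp]: "rws (2*n) U2" "cls q U2"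
  by (simp_all add: U2_def)

lemma Vt_dims [simp]: "rws m b \<Longrightarrow> cls m b \<Longrightarrow> rws (2*n) (Vt b \<tau>)" "rws m b \<Longrightarrow> cls m b \<Longrightarrow> cls m (Vt b \<tau>)"
  by (simp_all add: Vt_def)

lemma frame_c: "cm K * cm E = 0" "cm K * cm F = idm m" "cm G * cm E = idm m" "cm G * cm F = 0"
  "tr (cm E) * Jc n = cm K" "tr (cm F) * Jc n = - cm G" "Jc n * cm E = - tr (cm K)" "Jc n * cm F = tr (cm G)"
  using arg_cong[OF KE, of cm] arg_cong[OF KF, of cm] arg_cong[OF GE, of cm] arg_cong[OF GF, of cm]
    arg_cong[OF JE, of cm] arg_cong[OF JF, of cm]
  by (simp_all add: K_def G_def)

lemma GU2: "cm G * U2 = 0" and KU2: "cm K * U2 = 0"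
  by (simp_all add: U2_def right_diff_distrib mult.assoc frame_c[THEN mult_assoc_eq] KU)

lemma U2_a: "U2 * a = U * a + cm E * (- (cm G * (U * a)))"
  by (simp add: U2_def left_diff_distrib mult.assoc)

lemma U2_JU2: "tr U2 * Jc n * U2 = 0"
proof -
  have "tr U2 * Jc n * U2 = tr U2 * Jc n * U - tr U2 * (Jc n * cm E) * cm G * U"
    unfolding U2_def by (simp add: right_diff_distrib mult.assoc)
  also have "tr U2 * (Jc n * cm E) = - tr (cm K * U2)" by (simp add: frame_c)
  also have "tr U2 * Jc n * U = tr U * Jc n * U - tr (cm G * U) * (tr (cm E) * Jc n) * U"
    unfolding U2_def by (simp add: left_diff_distrib mult.assoc)
  also have "\<dots> = 0" by (simp add: UJU[unfolded mult.assoc] frame_c mult.assoc KU)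
  finally show ?thesis by (simp add: KU2)
qed

lemma Vt_form:
  assumes [simp]: "rws m b" "cls m b"
  shows "tr (Vt b \<tau>) * Jc n * Vt b \<tau> = 0" "tr U2 * Jc n * Vt b \<tau> = 0" "tr U2 * Jc n * cj (Vt b \<tau>) = 0"
    "tr (Vt b \<tau>) * Jc n * U2 = 0"
    "tr (Vt b \<tau>) * Jc n * cj (Vt b \<tau>) = scl (2 * \<i> * of_real \<tau>) (idm m + cm b * tr (cm b))"
proof -
  let ?Y = "idm m + cm b * tr (cm b)" and ?i = "\<i> * complex_of_real \<tau>"
  have V: "Vt b \<tau> = cm F + scl ?i (cm E * ?Y)" by (simp add: Vt_def)
  have cV: "cj (Vt b \<tau>) = cm F - scl ?i (cm E * ?Y)" unfolding V by (simp add: scl_distribs)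
  have Yd: "rws m ?Y" "cls m ?Y" "tr ?Y = ?Y" by simp_all
  have JV: "Jc n * Vt b \<tau> = tr (cm G) - scl ?i (tr (cm K) * ?Y)"
    unfolding V by (simp only: distrib_left scl_mult_right frame_c frame_c[THEN mult_assoc_eq]) (simp add: scl_distribs)
  have JcV: "Jc n * cj (Vt b \<tau>) = tr (cm G) + scl ?i (tr (cm K) * ?Y)"
    unfolding cV by (simp only: right_diff_distrib scl_mult_right frame_c frame_c[THEN mult_assoc_eq]) (simp add: scl_distribs)
  have tV: "tr (Vt b \<tau>) = tr (cm F) + scl ?i (?Y * tr (cm E))"
    unfolding V by simp
  have t: "tr (cm E) * tr (cm K) = 0" "tr (cm E) * tr (cm G) = idm m" "tr (cm F) * tr (cm K) = idm m" "tr (cm F) * tr (cm G) = 0"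
    "tr U2 * tr (cm K) = 0" "tr U2 * tr (cm G) = 0"
    using arg_cong[OF frame_c(1), of tr] arg_cong[OF frame_c(2), of tr] arg_cong[OF frame_c(3), of tr]
      arg_cong[OF frame_c(4), of tr] arg_cong[OF GU2, of tr] arg_cong[OF KU2, of tr] by simp_all
  show "tr (Vt b \<tau>) * Jc n * Vt b \<tau> = 0"
    unfolding mult.assoc JV tV using Yd
    by (simp only: distrib_right right_diff_distrib mult.assoc scl_mult_left scl_mult_right t t[THEN mult_assoc_eq]) simp
  show "tr (Vt b \<tau>) * Jc n * cj (Vt b \<tau>) = scl (2 * \<i> * of_real \<tau>) ?Y"
    unfolding mult.assoc JcV tV using Yd
    by (simp only: distrib_right distrib_left mult.assoc scl_mult_left scl_mult_right t t[THEN mult_assoc_eq])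
      (auto intro!: fmat_eqI)
  show "tr U2 * Jc n * Vt b \<tau> = 0"
    unfolding mult.assoc JV by (simp add: right_diff_distrib t t[THEN mult_assoc_eq])
  then have "tr (tr U2 * Jc n * Vt b \<tau>) = 0" by simp
  then show "tr (Vt b \<tau>) * Jc n * U2 = 0" by (simp add: mult.assoc)
  show "tr U2 * Jc n * cj (Vt b \<tau>) = 0"
    unfolding mult.assoc JcV by (simp add: distrib_left t t[THEN mult_assoc_eq])
qed

text \<open>The orthogonality of \<open>U2\<close> and \<open>Vt\<close> separates the two parts,
  and \<open>Y = 1 + b b^T\<close> makes the second a sum of squares. The first sum already bounds
  the form below by \<tau> times the squared length of \<open>c\<close>.\<close>

lemma herm_U2V:
  assumes [simp]: "rws m b" "cls m b" and c: "rws m c" "cls 1 c"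
  shows "herm n (U2 * a + Vt b \<tau> * c) = herm n (U * a) +
    \<tau> * ((\<Sum>i<m. (cmod (entry c i 0))\<^sup>2) + (\<Sum>i<m. (cmod (entry (tr (cm b) * c) i 0))\<^sup>2))"
proof -
  have "tr (U2 * a) * Jc n * cj (Vt b \<tau> * c) = tr a * (tr U2 * Jc n * cj (Vt b \<tau>)) * cj c"
    by (simp add: mult.assoc)
  then have "herm n (U2 * a + Vt b \<tau> * c) = herm n (U2 * a) + herm n (Vt b \<tau> * c)"
    by (intro herm_add_orth) (simp add: Vt_form)
  also have "herm n (U2 * a) = herm n (U * a)" unfolding U2_a by (rule herm_UE)
  also have "herm n (Vt b \<tau> * c) = \<tau> * ((\<Sum>i<m. (cmod (entry c i 0))\<^sup>2) + (\<Sum>i<m. (cmod (entry (tr (cm b) * c) i 0))\<^sup>2))"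
  proof -
    have "tr (Vt b \<tau> * c) * Jc n * cj (Vt b \<tau> * c) = tr c * (tr (Vt b \<tau>) * Jc n * cj (Vt b \<tau>)) * cj c"
      by (simp add: mult.assoc)
    also have "\<dots> = scl (2 * \<i> * of_real \<tau>) (tr c * cj c + tr (tr (cm b) * c) * cj (tr (cm b) * c))"
      unfolding Vt_form[OF assms(1,2)] using c by (simp add: distrib_left distrib_right mult.assoc)
    finally have e: "tr (Vt b \<tau> * c) * Jc n * cj (Vt b \<tau> * c) = \<dots>" .
    have sq: "entry (tr x * cj x) 0 0 = of_real (\<Sum>i<m. (cmod (entry x i 0))\<^sup>2)" if "rws m x" for x
      using that by (subst entry_times[of m]) (simp_all add: complex_norm_square del: of_real_power)
    show ?thesis unfolding herm_def e entry_scl entry_plus using c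
      by (subst sq, simp, subst sq, simp, simp flip: of_real_add)
  qed
  finally show ?thesis .
qed

text \<open>\<open>b * Y = b + tr b = Y * tr b\<close> since \<open>b^2 = 1\<close>, and the sign
  from conjugating \<open>i\<close> matches the sign in \<open>t * F\<close>.\<close>

lemma Vt_equivariant:
  assumes tE: "t * E = E * b" and tF: "t * F = - (F * tr b)" and b [simp]: "rws m b" "cls m b" and bb: "b * b = idm m"
  shows "cj (cm t * (Vt b \<tau> * c)) = Vt b \<tau> * (- (tr (cm b) * cj c))"
proof -
  have tEc: "cm t * cm E = cm E * cm b" using arg_cong[OF tE, of cm] by simp
  have tFc: "cm t * cm F = - (cm F * tr (cm b))" using arg_cong[OF tF, of cm] by simp
  have bbc: "cm b * cm b = idm m" using arg_cong[OF bb, of cm] by simp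
  have tbb: "tr (cm b) * tr (cm b) = idm m" using arg_cong[OF bbc, of tr] by simp
  have "cj (cm t * Vt b \<tau>) = - (Vt b \<tau> * tr (cm b))"
    unfolding Vt_def
    by (simp add: distrib_left distrib_right tFc tEc mult_assoc_eq[OF tEc] mult.assoc mult_assoc_eq[OF bbc] tbb scl_distribs)
  then have "cj (cm t * Vt b \<tau>) * cj c = - (Vt b \<tau> * tr (cm b)) * cj c" by simp
  then show ?thesis by (simp add: mult.assoc)
qed

end

section \<open>Translation to the Satake model\<close>

definition cv :: "complex fmat \<Rightarrow> nat \<Rightarrow> complex" where "cv A = (\<lambda>i. entry A i 0)"

lemma cv_apply: "cv A i = entry A i 0"
  by (simp add: cv_def)

lemma cv_inject: "cls 1 A \<Longrightarrow> cls 1 B \<Longrightarrow> cv A = cv B \<Longrightarrow> A = B"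
  unfolding cv_def cls_def by (intro fmat_eqI) (metis One_nat_def Suc_leI neq0_conv)

definition col_span :: "complex fmat \<Rightarrow> nat \<Rightarrow> complex fmat set" where
  "col_span M n = {M * a | a. rws n a \<and> cls 1 a}"

definition pair_span :: "complex fmat \<Rightarrow> nat \<Rightarrow> complex fmat \<Rightarrow> nat \<Rightarrow> complex fmat set" where
  "pair_span A q B m = {A * a + B * c | a c. rws q a \<and> cls 1 a \<and> rws m c \<and> cls 1 c}"

lemma col_spanI: "rws n a \<Longrightarrow> cls 1 a \<Longrightarrow> M * a \<in> col_span M n"
  and pair_spanI: "rws q a \<Longrightarrow> cls 1 a \<Longrightarrow> rws m c \<Longrightarrow> cls 1 c \<Longrightarrow> A * a + B * c \<in> pair_span A q B m"
  by (auto simp: col_span_def pair_span_def)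

lemma col_spanE: "v \<in> col_span M n \<Longrightarrow> (\<And>a. rws n a \<Longrightarrow> cls 1 a \<Longrightarrow> v = M * a \<Longrightarrow> P) \<Longrightarrow> P"
  by (auto simp: col_span_def)

lemma pair_spanE: "v \<in> pair_span A q B m \<Longrightarrow>
    (\<And>a c. rws q a \<Longrightarrow> cls 1 a \<Longrightarrow> rws m c \<Longrightarrow> cls 1 c \<Longrightarrow> v = A * a + B * c \<Longrightarrow> P) \<Longrightarrow> P"
  by (auto simp: pair_span_def)

text \<open>\<open>A * Pq n q + B * Pm n q\<close> places the \<open>q\<close> columns of
  \<open>A\<close> beside the \<open>n - q\<close> columns of \<open>B\<close>.\<close>

definition Pq :: "nat \<Rightarrow> nat \<Rightarrow> 'a::comm_ring_1 fmat" where "Pq n q = tr (sel n q (\<lambda>j. j))"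
definition Pm :: "nat \<Rightarrow> nat \<Rightarrow> 'a::comm_ring_1 fmat" where "Pm n q = tr (sel n (n - q) (\<lambda>j. q + j))"

lemma Pqm_dims [simp]: "rws q (Pq n q)" "cls n (Pq n q)" "rws (n - q) (Pm n q)" "cls n (Pm n q)"
  by (simp_all add: Pq_def Pm_def)

lemma Pqm:
  assumes "q \<le> n"
  shows "Pq n q * tr (Pq n q) = idm q" "Pm n q * tr (Pm n q) = idm (n - q)" "Pq n q * tr (Pm n q) = 0" "Pm n q * tr (Pq n q) = 0"
  using assms by (auto intro!: fmat_eqI simp: Pq_def Pm_def entry_trsel_mult entry_sel)

lemma pair_span_col_span:
  assumes "q \<le> n"
  shows "pair_span A q B (n - q) = col_span (A * Pq n q + B * Pm n q) n"
proof
  show "pair_span A q B (n - q) \<subseteq> col_span (A * Pq n q + B * Pm n q) n"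
  proof
    fix v assume "v \<in> pair_span A q B (n - q)"
    then obtain a c where ac: "rws q a" "cls 1 a" "rws (n - q) c" "cls 1 c" "v = A * a + B * c" by (rule pair_spanE)
    let ?x = "tr (Pq n q) * a + tr (Pm n q) * c"
    have "v = (A * Pq n q + B * Pm n q) * ?x"
      using ac assms by (simp add: mdistribs Pqm Pqm[THEN mult_assoc_eq])
    moreover have "rws n ?x" "cls 1 ?x" using ac by simp_all
    ultimately show "v \<in> col_span (A * Pq n q + B * Pm n q) n" unfolding col_span_def by blast
  qed
  show "col_span (A * Pq n q + B * Pm n q) n \<subseteq> pair_span A q B (n - q)"
  proof
    fix v assume "v \<in> col_span (A * Pq n q + B * Pm n q) n"
    then obtain a where a: "rws n a" "cls 1 a" "v = (A * Pq n q + B * Pm n q) * a" by (rule col_spanE)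
    then have "v = A * (Pq n q * a) + B * (Pm n q * a)" by (simp add: distrib_right mult.assoc)
    then show "v \<in> pair_span A q B (n - q)" using a by (auto intro!: pair_spanI)
  qed
qed

lemma Pqm_zero: assumes "q \<le> n" "rws n a" "Pq n q * a = 0" "Pm n q * a = 0" shows "a = 0"
proof (rule fmat_eqI)
  fix i j
  show "entry a i j = entry 0 i j"
  proof (cases "i < n")
    case True
    show ?thesis
    proof (cases "i < q")
      case True
      have "entry (Pq n q * a) i j = entry a i j" using True assms(1) by (simp add: Pq_def entry_trsel_mult)
      then show ?thesis using assms(3) by simp
    next
      case False
      have "entry (Pm n q * a) (i - q) j = entry a i j" using \<open>i < n\<close> False assms(1) by (simp add: Pm_def entry_trsel_mult)
      then show ?thesis using assms(4) by simp
    qed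
  next
    case False
    then show ?thesis using assms(2) by (simp add: rws_def)
  qed
qed

lemma colspace_cv: "colspace n M = cv ` col_span (mk (2*n) n M) n"
proof -
  have e: "cv (mk (2*n) n M * mk n 1 (\<lambda>i j. a i)) = (\<lambda>i. if i < 2*n then (\<Sum>j<n. M i j * a j) else 0)" for a
    by (rule ext) (simp add: cv_apply entry_times[of n])
  show ?thesis
  proof
    show "colspace n M \<subseteq> cv ` col_span (mk (2*n) n M) n"
      unfolding colspace_def e[symmetric] col_span_def by force
    show "cv ` col_span (mk (2*n) n M) n \<subseteq> colspace n M"
    proof
      fix v assume "v \<in> cv ` col_span (mk (2*n) n M) n"
      then obtain a where a: "rws n a" "cls 1 a" "v = cv (mk (2*n) n M * a)" by (auto simp: col_span_def)
      have "a = mk n 1 (\<lambda>i j. entry a i 0)"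
        using a(1,2) by (intro fmat_eqI) (auto simp: rws_def cls_def)
      then have "v = (\<lambda>i. if i < 2*n then (\<Sum>j<n. M i j * entry a j 0) else 0)" using a(3) e by metis
      then show "v \<in> colspace n M" unfolding colspace_def by (auto intro: exI[of _ "\<lambda>j. entry a j 0"])
    qed
  qed
qed

lemma actv_cv: "rws (2*n) v \<Longrightarrow> actv n g (cv v) = cv (cm (mk (2*n) (2*n) g) * v)"
  by (rule ext) (simp add: actv_def cv_apply entry_times[of "2*n"])

lemma act_cv: "(\<And>v. v \<in> S \<Longrightarrow> rws (2*n) v) \<Longrightarrow> act n g (cv ` S) = cv ` ((\<lambda>v. cm (mk (2*n) (2*n) g) * v) ` S)"
  unfolding act_def image_image by (rule image_cong) (auto simp: actv_cv)

section \<open>The map tau, the Hermitian form and the points of the model in matrix terms\<close>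

definition eps :: "nat \<Rightarrow> real fmat" where
  "eps n = mk (2*n) (2*n) (\<lambda>i j. if i = j then (if i < n then -1 else 1) else 0)"

lemma eps_dims [simp]: "rws (2*n) (eps n)" "cls (2*n) (eps n)" "tr (eps n) = eps n"
  by (simp_all add: eps_def) (auto intro!: fmat_eqI)

lemma entry_eps: "entry (eps n) i j = (if i = j \<and> i < 2*n then (if i < n then -1 else 1) else 0)"
  by (auto simp: eps_def)

lemma entry_eps_mult: "entry (eps n * A) i j = (if i < n then - entry A i j else if i < 2*n then entry A i j else 0)"
proof -
  have "entry (eps n * A) i j = (\<Sum>k<2*n. entry (eps n) i k * entry A k j)" by (rule entry_times) simp
  also have "\<dots> = (\<Sum>k<2*n. if k = i then (if i < n then - entry A i j else entry A i j) else 0)"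
    by (rule sum.cong) (auto simp: eps_def)
  finally show ?thesis by auto
qed

lemma entry_cm_eps_mult: "entry (cm (eps n) * A) i j = (if i < n then - entry A i j else if i < 2*n then entry A i j else 0)"
proof -
  have "entry (cm (eps n) * A) i j = (\<Sum>k<2*n. entry (cm (eps n)) i k * entry A k j)" by (rule entry_times) simp
  also have "\<dots> = (\<Sum>k<2*n. if k = i then (if i < n then - entry A i j else entry A i j) else 0)"
    by (rule sum.cong) (auto simp: eps_def)
  finally show ?thesis by auto
qed

lemma eps_eps: "eps n * eps n = idm (2*n)"
  by (rule fmat_eqI) (auto simp: entry_eps_mult entry_eps)

lemma eps_eps_mult: "rws (2*n) A \<Longrightarrow> eps n * (eps n * A) = A" 
  by (simp add: mult.assoc[symmetric] eps_eps)

lemma cm_eps_eps_mult: "rws (2*n) A \<Longrightarrow> cm (eps n) * (cm (eps n) * A) = A"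
  using arg_cong[OF eps_eps, of cm] by (simp add: mult.assoc[symmetric])

lemma eps_J_eps: "eps n * Jm n * eps n = - Jm n"
proof -
  have "eps n * Jm n = - (Jm n * eps n)"
    by (rule fmat_eqI) (auto simp: entry_eps_mult entry_Jm_mult entry_Jm Jmat_def entry_eps)
  then show ?thesis by (simp add: mult.assoc eps_eps)
qed

lemma eps_int: "dvm 1 (eps n)" "dvm 2 (eps n - idm (2*n))"
  by (auto simp: dvm_def eps_def intro: exI[of _ 0] exI[of _ 1] exI[of _ "-1"])

lemma tauP_cv: assumes "\<And>v. v \<in> S \<Longrightarrow> rws (2*n) v"
  shows "tauP n (cv ` S) = cv ` ((\<lambda>v. cm (eps n) * cj v) ` S)"
  unfolding tauP_def image_image
  by (rule image_cong) (auto simp: cv_apply entry_cm_eps_mult)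

lemma Hf_cv: assumes v: "rws (2*n) v" shows "Hf n (cv v) = herm n v"
proof -
  define s where "s = (\<Sum>i<n. entry v i 0 * cnj (entry v (n + i) 0))"
  have "tr v * Jc n * cj v = tr v * (Jc n * cj v)" by (simp add: mult.assoc)
  then have "entry (tr v * Jc n * cj v) 0 0 = (\<Sum>k<2*n. entry v k 0 * entry (Jc n * cj v) k 0)"
    using v by (simp add: entry_times[of "2*n" "tr v"])
  also have "\<dots> = (\<Sum>k<n + n. entry v k 0 * entry (Jc n * cj v) k 0)" by (simp add: mult_2)
  also have "\<dots> = (\<Sum>k<n. entry v k 0 * entry (Jc n * cj v) k 0) + (\<Sum>k<n. entry v (n + k) 0 * entry (Jc n * cj v) (n + k) 0)"
    by (simp add: lessThan_atLeast0 sum.nat_group[symmetric] sum.atLeastLessThan_concat[of 0 n "n + n", symmetric]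
        sum.shift_bounds_nat_ivl[of _ 0 n n, simplified] add.commute)
  also have "(\<Sum>k<n. entry v k 0 * entry (Jc n * cj v) k 0) = s"
    unfolding s_def by (rule sum.cong) (auto simp: entry_Jc_mult add.commute)
  also have "(\<Sum>k<n. entry v (n + k) 0 * entry (Jc n * cj v) (n + k) 0) = - cnj s"
    unfolding s_def cnj_sum sum_negf[symmetric] by (rule sum.cong) (auto simp: entry_Jc_mult)
  finally have "herm n v = Im (s + - cnj s) / 2" unfolding herm_def by simp
  also have "\<dots> = Im s" by simp
  finally show ?thesis by (simp only: Hf_def cv_apply s_def)
qed

lemma entry_sel_id_mult: "c \<le> r \<Longrightarrow> entry (sel r c (\<lambda>j. j) * A) i j = (if i < c then entry A i j else 0)"
proof -
  assume "c \<le> r"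
  have "entry (sel r c (\<lambda>j. j) * A) i j = (\<Sum>k<c. entry (sel r c (\<lambda>j. j)) i k * entry A k j)"
    by (rule entry_times) simp
  also have "\<dots> = (\<Sum>k<c. if k = i then (if i < c then entry A i j else 0) else 0)"
    by (rule sum.cong) (use \<open>c \<le> r\<close> in \<open>auto simp: entry_sel\<close>)
  finally show ?thesis by auto
qed

lemma embZ_cv: "embZ n Z = cv ` col_span (stk n (zm n Z)) n"
proof -
  have "mk (2*n) n (\<lambda>i j. if i < n then Z i j else if i = n + j then 1 else 0) = stk n (zm n Z)"
    by (rule fmat_eqI) (auto simp: stk_def tp_def bt_def entry_sel_id_mult entry_sel)
  then show ?thesis by (simp add: embZ_def colspace_cv)
qed

lemma Mq_cv:
  assumes q: "q \<le> n" and W: "zero_outside q q W"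
  shows "mk (2*n) n (Mq n q W) = cm (Sq n q) * stk q (zm q W) * Pq n q + cm (Eq n q) * Pm n q"
proof -
  have f: "(if j < q then j else n + j - q) < 2*n" if "j < 2*q" for j using q that by auto
  have St: "cm (Sq n q) * tp q = sel (2*n) q (\<lambda>j. j)" and Sb: "cm (Sq n q) * bt q = sel (2*n) q (\<lambda>j. n + j)"
    using q by (auto intro!: fmat_eqI simp: tp_def bt_def Sq_def entry_mult_sel entry_sel)
  have S: "cm (Sq n q) * stk q (zm q W) = sel (2*n) q (\<lambda>j. j) * zm q W + sel (2*n) q (\<lambda>j. n + j)"
    by (simp add: stk_def distrib_left St Sb mult_assoc_eq[OF St])
  have tq: "entry (A * Pq n q) i j = (if j < q then entry A i j else 0)" if "cls q A" for A :: "complex fmat" and i j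
  proof -
    have "entry (A * Pq n q) i j = entry (tr (Pq n q) * tr A) j i" by (metis entry_tr tr_mult tr_simps(5))
    then show ?thesis using q by (simp add: Pq_def entry_sel_id_mult)
  qed
  have tm: "entry (cm (Eq n q) * Pm n q) i j = (if i = j \<and> q \<le> i \<and> i < n then 1 else 0)" for i j
  proof -
    have "entry (cm (Eq n q) * Pm n q) i j = (\<Sum>k<n - q. entry (cm (Eq n q)) i k * entry (Pm n q) k j)"
      by (rule entry_times) simp
    also have "\<dots> = (\<Sum>k<n - q. if k = i - q then (if i = j \<and> q \<le> i \<and> i < n then 1 else 0) else 0)"
      by (rule sum.cong) (use q in \<open>auto simp: Eq_def Pm_def entry_sel\<close>)
    finally show ?thesis by auto
  qed
  show ?thesis
  proof (rule fmat_eqI)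
    fix i j
    have c: "cls q (sel (2*n) q (\<lambda>j. j) * zm q W + sel (2*n) q (\<lambda>j. n + j))" by simp
    show "entry (mk (2*n) n (Mq n q W)) i j = entry (cm (Sq n q) * stk q (zm q W) * Pq n q + cm (Eq n q) * Pm n q) i j"
      unfolding S entry_plus tq[OF c] tm
      using q W by (auto simp: Mq_def entry_sel_id_mult entry_sel zero_outside_def)
  qed
qed

lemma boundary_cv:
  assumes q: "q \<le> n" and W: "W \<in> siegel q" and g: "cm (mk (2*n) (2*n) gf) = cm g"
  shows "act n gf (colspace n (Mq n q W)) =
    cv ` pair_span (cm g * cm (Sq n q) * stk q (zm q W)) q (cm (g * Eq n q)) (n - q)"
proof -
  have z: "zero_outside q q W" using W by (simp add: siegel_def)
  have "act n gf (colspace n (Mq n q W)) = cv ` ((\<lambda>v. cm g * v) ` col_span (mk (2*n) n (Mq n q W)) n)"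
    unfolding colspace_cv by (subst act_cv) (auto simp: col_span_def g)
  also have "(\<lambda>v. cm g * v) ` col_span (mk (2*n) n (Mq n q W)) n = col_span (cm g * mk (2*n) n (Mq n q W)) n"
    by (auto simp: col_span_def mult.assoc)
  also have "cm g * mk (2*n) n (Mq n q W) = (cm g * cm (Sq n q) * stk q (zm q W)) * Pq n q + cm (g * Eq n q) * Pm n q"
    unfolding Mq_cv[OF q z] by (simp add: distrib_left mult.assoc)
  also have "col_span \<dots> n = pair_span (cm g * cm (Sq n q) * stk q (zm q W)) q (cm (g * Eq n q)) (n - q)"
    by (rule pair_span_col_span[OF q, symmetric])
  finally show ?thesis .
qed

lemma positive_lagrangian_embZ:
  assumes M: "rws (2*n) M" "cls n M" "tr M * Jc n * M = 0"
    and pos: "\<And>a. rws n a \<Longrightarrow> cls 1 a \<Longrightarrow> a \<noteq> 0 \<Longrightarrow> herm n (M * a) > 0"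
  shows "\<exists>Z\<in>siegel n. cv ` col_span M n = embZ n Z"
proof -
  obtain Z C where Z: "Z \<in> siegel n" "rws n C" "cls n C" "M = stk n (zm n Z) * (tr (bt n) * M)"
    "tr (bt n) * M * C = idm n"
    by (rule positive_lagrangian[OF M]) (use pos in blast)+
  define M2 where "M2 = tr (bt n) * M"
  have M2: "rws n M2" "cls n M2" using M by (simp_all add: M2_def)
  have "col_span M n = col_span (stk n (zm n Z)) n"
  proof
    show "col_span M n \<subseteq> col_span (stk n (zm n Z)) n"
    proof
      fix v assume "v \<in> col_span M n"
      then obtain a where a: "rws n a" "cls 1 a" "v = M * a" by (rule col_spanE)
      then have "v = stk n (zm n Z) * (M2 * a)" using Z(4) unfolding M2_def by (metis mult.assoc)
      then show "v \<in> col_span (stk n (zm n Z)) n" using a M2 by (auto intro!: col_spanI)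
    qed
    show "col_span (stk n (zm n Z)) n \<subseteq> col_span M n"
    proof
      fix v assume "v \<in> col_span (stk n (zm n Z)) n"
      then obtain a where a: "rws n a" "cls 1 a" "v = stk n (zm n Z) * a" by (rule col_spanE)
      have "M * (C * a) = stk n (zm n Z) * (tr (bt n) * M * C) * a" by (subst Z(4)) (simp add: mult.assoc)
      then have "v = M * (C * a)" using Z(5) a by simp
      then show "v \<in> col_span M n" using a Z by (auto intro!: col_spanI)
    qed
  qed
  then show ?thesis using Z(1) by (auto simp: embZ_cv)
qed

lemma siegel_herm_pos: "Z \<in> siegel n \<Longrightarrow> rws n a \<Longrightarrow> cls 1 a \<Longrightarrow> a \<noteq> 0 \<Longrightarrow> herm n (stk n (zm n Z) * a) > 0"
proof -
  assume Z: "Z \<in> siegel n" and a: "rws n a" "cls 1 a" "a \<noteq> 0"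
  obtain c where c: "c > 0" "\<And>(a::complex fmat) k. rws n a \<Longrightarrow> cls 1 a \<Longrightarrow> c * (cmod (entry a k 0))\<^sup>2 \<le> herm n (stk n (zm n Z) * a)"
    using herm_siegel_lower[OF Z] by blast
  have "\<exists>k. entry a k 0 \<noteq> 0"
  proof (rule ccontr)
    assume "\<not> ?thesis"
    then have "cv a = cv 0" by (auto simp: cv_def)
    then have "a = 0" using cv_inject[of a 0] a by simp
    then show False using a by simp
  qed
  then obtain k where "entry a k 0 \<noteq> 0" by blast
  then have "c * (cmod (entry a k 0))\<^sup>2 > 0" using c(1) by simp
  then show ?thesis using c(2)[OF a(1,2), of k] by linarith
qed

text \<open>From equality of Lagrangians to the fractional action. Since \<open>mob\<close> is a
  definite description, uniqueness has to be shown as well: \<open>N2\<close>, which is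
  \<open>CZ + D\<close>, is the lower block of the positive Lagrangian \<open>N\<close> and so
  invertible by \<open>positive_lagrangian\<close>.\<close>

lemma hfix_criterion:
  assumes Z: "Z \<in> siegel n" and g [simp]: "rws (2*n) g" "cls (2*n) g" and gJ: "tr g * Jm n * g = Jm n"
    and fx: "act n (entry g) (embZ n Z) = tauP n (embZ n Z)"
  shows "Z \<in> hfix n (entry g)"
proof -
  let ?Z = "zm n Z"
  have gg: "mk (2*n) (2*n) (entry g) = g"
    using g by (intro fmat_eqI) (auto simp: rws_def cls_def simp del: g)
  define N where "N = cm g * stk n ?Z"
  have Nd [simp]: "rws (2*n) N" "cls n N" by (simp_all add: N_def)
  have gJc: "tr (cm g) * (Jc n * (cm g * X)) = Jc n * X" for X
    using arg_cong[OF gJ, of cm] by (simp add: mult.assoc[symmetric])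
  have NJN: "tr N * Jc n * N = 0"
    using stk_isotropic[of n ?Z] siegel_zm[OF Z] by (simp add: N_def mult.assoc gJc)
  have Npos: "herm n (N * a) > 0" if "rws n a" "cls 1 a" "a \<noteq> 0" for a
    unfolding N_def mult.assoc herm_symplectic[OF gJ] by (rule siegel_herm_pos[OF Z that])
  define N2 where "N2 = tr (bt n) * N"
  obtain C where C: "rws n C" "cls n C" "N2 * C = idm n" "C * N2 = idm n"
    unfolding N2_def by (rule positive_lagrangian[OF Nd NJN]) (use Npos in blast)+
  have Nd2: "rws n N2" "cls n N2" by (simp_all add: N2_def)
  let ?t = "zm n (tauZ Z)"
  have tz: "cm (eps n) * cj (stk n ?Z) = stk n ?t"
    by (rule fmat_eqI)
      (auto simp: entry_cm_eps_mult stk_def tp_def bt_def entry_sel_id_mult entry_sel tauZ_def)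
  have tauset: "tauP n (embZ n Z) = cv ` col_span (stk n ?t) n"
  proof -
    have "tauP n (embZ n Z) = cv ` ((\<lambda>v. cm (eps n) * cj v) ` col_span (stk n ?Z) n)"
      unfolding embZ_cv by (rule tauP_cv) (auto simp: col_span_def)
    also have "(\<lambda>v. cm (eps n) * cj v) ` col_span (stk n ?Z) n = col_span (stk n ?t) n"
    proof
      show "(\<lambda>v. cm (eps n) * cj v) ` col_span (stk n ?Z) n \<subseteq> col_span (stk n ?t) n"
      proof (rule image_subsetI, erule col_spanE)
        fix v a assume a: "rws n a" "cls 1 a" "v = stk n ?Z * a"
        have "cm (eps n) * cj v = stk n ?t * cj a" unfolding a(3) by (simp add: tz flip: mult.assoc)
        then show "cm (eps n) * cj v \<in> col_span (stk n ?t) n" using a by (auto intro!: col_spanI)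
      qed
      show "col_span (stk n ?t) n \<subseteq> (\<lambda>v. cm (eps n) * cj v) ` col_span (stk n ?Z) n"
      proof (rule subsetI, erule col_spanE)
        fix v a assume a: "rws n a" "cls 1 a" "v = stk n ?t * a"
        have "v = cm (eps n) * cj (stk n ?Z * cj a)" unfolding a(3) by (simp add: tz flip: mult.assoc)
        moreover have "stk n ?Z * cj a \<in> col_span (stk n ?Z) n" using a by (intro col_spanI) auto
        ultimately show "v \<in> (\<lambda>v. cm (eps n) * cj v) ` col_span (stk n ?Z) n" by blast
      qed
    qed
    finally show ?thesis .
  qed
  have actset: "act n (entry g) (embZ n Z) = cv ` ((\<lambda>v. cm g * v) ` col_span (stk n ?Z) n)"
    unfolding embZ_cv by (subst act_cv) (auto simp: col_span_def gg)
  have "\<exists>a c. rws n a \<and> rws 0 c \<and> N * unit_fmat j 0 = stk n ?t * a + 0 * c" if "j < n" for j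
  proof -
    have "stk n ?Z * unit_fmat j 0 \<in> col_span (stk n ?Z) n" using that by (intro col_spanI) auto
    then have "cv (cm g * (stk n ?Z * unit_fmat j 0)) \<in> act n (entry g) (embZ n Z)" unfolding actset by blast
    then obtain a where a: "rws n a" "cls 1 a" "cv (N * unit_fmat j 0) = cv (stk n ?t * a)"
      unfolding fx tauset by (auto simp: N_def mult.assoc elim!: col_spanE)
    have "N * unit_fmat j 0 = stk n ?t * a" by (rule cv_inject) (use a in auto)
    then show ?thesis using a by (intro exI[of _ a] exI[of _ 0]) simp
  qed
  then obtain k where k: "rws n k" "cls n k" "N = stk n ?t * k"
    using matrix_by_columns[OF Nd(2), of n 0 "stk n ?t" 0] by (metis add.right_neutral mult_zero_left)
  \<comment> \<open>The lower block of \<open>stk n ?t\<close> is the identity, so the coefficient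
    matrix is \<open>N2\<close> itself and the upper block of \<open>N\<close> is
    \<open>?t * N2\<close>.\<close>
  have "N2 = k" unfolding N2_def k(3) using k(1)
    by (simp add: stk_def distrib_right distrib_left tpbt tpbt[THEN mult_assoc_eq] mult.assoc)
  then have tN: "tr (tp n) * N = ?t * N2" using k
    by (simp add: stk_def distrib_right distrib_left tpbt tpbt[THEN mult_assoc_eq] mult.assoc)
  have eN: "entry N i j = (\<Sum>l<n. of_real (entry g i l) * Z l j) + of_real (entry g i (n + j))" if "j < n" for i j
  proof -
    have "N = (cm g * tp n) * ?Z + cm g * bt n" by (simp add: N_def stk_def distrib_left mult.assoc)
    moreover have "entry ((cm g * tp n) * ?Z) i j = (\<Sum>l<n. entry (cm g * tp n) i l * entry ?Z l j)"
      by (rule entry_times) simp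
    moreover have "\<dots> = (\<Sum>l<n. of_real (entry g i l) * Z l j)"
      by (rule sum.cong) (use that in \<open>auto simp: tp_def entry_mult_sel\<close>)
    moreover have "entry (cm g * bt n) i j = of_real (entry g i (n + j))"
      using that by (simp add: bt_def entry_mult_sel)
    ultimately show ?thesis by (simp only: entry_plus)
  qed
  have eq_iff: "(\<forall>i<n. \<forall>j<n. (\<Sum>k<n. W i k * ((\<Sum>l<n. of_real (entry g (n+k) l) * Z l j) + of_real (entry g (n+k) (n+j))))
        = (\<Sum>l<n. of_real (entry g i l) * Z l j) + of_real (entry g i (n+j))) \<longleftrightarrow> zm n W * N2 = tr (tp n) * N" for W
  proof -
    have l: "entry (zm n W * N2) i j = (\<Sum>k<n. W i k * ((\<Sum>l<n. of_real (entry g (n+k) l) * Z l j) + of_real (entry g (n+k) (n+j))))"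
      if "i < n" "j < n" for i j
    proof -
      have "entry (zm n W * N2) i j = (\<Sum>k<n. entry (zm n W) i k * entry N2 k j)" by (rule entry_times) simp
      also have "\<dots> = (\<Sum>k<n. W i k * ((\<Sum>l<n. of_real (entry g (n+k) l) * Z l j) + of_real (entry g (n+k) (n+j))))"
        by (rule sum.cong) (use that in \<open>auto simp: N2_def bt_def entry_trsel_mult eN\<close>)
      finally show ?thesis .
    qed
    have r: "entry (tr (tp n) * N) i j = (\<Sum>l<n. of_real (entry g i l) * Z l j) + of_real (entry g i (n+j))"
      if "i < n" "j < n" for i j
      using that by (simp add: tp_def entry_trsel_mult eN)
    show ?thesis
    proof
      assume L: "\<forall>i<n. \<forall>j<n. (\<Sum>k<n. W i k * ((\<Sum>l<n. of_real (entry g (n+k) l) * Z l j) + of_real (entry g (n+k) (n+j))))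
        = (\<Sum>l<n. of_real (entry g i l) * Z l j) + of_real (entry g i (n+j))"
      show "zm n W * N2 = tr (tp n) * N"
      proof (rule fmat_eqI)
        fix i j
        show "entry (zm n W * N2) i j = entry (tr (tp n) * N) i j"
        proof (cases "i < n \<and> j < n")
          case True
          then show ?thesis using l r L by simp
        next
          case False
          moreover have "rws n (zm n W * N2)" "cls n (zm n W * N2)" "rws n (tr (tp n) * N)" "cls n (tr (tp n) * N)"
            using Nd2 by simp_all
          ultimately show ?thesis unfolding rws_def cls_def by (metis not_le)
        qed
      qed
    next
      assume e: "zm n W * N2 = tr (tp n) * N"
      show "\<forall>i<n. \<forall>j<n. (\<Sum>k<n. W i k * ((\<Sum>l<n. of_real (entry g (n+k) l) * Z l j) + of_real (entry g (n+k) (n+j))))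
        = (\<Sum>l<n. of_real (entry g i l) * Z l j) + of_real (entry g i (n+j))"
      proof (intro allI impI)
        fix i j assume ij: "i < n" "j < n"
        show "(\<Sum>k<n. W i k * ((\<Sum>l<n. of_real (entry g (n+k) l) * Z l j) + of_real (entry g (n+k) (n+j))))
          = (\<Sum>l<n. of_real (entry g i l) * Z l j) + of_real (entry g i (n+j))"
          unfolding l[OF ij, symmetric] r[OF ij, symmetric] e ..
      qed
    qed
  qed
  have zt: "zero_outside n n (tauZ Z)" using Z by (auto simp: siegel_def zero_outside_def tauZ_def)
  have "mob n (entry g) Z = tauZ Z"
    unfolding mob_def eq_iff
  proof (rule the_equality)
    show "zero_outside n n (tauZ Z) \<and> zm n (tauZ Z) * N2 = tr (tp n) * N" using zt tN by simp
    fix W assume W: "zero_outside n n W \<and> zm n W * N2 = tr (tp n) * N"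
    then have "zm n W * N2 * C = ?t * N2 * C" using tN by simp
    then have "zm n W = ?t" using C(3) by (simp add: mult.assoc)
    then have e: "entry (zm n W) i j = entry ?t i j" for i j by simp
    show "W = tauZ Z"
    proof (intro ext)
      fix i j
      show "W i j = tauZ Z i j"
      proof (cases "i < n \<and> j < n")
        case True
        then show ?thesis using e[of i j] by simp
      next
        case False
        then show ?thesis using W zt unfolding zero_outside_def by (metis not_le)
      qed
    qed
  qed
  then show ?thesis using Z by (simp add: hfix_def)
qed

section \<open>Approximation of boundary points\<close>

lemma eps_anti_symplectic: "tr t * Jm n * t = - Jm n \<Longrightarrow> tr (eps n * t) * Jm n * (eps n * t) = Jm n"
proof -
  assume "tr t * Jm n * t = - Jm n"
  moreover have "tr (eps n * t) * Jm n * (eps n * t) = tr t * (eps n * Jm n * eps n) * t" by (simp add: mult.assoc)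
  ultimately show ?thesis by (simp add: eps_J_eps)
qed

lemma entry_sel_mult_zero: "(\<And>k. k < c \<Longrightarrow> f k \<noteq> i) \<Longrightarrow> entry (sel r c f * A) i j = 0"
proof -
  assume f: "\<And>k. k < c \<Longrightarrow> f k \<noteq> i"
  have "entry (sel r c f * A) i j = (\<Sum>k<c. entry (sel r c f) i k * entry A k j)"
    by (rule entry_times) simp
  also have "\<dots> = 0" by (rule sum.neutral) (use f in \<open>force simp: entry_sel\<close>)
  finally show ?thesis .
qed

lemma mk_entry: "rws r g \<Longrightarrow> cls c g \<Longrightarrow> mk r c (entry g) = g"
  by (intro fmat_eqI) (auto simp: rws_def cls_def)

lemma hbar_dims: "P \<in> hbar n \<Longrightarrow> v \<in> P \<Longrightarrow> 2*n \<le> i \<Longrightarrow> v i = 0"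
  unfolding hbar_def is_bcomp_def embZ_def colspace_def Fstd_def act_def actv_def by fastforce

context boundary_point
begin

text \<open>\<open>X0\<close> is the boundary point as a set of columns, \<open>Pt\<close> the
  interior point that tends to it as \<tau> grows.\<close>

abbreviation "X0 \<equiv> pair_span U q (cm E) m"
abbreviation "Pt b \<tau> \<equiv> pair_span U2 q (Vt b \<tau>) m"

lemma X0_props: "v \<in> X0 \<Longrightarrow> rws (2*n) v" "v \<in> X0 \<Longrightarrow> cls 1 v" "v \<in> X0 \<Longrightarrow> cm K * v = 0"
  by (auto elim!: pair_spanE simp: distrib_left mult_assoc_eq[OF KU] mult_assoc_eq[OF frame_c(1)])

lemma E_in_X0: "rws m c \<Longrightarrow> cls 1 c \<Longrightarrow> cm E * c \<in> X0"
  using pair_spanI[of q 0 m c U "cm E"] by simp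

lemma U_in_X0: "rws q a \<Longrightarrow> cls 1 a \<Longrightarrow> U * a \<in> X0"
  using pair_spanI[of q a m 0 U "cm E"] by simp

lemma X0_add_E: "v \<in> X0 \<Longrightarrow> rws m c \<Longrightarrow> cls 1 c \<Longrightarrow> v + cm E * c \<in> X0"
proof (erule pair_spanE)
  fix a c' assume a: "rws q a" "cls 1 a" "rws m c'" "cls 1 c'" "v = U * a + cm E * c'" and c: "rws m c" "cls 1 c"
  have e: "v + cm E * c = U * a + cm E * (c' + c)" by (simp add: a distrib_left add.assoc)
  show ?thesis unfolding e by (rule pair_spanI) (use a c in simp_all)
qed

lemma X0_null: "v \<in> X0 \<Longrightarrow> herm n v = 0 \<Longrightarrow> \<exists>c. rws m c \<and> cls 1 c \<and> v = cm E * c"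
proof (erule pair_spanE)
  fix a c assume a: "rws q a" "cls 1 a" "rws m c" "cls 1 c" "v = U * a + cm E * c" and H: "herm n v = 0"
  have "a = 0" using herm_null_iff[OF a(1,2)] a(5) H by simp
  then show ?thesis using a by auto
qed

lemma Pt_props: assumes "rws m b" "cls m b" shows "v \<in> Pt b \<tau> \<Longrightarrow> rws (2*n) v" "v \<in> Pt b \<tau> \<Longrightarrow> cls 1 v"
  using assms by (auto elim!: pair_spanE)

lemma K_Vt: "rws m b \<Longrightarrow> cls m b \<Longrightarrow> cm K * Vt b \<tau> = idm m"
  by (simp add: Vt_def distrib_left frame_c frame_c[THEN mult_assoc_eq])

lemma herm_Pt_pos:
  assumes b: "rws m b" "cls m b" and ac: "rws q a" "cls 1 a" "rws m c" "cls 1 c" and \<tau>: "\<tau> > 0" and ne: "a \<noteq> 0 \<or> c \<noteq> 0"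
  shows "herm n (U2 * a + Vt b \<tau> * c) > 0"
proof -
  have nn: "(\<Sum>i<m. (cmod (entry c i 0))\<^sup>2) + (\<Sum>i<m. (cmod (entry (tr (cm b) * c) i 0))\<^sup>2) \<ge> 0"
    by (intro add_nonneg_nonneg sum_nonneg) auto
  show ?thesis
  proof (cases "c = 0")
    case True
    then have "a \<noteq> 0" using ne by simp
    then have "herm n (U * a) > 0" using herm_U_zero[OF ac(1,2)] by (meson not_le)
    then show ?thesis unfolding herm_U2V[OF b ac(3,4)] using nn \<tau> by (simp add: add_pos_nonneg)
  next
    case False
    have "\<exists>i<m. entry c i 0 \<noteq> 0"
    proof (rule ccontr)
      assume *: "\<not> ?thesis"
      have "entry c i 0 = 0" for i using * ac(3) by (cases "i < m") (auto simp: rws_def)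
      then have "cv c = cv 0" by (auto simp: cv_def)
      then show False using cv_inject[of c 0] ac(4) False by simp
    qed
    then obtain i where i: "i < m" "entry c i 0 \<noteq> 0" by blast
    have "0 < (cmod (entry c i 0))\<^sup>2" using i by simp
    also have "\<dots> \<le> (\<Sum>i<m. (cmod (entry c i 0))\<^sup>2)" using i by (intro member_le_sum) auto
    finally have "0 < (\<Sum>i<m. (cmod (entry c i 0))\<^sup>2) + (\<Sum>i<m. (cmod (entry (tr (cm b) * c) i 0))\<^sup>2)"
      by (intro add_pos_nonneg sum_nonneg) auto
    then show ?thesis unfolding herm_U2V[OF b ac(3,4)] using herm_U_nonneg[OF ac(1,2)] \<tau> by (simp add: add_nonneg_pos)
  qed
qed

text \<open>The factor \<open>h\<close> covers both the point itself and its translate to the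
  position of a standard component.\<close>

lemma Pt_embZ:
  assumes b [simp]: "rws m b" "cls m b" and \<tau>: "\<tau> > 0" and nq: "q \<le> n" "m = n - q"
    and h [simp]: "rws (2*n) h" "cls (2*n) h" and hJ: "tr h * Jm n * h = Jm n"
  shows "\<exists>Z\<in>siegel n. cv ` ((\<lambda>v. cm h * v) ` Pt b \<tau>) = embZ n Z"
proof -
  let ?V = "Vt b \<tau>"
  define M where "M = U2 * Pq n q + ?V * Pm n q"
  have Vd [simp]: "rws (2*n) ?V" "cls m ?V" by simp_all
  have Md [simp]: "rws (2*n) M" "cls n M" by (simp_all add: M_def)
  have "(\<lambda>v. cm h * v) ` Pt b \<tau> = col_span (cm h * M) n"
    unfolding nq(2) pair_span_col_span[OF nq(1)] M_def col_span_def by (auto simp: mult.assoc)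
  moreover have "\<exists>Z\<in>siegel n. cv ` col_span (cm h * M) n = embZ n Z"
  proof (rule positive_lagrangian_embZ)
    show "rws (2*n) (cm h * M)" "cls n (cm h * M)" by simp_all
    have hJc: "tr (cm h) * (Jc n * (cm h * X)) = Jc n * X" for X
      using arg_cong[OF hJ, of cm] by (simp add: mult.assoc[symmetric])
    have "tr (cm h * M) * Jc n * (cm h * M) = tr M * (Jc n * M)" by (simp add: mult.assoc hJc)
    also have "\<dots> = tr (Pq n q) * (tr U2 * Jc n * U2) * Pq n q + tr (Pq n q) * (tr U2 * Jc n * ?V) * Pm n q
      + tr (Pm n q) * (tr ?V * Jc n * U2) * Pq n q + tr (Pm n q) * (tr ?V * Jc n * ?V) * Pm n q"
      by (simp add: M_def mdistribs add.assoc)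
    also have "\<dots> = 0" by (simp add: U2_JU2 Vt_form)
    finally show "tr (cm h * M) * Jc n * (cm h * M) = 0" .
    fix a :: "complex fmat" assume a: "rws n a" "cls 1 a" "a \<noteq> 0"
    have "M * a = U2 * (Pq n q * a) + ?V * (Pm n q * a)" by (simp add: M_def distrib_right mult.assoc)
    moreover have "herm n \<dots> > 0"
      by (rule herm_Pt_pos) (use a \<tau> b nq Pqm_zero[OF nq(1) a(1)] in auto)
    ultimately show "herm n (cm h * M * a) > 0" by (simp add: mult.assoc herm_symplectic[OF hJ])
  qed
  ultimately show ?thesis by simp
qed

lemma Pt_hfix:
  assumes t [simp]: "rws (2*n) t" "cls (2*n) t" and anti: "tr t * Jm n * t = - Jm n" and tt: "t * t = idm (2*n)"
    and tE: "t * E = E * b" and tF: "t * F = - (F * tr b)" and b [simp]: "rws m b" "cls m b" and bb: "b * b = idm m"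
    and tX: "\<And>v. v \<in> X0 \<Longrightarrow> cj (cm t * v) \<in> X0" and \<tau>: "\<tau> > 0" and nq: "q \<le> n" "m = n - q"
  shows "cv ` Pt b \<tau> \<in> embZ n ` hfix n (entry (eps n * t))"
proof -
  have idJ: "tr (idm (2*n)) * Jm n * idm (2*n) = Jm n" by simp
  have "(\<lambda>v. cm (idm (2*n)) * v) ` Pt b \<tau> = (\<lambda>v. v) ` Pt b \<tau>"
    by (rule image_cong) (use Pt_props[OF b] in auto)
  then obtain Z where Z: "Z \<in> siegel n" "cv ` Pt b \<tau> = embZ n Z"
    using Pt_embZ[OF b \<tau> nq _ _ idJ] by auto
  have sub: "cj (cm t * v) \<in> Pt b \<tau>" if "v \<in> Pt b \<tau>" for v
    using that
  proof (rule pair_spanE)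
    fix a c assume a: "rws q a" "cls 1 a" "rws m c" "cls 1 c" "v = U2 * a + Vt b \<tau> * c"
    have "U2 * a \<in> X0" unfolding U2_a using a by (intro pair_spanI) auto
    then have "cj (cm t * (U2 * a)) \<in> X0" by (rule tX)
    then obtain a' c' where a': "rws q a'" "cls 1 a'" "rws m c'" "cls 1 c'" "cj (cm t * (U2 * a)) = U * a' + cm E * c'"
      by (rule pair_spanE)
    \<comment> \<open>Stability of the complement makes \<open>t\<close> preserve the kernel of
      \<open>G\<close>. A vector of \<open>X0\<close> in this kernel has the form
      \<open>U2 * a'\<close>, which identifies the image of \<open>U2 * a\<close>.\<close>
    have Gt: "G * t = b * G"
    proof -
      have "tr t * Jm n = tr t * Jm n * (t * t)" by (simp add: tt)
      also have "\<dots> = (tr t * Jm n * t) * t" by (simp only: mult.assoc)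
      finally have "Jm n * t = - (tr t * Jm n)" by (simp add: anti)
      then have "G * t = tr (t * F) * Jm n" by (simp add: G_def mult.assoc)
      then show ?thesis unfolding tF by (simp add: G_def mult.assoc)
    qed
    have "cm G * (cm t * (U2 * a)) = cm (G * t) * (U2 * a)" by (simp add: mult.assoc)
    also have "\<dots> = 0" unfolding Gt by (simp add: mult.assoc mult_assoc_eq[OF GU2])
    finally have "cj (cm G * (cm t * (U2 * a))) = 0" by simp
    then have "cm G * cj (cm t * (U2 * a)) = 0" by simp
    then have "c' = - (cm G * (U * a'))"
      unfolding a'(5) using a' by (simp add: distrib_left mult_assoc_eq[OF frame_c(3)] eq_neg_iff_add_eq_0 add.commute)
    then have "cj (cm t * (U2 * a)) = U2 * a'" using a'(5) by (simp add: U2_a)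
    moreover have "cj (cm t * (Vt b \<tau> * c)) = Vt b \<tau> * (- (tr (cm b) * cj c))"
      by (rule Vt_equivariant[OF tE tF b bb])
    moreover have "cj (cm t * v) = cj (cm t * (U2 * a)) + cj (cm t * (Vt b \<tau> * c))"
      unfolding a(5) by (simp only: distrib_left maps_simps(5))
    ultimately have e: "cj (cm t * v) = U2 * a' + Vt b \<tau> * (- (tr (cm b) * cj c))" by simp
    show "cj (cm t * v) \<in> Pt b \<tau>" unfolding e by (rule pair_spanI) (use a a' in simp_all)
  qed
  have ttc: "cm t * (cm t * v) = v" if "v \<in> Pt b \<tau>" for v
    using arg_cong[OF tt, of cm] Pt_props[OF b] that by (simp add: mult.assoc[symmetric])
  \<comment> \<open>The inclusion \<open>sub\<close> is upgraded to equality by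
    \<open>t * t = idm (2*n)\<close>.\<close>
  have eq: "(\<lambda>v. cm t * v) ` Pt b \<tau> = cj ` Pt b \<tau>"
  proof
    show "(\<lambda>v. cm t * v) ` Pt b \<tau> \<subseteq> cj ` Pt b \<tau>"
    proof (rule image_subsetI)
      fix v assume "v \<in> Pt b \<tau>"
      then have "cj (cm t * v) \<in> Pt b \<tau>" by (rule sub)
      moreover have "cm t * v = cj (cj (cm t * v))" by simp
      ultimately show "cm t * v \<in> cj ` Pt b \<tau>" by blast
    qed
    show "cj ` Pt b \<tau> \<subseteq> (\<lambda>v. cm t * v) ` Pt b \<tau>"
    proof (rule image_subsetI)
      fix v assume v: "v \<in> Pt b \<tau>"
      have "cj v = cj (cm t * (cm t * v))" using ttc[OF v] by simp
      also have "\<dots> = cm t * cj (cm t * v)" by simp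
      finally show "cj v \<in> (\<lambda>v. cm t * v) ` Pt b \<tau>" using sub[OF v] by blast
    qed
  qed
  have "Z \<in> hfix n (entry (eps n * t))"
  proof (rule hfix_criterion[OF Z(1)])
    show "rws (2*n) (eps n * t)" "cls (2*n) (eps n * t)" by simp_all
    show "tr (eps n * t) * Jm n * (eps n * t) = Jm n" by (rule eps_anti_symplectic[OF anti])
    have "act n (entry (eps n * t)) (cv ` Pt b \<tau>) = cv ` ((\<lambda>v. cm (eps n * t) * v) ` Pt b \<tau>)"
      by (subst act_cv) (use Pt_props[OF b] in \<open>auto simp: mk_entry\<close>)
    also have "(\<lambda>v. cm (eps n * t) * v) ` Pt b \<tau> = (\<lambda>v. cm (eps n) * v) ` ((\<lambda>v. cm t * v) ` Pt b \<tau>)"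
      by (simp add: image_image mult.assoc)
    also have "\<dots> = (\<lambda>v. cm (eps n) * cj v) ` Pt b \<tau>" unfolding eq by (simp add: image_image)
    also have "cv ` \<dots> = tauP n (cv ` Pt b \<tau>)"
      by (rule tauP_cv[symmetric]) (use Pt_props[OF b] in auto)
    finally show "act n (entry (eps n * t)) (embZ n Z) = tauP n (embZ n Z)" unfolding Z(2) .
  qed
  then show ?thesis unfolding Z(2) by blast
qed

text \<open>The projection does not depend on \<tau>, so only the bound by \<open>Kc\<close> has to
  be arranged. A vector of \<open>Pt\<close> with nonzero integral lower coordinates has
  \<open>c\<close> bounded away from 0, and its form is at least \<tau> times the squared length of
  \<open>c\<close>.\<close>

lemma Pt_in_Ustd:
  assumes b [simp]: "rws m b" "cls m b" and nq: "q \<le> n" "m = n - q" and q': "q' \<le> n"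
    and g [simp]: "rws (2*n) g" "cls (2*n) g" and gJ: "tr g * Jm n * g = Jm n"
    and T: "g * Eq n q' = E * T" and Td [simp]: "rws m T" "cls (n - q') T"
    and T': "E = g * Eq n q' * T'" and Td' [simp]: "rws (n - q') T'" "cls m T'"
    and pr: "projset n q' (cv ` ((\<lambda>v. cm (symp_inv n g) * v) ` X0)) = embZ q' W" and W: "W \<in> V"
  shows "\<exists>\<tau>>0. cv ` ((\<lambda>v. cm (symp_inv n g) * v) ` Pt b \<tau>) \<in> Ustd n q' V Kc"
proof -
  define gi where "gi = symp_inv n g"
  note gip = symp_inv[OF g gJ, folded gi_def]
  note std = std_relations[OF q']
  have gid [simp]: "rws (2*n) gi" "cls (2*n) gi" by (rule gip)+
  have "tr (Fq n q') * gi = tr (Eq n q') * (tr g * Jm n * g) * gi" using std(6) gJ by simp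
  also have "\<dots> = tr (g * Eq n q') * Jm n * (g * gi)" by (simp add: mult.assoc)
  also have "\<dots> = tr T * K" unfolding T gip(4) by (simp add: K_def mult.assoc)
  finally have "cm (tr (Fq n q') * gi) = cm (tr T * K)" by simp
  then have Fgi: "tr (cm (Fq n q')) * (cm gi * w) = tr (cm T) * (cm K * w)" for w
    by (simp add: mult.assoc[symmetric])
  \<comment> \<open>In the coordinates of the neighbourhood the lower entries dual to
    \<open>Eq n q'\<close> are \<open>tr T\<close> applied to \<open>K * w\<close>; on
    \<open>Pt\<close> the vector \<open>K * w\<close> is just \<open>c\<close>.\<close>
  have low: "cv (cm gi * w) (n + j) = entry (tr (cm T) * (cm K * w)) (j - q') 0" if "q' \<le> j" "j < n" for w j
    unfolding Fgi[symmetric] using that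
    by (simp add: Fq_def entry_trsel_mult cv_apply)
  have "E * idm m = E * (T * T')" using T T' by (simp add: mult.assoc[symmetric])
  then have "G * (E * idm m) = G * (E * (T * T'))" by simp
  then have TT: "T * T' = idm m" by (simp add: frs)
  have TTc: "tr (cm T') * (tr (cm T) * X) = X" if "rws m X" for X
  proof -
    have "tr (cm (T * T')) = idm m" by (simp only: TT maps_simps tr_simps)
    then have "tr (cm T') * tr (cm T) = idm m" by simp
    then show ?thesis using that by (simp add: mult.assoc[symmetric])
  qed
  have van: "(\<forall>j. q' \<le> j \<and> j < n \<longrightarrow> cv (cm gi * w) (n + j) = 0) \<longleftrightarrow> cm K * w = 0" if w: "cls 1 w" for w
  proof
    assume z: "\<forall>j. q' \<le> j \<and> j < n \<longrightarrow> cv (cm gi * w) (n + j) = 0"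
    have "tr (cm T) * (cm K * w) = 0"
    proof (rule cv_inject)
      show "cls 1 (tr (cm T) * (cm K * w))" using w by simp
      show "cv (tr (cm T) * (cm K * w)) = cv 0"
      proof (rule ext)
        fix i
        show "cv (tr (cm T) * (cm K * w)) i = cv 0 i"
        proof (cases "i < n - q'")
          case True
          then show ?thesis using z[rule_format, of "q' + i"] low[of "q' + i" w] by (simp add: cv_apply)
        next
          case False
          moreover have "rws (n - q') (tr (cm T) * (cm K * w))" by simp
          ultimately show ?thesis by (simp add: cv_apply rws_def)
        qed
      qed
    qed simp
    then show "cm K * w = 0" using TTc[of "cm K * w"] by simp
  next
    assume "cm K * w = 0"
    then show "\<forall>j. q' \<le> j \<and> j < n \<longrightarrow> cv (cm gi * w) (n + j) = 0" using low[of _ w] by simp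
  qed
  define rm where "rm v = (\<lambda>i. if i < q' then v i else if i < 2*q' then v (n + i - q') else 0)" for v :: "nat \<Rightarrow> complex"
  have proj: "projset n q' (cv ` ((\<lambda>v. cm gi * v) ` S)) = {rm (cv (cm gi * w)) | w. w \<in> S \<and> cm K * w = 0}"
    if S: "\<And>w. w \<in> S \<Longrightarrow> cls 1 w" for S
  proof -
    have "projset n q' (cv ` ((\<lambda>v. cm gi * v) ` S)) =
      {rm (cv (cm gi * w)) | w. w \<in> S \<and> (\<forall>j. q' \<le> j \<and> j < n \<longrightarrow> cv (cm gi * w) (n + j) = 0)}"
      unfolding projset_def rm_def by blast
    then show ?thesis using van S by blast
  qed
  have giE: "gi * E = Eq n q' * T'"
  proof -
    have "gi * E = (gi * g) * Eq n q' * T'" by (subst T') (simp only: mult.assoc)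
    then show ?thesis by (simp add: gip(3))
  qed
  have rmE: "rm (cv (cm gi * (w + cm E * c))) = rm (cv (cm gi * w))" for w c
  proof
    fix i
    have "cm gi * (cm E * c) = cm (gi * E) * c" by (simp add: mult.assoc)
    then have e: "cm gi * (w + cm E * c) = cm gi * w + cm (Eq n q') * (cm T' * c)"
      unfolding giE by (simp add: distrib_left mult.assoc)
    have z: "entry (cm (Eq n q') * X) x 0 = 0" if "x < q' \<or> n \<le> x" for X x
      unfolding Eq_def sel_maps by (rule entry_sel_mult_zero) (use that q' in auto)
    show "rm (cv (cm gi * (w + cm E * c))) i = rm (cv (cm gi * w)) i"
    proof (cases "i < q'")
      case True
      then show ?thesis using z[of i] unfolding e rm_def cv_apply by simp
    next
      case False
      then have "entry (cm (Eq n q') * X) (n + i - q') 0 = 0" for X by (intro z) linarith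
      then show ?thesis using False unfolding e rm_def cv_apply by simp
    qed
  qed
  have KPt: "cm K * (U2 * a + Vt b \<tau> * c) = c" if "rws m c" for a c \<tau>
    using that by (simp add: distrib_left mult_assoc_eq[OF KU2] mult_assoc_eq[OF K_Vt])
  \<comment> \<open>Vectors of \<open>Pt\<close> with \<open>K * w = 0\<close> have
    \<open>c = 0\<close>, so they are \<open>U2 * a\<close>, which differs from \<open>U * a\<close>
    by a vector of L; and \<open>rm\<close> forgets L.\<close>
  have projeq: "projset n q' (cv ` ((\<lambda>v. cm gi * v) ` Pt b \<tau>)) = projset n q' (cv ` ((\<lambda>v. cm gi * v) ` X0))" for \<tau>
  proof -
    have "{rm (cv (cm gi * w)) | w. w \<in> Pt b \<tau> \<and> cm K * w = 0} = {rm (cv (cm gi * w)) | w. w \<in> X0 \<and> cm K * w = 0}"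
    proof (intro equalityI subsetI)
      fix f assume "f \<in> {rm (cv (cm gi * w)) | w. w \<in> Pt b \<tau> \<and> cm K * w = 0}"
      then obtain w where w: "w \<in> Pt b \<tau>" "cm K * w = 0" "f = rm (cv (cm gi * w))" by blast
      from w(1) obtain a c where a: "rws q a" "cls 1 a" "rws m c" "cls 1 c" "w = U2 * a + Vt b \<tau> * c" by (rule pair_spanE)
      then have "c = 0" using KPt w(2) by simp
      then have e: "w = U * a + cm E * (- (cm G * (U * a)))" using a(5) U2_a by simp
      have "w \<in> X0" unfolding e by (rule pair_spanI) (use a in simp_all)
      then show "f \<in> {rm (cv (cm gi * w)) | w. w \<in> X0 \<and> cm K * w = 0}" using w by blast
    next
      fix f assume "f \<in> {rm (cv (cm gi * w)) | w. w \<in> X0 \<and> cm K * w = 0}"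
      then obtain w where w: "w \<in> X0" "f = rm (cv (cm gi * w))" by blast
      from w(1) obtain a c where a: "rws q a" "cls 1 a" "rws m c" "cls 1 c" "w = U * a + cm E * c" by (rule pair_spanE)
      have "w = U2 * a + cm E * (c + cm G * (U * a))" unfolding a(5) U2_a by (simp add: distrib_left)
      then have "f = rm (cv (cm gi * (U2 * a)))" using rmE w(2) by simp
      moreover have "U2 * a \<in> Pt b \<tau>" using pair_spanI[of q a m 0 U2 "Vt b \<tau>"] a by simp
      moreover have "cm K * (U2 * a) = 0" by (simp add: mult_assoc_eq[OF KU2])
      ultimately show "f \<in> {rm (cv (cm gi * w)) | w. w \<in> Pt b \<tau> \<and> cm K * w = 0}" by blast
    qed
    then show ?thesis using proj[of "Pt b \<tau>"] proj[of X0] Pt_props[OF b] X0_props by simp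
  qed
  \<comment> \<open>\<open>t0\<close> bounds each column sum of \<open>T\<close> in absolute value,
    so a nonzero integer among the lower coordinates forces \<open>1 \<le> t0^2 * S\<close> for the
    squared length \<open>S\<close> of \<open>c\<close>. The choice of \<tau> below then makes the
    form at least \<open>\<bar>Kc\<bar> + 1\<close>; the summand 1 in \<open>t0\<close> keeps \<tau>
    positive.\<close>
  define t0 where "t0 = 1 + (\<Sum>i<n - q'. \<Sum>l<m. \<bar>entry T l i\<bar>)"
  have t0: "t0 \<ge> 1" unfolding t0_def by (simp add: sum_nonneg)
  define \<tau> where "\<tau> = (\<bar>Kc\<bar> + 1) * t0\<^sup>2"
  have \<tau>: "\<tau> > 0" using t0 by (simp add: \<tau>_def)
  have bound: "Hf n v \<ge> Kc"
    if v: "v \<in> cv ` ((\<lambda>v. cm gi * v) ` Pt b \<tau>)" and j0: "q' \<le> j0" "j0 < n" "mm j0 \<noteq> 0"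
      and mm: "\<forall>j. q' \<le> j \<and> j < n \<longrightarrow> v (n + j) = of_int (mm j)" for v j0 and mm :: "nat \<Rightarrow> int"
  proof -
    from v obtain w where w: "w \<in> Pt b \<tau>" "v = cv (cm gi * w)" by blast
    from w(1) obtain a c where a: "rws q a" "cls 1 a" "rws m c" "cls 1 c" "w = U2 * a + Vt b \<tau> * c" by (rule pair_spanE)
    define S where "S = (\<Sum>i<m. (cmod (entry c i 0))\<^sup>2)"
    have S0: "S \<ge> 0" by (simp add: S_def sum_nonneg)
    have cl: "cmod (entry c l 0) \<le> sqrt S" if "l < m" for l
    proof -
      have "(cmod (entry c l 0))\<^sup>2 \<le> S" unfolding S_def using that by (intro member_le_sum) auto
      then show ?thesis by (rule real_le_rsqrt)
    qed
    have "of_int (mm j0) = entry (tr (cm T) * c) (j0 - q') 0"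
      using mm j0 low[OF j0(1,2), of w] KPt[OF a(3), of a \<tau>] unfolding w(2) a(5) by simp
    also have "\<dots> = (\<Sum>l<m. of_real (entry T l (j0 - q')) * entry c l 0)"
      using a(3) by (subst entry_times[of m]) auto
    finally have "cmod (of_int (mm j0)) \<le> (\<Sum>l<m. cmod (of_real (entry T l (j0 - q')) * entry c l 0))"
      using norm_sum by metis
    also have "\<dots> \<le> (\<Sum>l<m. \<bar>entry T l (j0 - q')\<bar> * sqrt S)"
      by (intro sum_mono) (auto simp: norm_mult intro!: mult_left_mono cl)
    also have "\<dots> = (\<Sum>l<m. \<bar>entry T l (j0 - q')\<bar>) * sqrt S" by (simp add: sum_distrib_right)
    also have "\<dots> \<le> t0 * sqrt S"
    proof (rule mult_right_mono)
      have "(\<Sum>l<m. \<bar>entry T l (j0 - q')\<bar>) \<le> (\<Sum>i<n - q'. \<Sum>l<m. \<bar>entry T l i\<bar>)"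
        using j0 by (intro member_le_sum[of "j0 - q'" _ "\<lambda>i. \<Sum>l<m. \<bar>entry T l i\<bar>"]) (auto intro!: sum_nonneg)
      then show "(\<Sum>l<m. \<bar>entry T l (j0 - q')\<bar>) \<le> t0" by (simp add: t0_def)
    qed (use S0 in simp)
    finally have "cmod (of_int (mm j0)) \<le> t0 * sqrt S" .
    moreover have "1 \<le> cmod (of_int (mm j0) :: complex)" using j0(3) by simp
    ultimately have "1 \<le> t0 * sqrt S" by linarith
    then have "1\<^sup>2 \<le> (t0 * sqrt S)\<^sup>2" by (intro power_mono) auto
    then have one: "1 \<le> t0\<^sup>2 * S" using S0 by (simp add: power_mult_distrib)
    have wd: "rws (2*n) (cm gi * w)" by simp
    have "Hf n v = herm n w" unfolding w(2) Hf_cv[OF wd] by (rule herm_symplectic[OF gip(5)])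
    also have "\<dots> = herm n (U * a) + \<tau> * (S + (\<Sum>i<m. (cmod (entry (tr (cm b) * c) i 0))\<^sup>2))"
      unfolding a(5) S_def by (rule herm_U2V[OF b a(3,4)])
    also have "\<dots> \<ge> \<tau> * S"
    proof -
      have "\<tau> * S \<le> \<tau> * (S + (\<Sum>i<m. (cmod (entry (tr (cm b) * c) i 0))\<^sup>2))"
        using \<tau> by (intro mult_left_mono) (auto intro!: sum_nonneg)
      then show ?thesis using herm_U_nonneg[OF a(1,2)] by linarith
    qed
    finally have "\<tau> * S \<le> Hf n v" .
    moreover have "\<tau> * S = (\<bar>Kc\<bar> + 1) * (t0\<^sup>2 * S)" by (simp add: \<tau>_def)
    moreover have "(\<bar>Kc\<bar> + 1) * 1 \<le> (\<bar>Kc\<bar> + 1) * (t0\<^sup>2 * S)" using one by (intro mult_left_mono) auto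
    ultimately have "\<bar>Kc\<bar> + 1 \<le> Hf n v" by (metis mult_1_right order_trans)
    then show ?thesis by linarith
  qed
  obtain Z where "Z \<in> siegel n" "cv ` ((\<lambda>v. cm gi * v) ` Pt b \<tau>) = embZ n Z"
    using Pt_embZ[OF b \<tau> nq gid gip(5)] by blast
  then have "cv ` ((\<lambda>v. cm gi * v) ` Pt b \<tau>) \<in> hbar n" by (simp add: hbar_def)
  then have "cv ` ((\<lambda>v. cm gi * v) ` Pt b \<tau>) \<in> Ustd n q' V Kc"
    unfolding Ustd_def using projeq pr W bound unfolding gi_def by blast
  then show ?thesis using \<tau> unfolding gi_def by blast
qed

end

text \<open>L is intrinsic to the point, being the set of null vectors of the Hermitian form on it.
  The transition matrix is real because it equals \<open>A.G * E'\<close>.\<close>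

lemma same_isotropic:
  assumes "boundary_point n m E F q U c" "boundary_point n m' E' F' q' U' c'"
    and eq: "pair_span U q (cm E) m = pair_span U' q' (cm E') m'"
  obtains T where "E' = E * T" "rws m T" "cls m' T"
proof -
  interpret A: boundary_point n m E F q U c by fact
  interpret B: boundary_point n m' E' F' q' U' c' by fact
  have "\<exists>a c. rws m a \<and> rws 0 c \<and> cm E' * unit_fmat j 0 = cm E * a + 0 * c" if "j < m'" for j
  proof -
    have "cm E' * unit_fmat j 0 \<in> B.X0" by (rule B.E_in_X0) (use that in auto)
    then have "cm E' * unit_fmat j 0 \<in> A.X0" using eq by simp
    then obtain c where "rws m c" "cm E' * unit_fmat j 0 = cm E * c" using A.X0_null B.herm_E by blast
    then show ?thesis by (intro exI[of _ c] exI[of _ 0]) simp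
  qed
  moreover have "cls m' (cm E')" by simp
  ultimately obtain k where k: "rws m k" "cls m' k" "cm E' = cm E * k"
    using matrix_by_columns[of m' "cm E'" m 0 "cm E" 0] by (metis add.right_neutral mult_zero_left)
  have "cm A.G * cm E' = k" unfolding k(3) using k by (simp add: mult_assoc_eq[OF A.frame_c(3)])
  then have "cm E' = cm (E * (A.G * E'))" using k(3) by simp
  then have "E' = E * (A.G * E')" by (simp only: cm_inject)
  then show ?thesis using that[of "A.G * E'"] by simp
qed

lemma symplectic_fmat:
  assumes "zero_outside (2*n) (2*n) g"
  shows "symplectic n g \<longleftrightarrow> tr (mk (2*n) (2*n) g) * Jm n * mk (2*n) (2*n) g = Jm n"
proof -
  let ?g = "mk (2*n) (2*n) g"
  have e: "entry (tr ?g * Jm n * ?g) i j = (\<Sum>k<2*n. \<Sum>l<2*n. g k i * Jmat n k l * g l j)" if ij: "i < 2*n" "j < 2*n" for i j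
  proof -
    have "entry (tr ?g * Jm n * ?g) i j = (\<Sum>l<2*n. entry (tr ?g * Jm n) i l * entry ?g l j)"
      by (rule entry_times) simp
    also have "\<dots> = (\<Sum>l<2*n. (\<Sum>k<2*n. g k i * Jmat n k l) * g l j)"
    proof (rule sum.cong)
      fix l assume l: "l \<in> {..<2*n}"
      have "entry (tr ?g * Jm n) i l = (\<Sum>k<2*n. entry (tr ?g) i k * entry (Jm n) k l)" by (rule entry_times) simp
      also have "\<dots> = (\<Sum>k<2*n. g k i * Jmat n k l)" by (rule sum.cong) (use ij in \<open>auto simp: entry_Jm\<close>)
      finally show "entry (tr ?g * Jm n) i l * entry ?g l j = (\<Sum>k<2*n. g k i * Jmat n k l) * g l j"
        using l ij by simp
    qed simp
    also have "\<dots> = (\<Sum>l<2*n. \<Sum>k<2*n. g k i * Jmat n k l * g l j)" by (simp add: sum_distrib_right)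
    also have "\<dots> = (\<Sum>k<2*n. \<Sum>l<2*n. g k i * Jmat n k l * g l j)" by (rule sum.swap)
    finally show ?thesis .
  qed
  show ?thesis
  proof
    assume s: "symplectic n g"
    show "tr ?g * Jm n * ?g = Jm n"
    proof (rule fmat_eqI)
      fix i j
      show "entry (tr ?g * Jm n * ?g) i j = entry (Jm n) i j"
      proof (cases "i < 2*n \<and> j < 2*n")
        case True
        then show ?thesis using s e by (simp add: symplectic_def entry_Jm)
      next
        case False
        moreover have "rws (2*n) (tr ?g * Jm n * ?g)" "cls (2*n) (tr ?g * Jm n * ?g)" by simp_all
        ultimately show ?thesis using Jm_dims(1,2)[of n] unfolding rws_def cls_def by (metis not_le)
      qed
    qed
  next
    assume r: "tr ?g * Jm n * ?g = Jm n"
    then have "(\<Sum>k<2*n. \<Sum>l<2*n. g k i * Jmat n k l * g l j) = Jmat n i j" if "i < 2*n" "j < 2*n" for i j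
      using e[OF that] by (simp add: entry_Jm)
    then show "symplectic n g" using assms by (simp add: symplectic_def)
  qed
qed

text \<open>A basic neighbourhood may be presented through any \<open>g\<close> and
  \<open>q'\<close> whose component contains the point. \<open>same_isotropic\<close> compares this
  presentation with the given frame, and \<open>Pt_in_Ustd\<close> then supplies a fixed point
  inside it.\<close>

lemma (in boundary_point) boundary_in_closure:
  assumes t: "rws (2*n) t" "cls (2*n) t" and anti: "tr t * Jm n * t = - Jm n" and tt: "t * t = idm (2*n)"
    and tE: "t * E = E * b" and tF: "t * F = - (F * tr b)" and b: "rws m b" "cls m b" and bb: "b * b = idm m"
    and tX: "\<And>v. v \<in> X0 \<Longrightarrow> cj (cm t * v) \<in> X0" and nq: "q < n" "m = n - q"
    and x: "cv ` X0 \<in> hbar n"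
  shows "cv ` X0 \<in> satake_closure n (embZ n ` hfix n (entry (eps n * t)))"
  unfolding satake_closure_def
proof (intro CollectI conjI x allI impI)
  fix O' assume O': "satake_open n O' \<and> cv ` X0 \<in> O'"
  then obtain N where N: "basic_nbhd n (cv ` X0) N" "N \<subseteq> O'" unfolding satake_open_def by blast
  have cvinj: "S = S'" if "cv ` S = cv ` S'" "\<And>v. v \<in> S \<Longrightarrow> cls 1 v" "\<And>v. v \<in> S' \<Longrightarrow> cls 1 v" for S S'
  proof -
    have "inj_on cv (S \<union> S')" using that(2,3) cv_inject by (intro inj_onI) blast
    then show ?thesis using that(1) by (simp add: inj_on_Un_image_eq_iff)
  qed
  from N(1) consider
    (interior) Z where "Z \<in> siegel n" "cv ` X0 = embZ n Z"
  | (boundary) g q' V Kc where "g \<in> SpQ n" "q' < n" "cv ` X0 \<in> act n g ` Fstd n q'"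
      "cv ` X0 \<in> act n g ` Ustd n q' V Kc" "N = act n g ` Ustd n q' V Kc"
    unfolding basic_nbhd_def by blast
  then show "O' \<inter> embZ n ` hfix n (entry (eps n * t)) \<noteq> {}"
  proof cases
    case interior
    \<comment> \<open>A point of the half space has no nonzero null vector, but the first column of
      \<open>E\<close> is one; it exists because \<open>q < n\<close>.\<close>
    have "cm E * unit_fmat 0 0 \<in> X0" by (rule E_in_X0) (use nq in auto)
    then have "cv (cm E * unit_fmat 0 0) \<in> cv ` col_span (stk n (zm n Z)) n" using interior(2) unfolding embZ_cv by blast
    then obtain a where a: "rws n a" "cls 1 a" "cv (cm E * unit_fmat 0 0) = cv (stk n (zm n Z) * a)" by (auto elim!: col_spanE)
    then have e: "cm E * unit_fmat 0 0 = stk n (zm n Z) * a" by (intro cv_inject) auto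
    have "a \<noteq> 0"
    proof
      assume "a = 0"
      then have "cm G * (cm E * unit_fmat 0 0) = 0" using e by simp
      then have "unit_fmat 0 0 = (0 :: complex fmat)" using nq by (simp add: mult_assoc_eq[OF frame_c(3)])
      then have "entry (unit_fmat 0 0 :: complex fmat) 0 0 = 0" by simp
      then show False by simp
    qed
    then have "herm n (stk n (zm n Z) * a) > 0" using siegel_herm_pos[OF interior(1) a(1,2)] by simp
    then show ?thesis using e herm_E[of "unit_fmat 0 0"] by simp
  next
    case (boundary gf q' V Kc)
    define g where "g = mk (2*n) (2*n) gf"
    have gd [simp]: "rws (2*n) g" "cls (2*n) g" by (simp_all add: g_def)
    have gJ: "tr g * Jm n * g = Jm n"
      using boundary(1) symplectic_fmat[of n gf] by (simp add: SpQ_def symplectic_def g_def)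
    have q': "q' \<le> n" using boundary(2) by simp
    obtain W' where W': "W' \<in> siegel q'" "cv ` X0 = act n gf (colspace n (Mq n q' W'))"
      using boundary(3) by (auto simp: Fstd_def)
    let ?U = "cm g * cm (Sq n q') * stk q' (zm q' W')"
    have "cv ` X0 = cv ` pair_span ?U q' (cm (g * Eq n q')) (n - q')"
      unfolding W'(2) by (rule boundary_cv[OF q' W'(1)]) (simp add: g_def)
    then have XX: "X0 = pair_span ?U q' (cm (g * Eq n q')) (n - q')"
      by (rule cvinj) (auto elim!: pair_spanE)
    have gJ': "tr g * (Jm n * (g * X)) = Jm n * X" for X using gJ by (simp add: mult.assoc[symmetric])
    have fr: "frame n (n - q') (g * Eq n q') (g * Fq n q')"
      using std_relations(1-3)[OF q'] by unfold_locales (simp_all add: mult.assoc gJ')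
    obtain c' where bp: "boundary_point n (n - q') (g * Eq n q') (g * Fq n q') q' ?U c'"
      using boundary_point_std[OF gd gJ q' W'(1) fr, of "idm (n - q')" "idm (n - q')"] by (auto simp: mult.assoc)
    have self: "boundary_point n m E F q U c0" by unfold_locales
    obtain T where T: "g * Eq n q' = E * T" "rws m T" "cls (n - q') T"
      using same_isotropic[OF self bp XX] by blast
    obtain T' where T': "E = g * Eq n q' * T'" "rws (n - q') T'" "cls m T'"
      using same_isotropic[OF bp self XX[symmetric]] by blast
    \<comment> \<open>The neighbourhood is known only through some \<open>Q\<close> that
      \<open>g\<close> maps to the point. Inverting \<open>g\<close> shows that \<open>Q\<close> is
      the translate of \<open>X0\<close>, so the membership of its projection in \<open>V\<close>
      becomes a statement about \<open>X0\<close>.\<close>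
    obtain Q where Q: "Q \<in> Ustd n q' V Kc" "cv ` X0 = act n gf Q" using boundary(4) by blast
    note gi = symp_inv[OF gd gJ]
    have gic: "cm (symp_inv n g) * (cm g * v) = v" "cm g * (cm (symp_inv n g) * v) = v" if "rws (2*n) v" for v
      using that arg_cong[OF gi(3), of cm] arg_cong[OF gi(4), of cm] by (simp_all add: mult.assoc[symmetric])
    define S where "S = (\<lambda>v. mk (2*n) 1 (\<lambda>i j. v i)) ` Q"
    have QS: "Q = cv ` S"
    proof -
      have "cv (mk (2*n) 1 (\<lambda>i j. v i)) = v" if "v \<in> Q" for v
        using hbar_dims[of Q n v] Q(1) that by (auto simp: cv_def Ustd_def)
      then show ?thesis unfolding S_def image_image by (auto simp: image_iff)
    qed
    have Sd: "rws (2*n) v" "cls 1 v" if "v \<in> S" for v using that by (auto simp: S_def)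
    have "cv ` X0 = cv ` ((\<lambda>v. cm g * v) ` S)"
      unfolding Q(2) QS g_def by (rule act_cv) (use Sd in auto)
    then have "X0 = (\<lambda>v. cm g * v) ` S"
      by (rule cvinj) (use Sd X0_props in auto)
    then have "(\<lambda>v. cm (symp_inv n g) * v) ` X0 = S"
      using Sd gic by (force simp: image_image)
    then have "Q = cv ` ((\<lambda>v. cm (symp_inv n g) * v) ` X0)" using QS by simp
    then obtain W where W: "W \<in> V" "projset n q' (cv ` ((\<lambda>v. cm (symp_inv n g) * v) ` X0)) = embZ q' W"
      using Q(1) by (auto simp: Ustd_def)
    obtain \<tau> where \<tau>: "\<tau> > 0" "cv ` ((\<lambda>v. cm (symp_inv n g) * v) ` Pt b \<tau>) \<in> Ustd n q' V Kc"
      using Pt_in_Ustd[OF b less_imp_le[OF nq(1)] nq(2) q' gd gJ T T' W(2,1)] by blast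
    have "act n gf (cv ` ((\<lambda>v. cm (symp_inv n g) * v) ` Pt b \<tau>)) = cv ` ((\<lambda>v. cm g * v) ` ((\<lambda>v. cm (symp_inv n g) * v) ` Pt b \<tau>))"
      unfolding g_def by (rule act_cv) (use gi(1) g_def in auto)
    also have "(\<lambda>v. cm g * v) ` ((\<lambda>v. cm (symp_inv n g) * v) ` Pt b \<tau>) = Pt b \<tau>"
      using gic(2) Pt_props[OF b] by (force simp: image_image)
    finally have "cv ` Pt b \<tau> \<in> N" unfolding boundary(5) using \<tau>(2) by (metis image_eqI)
    moreover have "cv ` Pt b \<tau> \<in> embZ n ` hfix n (entry (eps n * t))"
      by (rule Pt_hfix[OF t anti tt tE tF b bb tX \<tau>(1) less_imp_le[OF nq(1)] nq(2)])
    ultimately show ?thesis using N(2) by blast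
  qed
qed

text \<open>Both \<open>s\<close> and conjugation reverse the sign of the form, so \<open>s\<close>
  followed by conjugation preserves the null vectors of the point, which make up L. The same for the
  inverse of \<open>s\<close> gives \<open>a'\<close>.\<close>

lemma fixed_boundary_relations:
  assumes bp: "boundary_point n m E F q U c0"
    and s [simp]: "rws (2*n) s" "cls (2*n) s" and anti: "tr s * Jm n * s = - Jm n"
    and fx: "(\<lambda>v. cm s * v) ` pair_span U q (cm E) m = cj ` pair_span U q (cm E) m"
  obtains a a' k l where "rws m a" "cls m a" "s * E = E * a" "rws m a'" "cls m a'" "E = s * E * a'"
    "rws q k" "cls q k" "cm s * U = cj U * k + cm E * l"
proof -
  interpret boundary_point n m E F q U c0 by fact
  have inX: "\<exists>w\<in>X0. cm s * v = cj w" if "v \<in> X0" for v using fx that by blast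
  have inX': "\<exists>w\<in>X0. cj v = cm s * w" if "v \<in> X0" for v using fx that by blast
  have "\<exists>a c. rws m a \<and> rws 0 c \<and> (cm s * cm E) * unit_fmat j 0 = cm E * a + 0 * c" if "j < m" for j
  proof -
    have "cm E * unit_fmat j 0 \<in> X0" by (rule E_in_X0) (use that in auto)
    then obtain w where w: "w \<in> X0" "cm s * (cm E * unit_fmat j 0) = cj w" using inX by blast
    have "herm n (cj w) = 0" unfolding w(2)[symmetric] herm_anti[OF anti] by (simp add: herm_E)
    then obtain c where c: "rws m c" "w = cm E * c" using X0_null[OF w(1)] by (auto simp: herm_cj)
    have "(cm s * cm E) * unit_fmat j 0 = cm E * cj c + 0 * 0" using w(2) c(2) by (simp add: mult.assoc)
    then show ?thesis using c by (intro exI[of _ "cj c"] exI[of _ 0]) simp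
  qed
  moreover have "cls m (cm s * cm E)" by simp
  ultimately obtain A where A: "rws m A" "cls m A" "cm s * cm E = cm E * A"
    using matrix_by_columns[of m "cm s * cm E" m 0 "cm E" 0] by (metis add.right_neutral mult_zero_left)
  have "cm (G * s * E) = A" using A by (simp add: mult.assoc mult_assoc_eq[OF frame_c(3)])
  then have "cm (s * E) = cm (E * (G * s * E))" using A(3) by simp
  then have a: "s * E = E * (G * s * E)" by (simp only: cm_inject)
  have inv: "Jm n * tr s * Jm n * s = idm (2*n)" by (rule anti_inverse[OF s anti])
  define si where "si = Jm n * tr s * Jm n"
  have sid: "rws (2*n) si" "cls (2*n) si" by (simp_all add: si_def)
  have sis: "si * s = idm (2*n)" "s * si = idm (2*n)"
    using inv left_inverse_right[OF s sid] by (simp_all add: si_def)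
  have sic: "cm si * (cm s * v) = v" if "rws (2*n) v" for v
    using arg_cong[OF sis(1), of cm] that by (simp add: mult.assoc[symmetric])
  have "\<exists>a c. rws m a \<and> rws 0 c \<and> (cm si * cm E) * unit_fmat j 0 = cm E * a + 0 * c" if "j < m" for j
  proof -
    have "cm E * unit_fmat j 0 \<in> X0" by (rule E_in_X0) (use that in auto)
    moreover have "cj (cm E * unit_fmat j 0) = cm E * cj (unit_fmat j 0)" by simp
    moreover have "cj (unit_fmat j 0) = unit_fmat j 0" by (auto intro!: fmat_eqI)
    ultimately obtain w where w: "w \<in> X0" "cm E * unit_fmat j 0 = cm s * w" using inX' by metis
    have "- herm n w = herm n (cm E * unit_fmat j 0)" unfolding w(2) herm_anti[OF anti] ..
    then have "herm n w = 0" by (simp add: herm_E)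
    then obtain c where c: "rws m c" "w = cm E * c" using X0_null[OF w(1)] by auto
    have "(cm si * cm E) * unit_fmat j 0 = cm E * c"
      using w(2) c(2) sic[of w] X0_props(1)[OF w(1)] by (simp add: mult.assoc)
    then show ?thesis using c by (intro exI[of _ c] exI[of _ 0]) simp
  qed
  moreover have "cls m (cm si * cm E)" by simp
  ultimately obtain A' where A': "rws m A'" "cls m A'" "cm si * cm E = cm E * A'"
    using matrix_by_columns[of m "cm si * cm E" m 0 "cm E" 0] by (metis add.right_neutral mult_zero_left)
  have "cm (G * si * E) = A'" using A' by (simp add: mult.assoc mult_assoc_eq[OF frame_c(3)])
  then have "cm (si * E) = cm (E * (G * si * E))" using A'(3) by simp
  then have "si * E = E * (G * si * E)" by (simp only: cm_inject)
  then have "s * (si * E) = s * E * (G * si * E)" by (simp only: mult.assoc)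
  then have a': "E = s * E * (G * si * E)" by (simp add: mult_assoc_eq[OF sis(2)])
  have "\<exists>a c. rws q a \<and> rws m c \<and> (cm s * U) * unit_fmat j 0 = cj U * a + cm E * c" if "j < q" for j
  proof -
    have "U * unit_fmat j 0 \<in> X0" by (rule U_in_X0) (use that in auto)
    then obtain w where w: "w \<in> X0" "cm s * (U * unit_fmat j 0) = cj w" using inX by blast
    from w(1) obtain a c where ac: "rws q a" "cls 1 a" "rws m c" "cls 1 c" "w = U * a + cm E * c" by (rule pair_spanE)
    have "(cm s * U) * unit_fmat j 0 = cj U * cj a + cm E * cj c" using w(2) ac(5) by (simp add: mult.assoc)
    then show ?thesis using ac by (intro exI[of _ "cj a"] exI[of _ "cj c"]) simp
  qed
  moreover have "cls q (cm s * U)" by simp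
  ultimately obtain k l where "rws q k" "cls q k" "cm s * U = cj U * k + cm E * l"
    using matrix_by_columns[of q "cm s * U" q m "cj U" "cm E"] by blast
  then show ?thesis using that[OF _ _ a _ _ a'] by simp
qed

lemma Ffix_iff:
  assumes S: "\<And>v. v \<in> S \<Longrightarrow> rws (2*n) v \<and> cls 1 v" and g: "rws (2*n) g" "cls (2*n) g"
  shows "tauP n (cv ` S) = act n (entry (eps n * g)) (cv ` S) \<longleftrightarrow> (\<lambda>v. cm g * v) ` S = cj ` S"
proof -
  have t: "tauP n (cv ` S) = cv ` ((\<lambda>v. cm (eps n) * v) ` (cj ` S))"
    by (subst tauP_cv) (use S in \<open>auto simp: image_image\<close>)
  have a: "act n (entry (eps n * g)) (cv ` S) = cv ` ((\<lambda>v. cm (eps n) * v) ` ((\<lambda>v. cm g * v) ` S))"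
  proof -
    have "mk (2*n) (2*n) (entry (eps n * g)) = eps n * g" by (rule mk_entry) (use g in auto)
    then show ?thesis by (subst act_cv) (use S in \<open>auto simp: image_image mult.assoc\<close>)
  qed
  have i: "inj_on (\<lambda>v. cv (cm (eps n) * v)) {v. rws (2*n) v \<and> cls 1 v}"
  proof (rule inj_onI)
    fix v w assume v: "v \<in> {v. rws (2*n) v \<and> cls 1 v}" and w: "w \<in> {v. rws (2*n) v \<and> cls 1 v}"
      and e: "cv (cm (eps n) * v) = cv (cm (eps n) * w)"
    have "cm (eps n) * v = cm (eps n) * w" by (rule cv_inject[OF _ _ e]) (use v w in auto)
    then have "cm (eps n) * (cm (eps n) * v) = cm (eps n) * (cm (eps n) * w)" by simp
    then show "v = w" using v w by (simp add: cm_eps_eps_mult)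
  qed
  have "tauP n (cv ` S) = act n (entry (eps n * g)) (cv ` S) \<longleftrightarrow>
    (\<lambda>v. cv (cm (eps n) * v)) ` (cj ` S) = (\<lambda>v. cv (cm (eps n) * v)) ` ((\<lambda>v. cm g * v) ` S)"
    unfolding t a image_image ..
  also have "\<dots> \<longleftrightarrow> cj ` S = (\<lambda>v. cm g * v) ` S"
    by (rule inj_on_image_eq_iff[OF i]) (use S g in auto)
  finally show ?thesis by blast
qed

theorem theorem10p5:
  fixes n k :: nat and F :: "(nat \<Rightarrow> complex) set set" and \<gamma> :: "nat \<Rightarrow> nat \<Rightarrow> real"
  assumes "k \<ge> 2"
    and "is_bcomp n F"
    and "\<gamma> \<in> Gamma n (2 ^ k)"
    and "Ffix n F \<gamma> \<noteq> {}"
  shows "\<exists>\<gamma>1 \<in> Gamma n (2 ^ k). Ffix n F \<gamma> = Ffix n F \<gamma>1 \<and>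
           Ffix n F \<gamma>1 \<subseteq> satake_closure n (embZ n ` hfix n \<gamma>1)"
proof -
  obtain gf q where gf: "gf \<in> SpQ n" and q: "q < n" and F: "F = act n gf ` Fstd n q"
    using assms(2) by (auto simp: is_bcomp_def)
  have qn: "q \<le> n" using q by simp
  define m where "m = n - q"
  define g where "g = mk (2*n) (2*n) gf"
  have gd [simp]: "rws (2*n) g" "cls (2*n) g" by (simp_all add: g_def)
  have gJ: "tr g * Jm n * g = Jm n"
    using gf symplectic_fmat[of n gf] by (simp add: SpQ_def symplectic_def g_def)
  have gJ': "tr g * (Jm n * (g * X)) = Jm n * X" for X using gJ by (simp add: mult.assoc[symmetric])
  \<comment> \<open>This basis of L is only rational; the saturated basis \<open>E\<close> below
    spans the same space and carries the congruences.\<close>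
  define Er where "Er = g * Eq n q"
  have Erd: "rws (2*n) Er" "cls m Er" by (simp_all add: Er_def m_def)
  note std = std_relations[OF qn, unfolded mult.assoc, folded m_def]
  have ErJ: "tr Er * (Jm n * Er) = 0" using std(1) by (simp add: Er_def mult.assoc gJ')
  have "frame n m Er (g * Fq n q)"
    using std(1-3) by unfold_locales (simp_all add: Er_def m_def mult.assoc gJ')
  then have left: "- (tr (g * Fq n q) * Jm n) * Er = idm m"
    using frame.GE frame.G_def by metis
  have rat: "entry Er i j \<in> \<rat>" for i j
    unfolding Er_def by (rule rational_mult) (use gf in \<open>auto simp: g_def SpQ_def Eq_def entry_sel\<close>)
  obtain E G T T' where E: "rws (2*n) E" "cls m E" "rws m G" "cls (2*n) G" "dvm 1 E" "dvm 1 G" "G * E = idm m"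
    "Er = E * T" "E = Er * T'" "rws m T" "cls m T" "rws m T'" "cls m T'"
    using saturated_basis[OF Erd left rat] by blast
  have "tr E * Jm n * E = tr T' * (tr Er * (Jm n * Er)) * T'" by (subst (1 2) E(9)) (simp add: mult.assoc)
  then have EJE: "tr E * Jm n * E = 0" by (simp add: ErJ)
  obtain Ff where fr: "frame n m E Ff" and Fi: "dvm 1 Ff"
    using frame_extension[OF E(1,2) EJE E(5) E(3,4,6,7)] by blast
  have EE: "pair_span U q (cm Er) m = pair_span U q (cm E) m" for U
  proof (intro equalityI subsetI)
    fix v assume "v \<in> pair_span U q (cm Er) m"
    then obtain a c where a: "rws q a" "cls 1 a" "rws m c" "cls 1 c" "v = U * a + cm Er * c" by (rule pair_spanE)
    have e: "v = U * a + cm E * (cm T * c)" using a(5) E(8) by (simp add: mult.assoc)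
    show "v \<in> pair_span U q (cm E) m" unfolding e by (rule pair_spanI) (use a E(10) in auto)
  next
    fix v assume "v \<in> pair_span U q (cm E) m"
    then obtain a c where a: "rws q a" "cls 1 a" "rws m c" "cls 1 c" "v = U * a + cm E * c" by (rule pair_spanE)
    have e: "v = U * a + cm Er * (cm T' * c)" using a(5) arg_cong[OF E(9), of cm] by (simp add: mult.assoc)
    show "v \<in> pair_span U q (cm Er) m" unfolding e by (rule pair_spanI) (use a E(12) in auto)
  qed
  \<comment> \<open>\<open>U\<close> is chosen before the complement \<open>F2\<close>: the same
    point is used with the integral complement \<open>Ff\<close> and later with one stable under
    \<open>t\<close>.\<close>
  have pts: "\<exists>U. x = cv ` pair_span U q (cm E) m \<and> (\<forall>F2. frame n m E F2 \<longrightarrow> (\<exists>c. boundary_point n m E F2 q U c))"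
    if xF: "x \<in> F" for x
  proof -
    obtain W where W: "W \<in> siegel q" "x = act n gf (colspace n (Mq n q W))"
      using xF unfolding F Fstd_def by auto
    let ?U = "cm g * cm (Sq n q) * stk q (zm q W)"
    have "x = cv ` pair_span ?U q (cm Er) m"
      unfolding W(2) Er_def m_def by (rule boundary_cv[OF qn W(1)]) (simp add: g_def)
    then have "x = cv ` pair_span ?U q (cm E) m" by (simp add: EE)
    moreover have "\<exists>c. boundary_point n m E F2 q ?U c" if "frame n m E F2" for F2
      unfolding m_def
      by (rule boundary_point_std[OF gd gJ qn W(1) that[unfolded m_def] E(8)[unfolded Er_def] E(9)[unfolded Er_def]])
    ultimately show ?thesis by blast
  qed
  define gm where "gm = mk (2*n) (2*n) \<gamma>"
  have gmd [simp]: "rws (2*n) gm" "cls (2*n) gm" by (simp_all add: gm_def)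
  have z\<gamma>: "zero_outside (2*n) (2*n) \<gamma>" using assms(3) by (simp add: Gamma_def SpZ_def symplectic_def)
  have gmJ: "tr gm * Jm n * gm = Jm n"
    using assms(3) symplectic_fmat[OF z\<gamma>] by (simp add: Gamma_def SpZ_def gm_def)
  have e\<gamma>: "entry gm = \<gamma>" unfolding gm_def using z\<gamma>
    by (intro ext) (auto simp: zero_outside_def)
  \<comment> \<open>The lifting lemmas use the moduli \<open>2 * 2^j\<close> and
    \<open>4 * 2^j\<close>; with this shift they are \<open>2^k\<close> and
    \<open>2^(k+1)\<close>.\<close>
  define j where "j = k - 1"
  have j: "k = Suc j" using assms(1) by (simp add: j_def)
  define N where "N = (2 * 2 ^ j :: real)"
  have gmN: "dvm N (gm - idm (2*n))"
    unfolding dvm_def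
  proof (intro allI)
    fix x y
    show "\<exists>z::int. entry (gm - idm (2*n)) x y = N * of_int z"
    proof (cases "x < 2*n \<and> y < 2*n")
      case True
      then obtain z :: int where "\<gamma> x y - (if x = y then 1 else 0) = of_int (2 ^ k * z)"
        using assms(3) by (auto simp: Gamma_def)
      then show ?thesis using True by (intro exI[of _ z]) (simp add: gm_def N_def j)
    next
      case False
      then show ?thesis by (intro exI[of _ 0]) (auto simp: gm_def)
    qed
  qed
  define s where "s = eps n * gm"
  have sd [simp]: "rws (2*n) s" "cls (2*n) s" by (simp_all add: s_def)
  have epss: "eps n * s = gm" by (simp add: s_def eps_eps_mult)
  have anti: "tr s * Jm n * s = - Jm n"
  proof -
    have "tr s * Jm n * s = tr gm * (eps n * Jm n * eps n) * gm" by (simp add: s_def mult.assoc)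
    then show ?thesis using gmJ by (simp add: eps_J_eps)
  qed
  have s_eps: "s - eps n = eps n * (gm - idm (2*n))" by (simp add: s_def right_diff_distrib)
  obtain X where X: "dvm 1 X" "gm - idm (2*n) = scl N X" using dvm_ex[OF gmN] by blast
  have Xd [simp]: "rws (2*n) X" "cls (2*n) X"
  proof -
    have "X = scl (1 / N) (gm - idm (2*n))" by (simp add: X(2) N_def)
    then show "rws (2*n) X" "cls (2*n) X" by simp_all
  qed
  define Y where "Y = eps n * X"
  have Yi: "dvm 1 Y" "rws (2*n) Y" "cls (2*n) Y" using X eps_int by (simp_all add: Y_def)
  have s_eq: "s = eps n + scl N Y" using s_eps X(2) by (simp add: Y_def algebra_simps)
  have s2: "dvm 2 (s - idm (2*n))"
  proof -
    have "dvm (N * 1) (scl N Y)" by (rule dvm_scl[OF Yi(1)])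
    then have "dvm 2 (scl N Y)" using dvm_weaken[of 2 "2 ^ j" "scl N Y"] by (simp add: N_def)
    moreover have "s - idm (2*n) = (eps n - idm (2*n)) + scl N Y" unfolding s_eq by (simp add: algebra_simps)
    ultimately show ?thesis using eps_int(2)[of n] by (metis dvm_simps(2))
  qed
  have ssN: "dvm (4 * 2 ^ j) (s * s - idm (2*n))"
  proof -
    obtain D where D: "dvm 1 D" "eps n - idm (2*n) = scl 2 D" using dvm_ex[OF eps_int(2)] by blast
    have eD: "eps n = idm (2*n) + scl 2 D" using D(2) by (simp add: algebra_simps)
    \<comment> \<open>\<open>eps n\<close> is an involution and 1 mod 2, so the cross term is even
      and one power of 2 is gained over \<open>N\<close>.\<close>
    have "s * s - idm (2*n) = scl N (eps n * Y + Y * eps n) + scl (N * N) (Y * Y)"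
      unfolding s_eq by (simp add: mdistribs scl_distribs eps_eps)
    also have "eps n * Y + Y * eps n = scl 2 (Y + D * Y + Y * D)"
      unfolding eD using Yi by (simp add: mdistribs scl_distribs) (auto intro!: fmat_eqI)
    also have "scl N (scl 2 (Y + D * Y + Y * D)) + scl (N * N) (Y * Y) = scl (4 * 2 ^ j) (Y + D * Y + Y * D + scl (2 ^ j) (Y * Y))"
      by (simp add: scl_distribs N_def mult.commute mult.left_commute)
    also have "dvm (4 * 2 ^ j * 1) \<dots>"
    proof (rule dvm_scl)
      have "dvm (2 ^ j * 1) (scl (2 ^ j) (Y * Y))" by (rule dvm_scl) (simp add: Yi)
      then have "dvm 1 (scl (2 ^ j) (Y * Y))" using dvm_weaken[of 1 "2 ^ j" "scl (2 ^ j) (Y * Y)"] by simp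
      then show "dvm 1 (Y + D * Y + Y * D + scl (2 ^ j) (Y * Y))" using Yi D by simp
    qed
    finally show ?thesis by simp
  qed
  obtain x0 where x0: "x0 \<in> F" "tauP n x0 = act n \<gamma> x0" using assms(4) by (auto simp: Ffix_def)
  obtain U0 c0 where U0: "x0 = cv ` pair_span U0 q (cm E) m" "boundary_point n m E Ff q U0 c0"
    using pts[OF x0(1)] fr by blast
  interpret B: boundary_point n m E Ff q U0 c0 by fact
  have fx0: "(\<lambda>v. cm s * v) ` B.X0 = cj ` B.X0"
  proof -
    have "tauP n (cv ` B.X0) = act n (entry (eps n * s)) (cv ` B.X0)"
      using x0(2) U0(1) by (simp add: epss e\<gamma>)
    then show ?thesis by (subst (asm) Ffix_iff) (use B.X0_props in auto)
  qed
  obtain a a' kk ll where rel: "rws m a" "cls m a" "s * E = E * a" "rws m a'" "cls m a'" "E = s * E * a'"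
    "rws q kk" "cls q kk" "cm s * U0 = cj U0 * kk + cm E * ll"
    using fixed_boundary_relations[OF U0(2) sd anti fx0] by blast
  have "dvm 4 (s * s - idm (2*n))" using ssN dvm_weaken[of 4 "2 ^ j"] by simp
  then obtain l where l: "(s * s - idm (2*n)) * (idm (2*n) - Ff * B.K) = E * l"
    using B.minkowski_trivial[OF sd anti _ E(5) Fi rel(3,9,7,8)] by blast
  obtain t b u where t: "rws (2*n) t" "cls (2*n) t" "tr t * Jm n * t = - Jm n" "t * t = idm (2*n)"
    "dvm (2 * 2 ^ j) (t - s)" "t * E = E * b" "rws m b" "cls m b" "b * b = idm m"
    "t * (idm (2*n) - Ff * B.K) = s * (idm (2*n) - Ff * B.K) + E * u"
    using B.involution_correction[OF sd anti s2 ssN rel(1,2,3,4,5,6) l E(5) Fi] by blast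
  define g1 where "g1 = eps n * t"
  have g1d: "rws (2*n) g1" "cls (2*n) g1" using t by (simp_all add: g1_def)
  have g1N: "dvm N (g1 - idm (2*n))"
  proof -
    have "g1 - idm (2*n) = eps n * (t - s) + (gm - idm (2*n))"
      by (simp add: g1_def right_diff_distrib epss)
    moreover have "dvm N (eps n * (t - s))" using t(5) eps_int(1) by (simp add: N_def)
    ultimately show ?thesis using gmN by (metis dvm_simps(2))
  qed
  have g1i: "dvm 1 g1"
  proof -
    have "dvm 1 (g1 - idm (2*n))" using g1N dvm_weaken[of 1 "2 * 2 ^ j" "g1 - idm (2*n)"] by (simp add: N_def)
    then show ?thesis by (rule dvm_diffD) simp
  qed
  have z1: "zero_outside (2*n) (2*n) (entry g1)" using g1d by (auto simp: zero_outside_def rws_def cls_def)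
  have G1: "entry g1 \<in> Gamma n (2 ^ k)"
  proof -
    have "symplectic n (entry g1)"
      using symplectic_fmat[OF z1] eps_anti_symplectic[OF t(3)] by (simp add: mk_entry[OF g1d]) (simp add: g1_def)
    moreover have "entry g1 x y \<in> \<int>" for x y using g1i unfolding dvm_def by (metis Ints_of_int mult_1)
    moreover have "\<exists>z::int. entry g1 x y - (if x = y then 1 else 0) = of_int (2 ^ k * z)" if "x < 2*n" "y < 2*n" for x y
    proof -
      obtain z :: int where "entry (g1 - idm (2*n)) x y = N * of_int z" using g1N unfolding dvm_def by blast
      then show ?thesis using that by (intro exI[of _ z]) (auto simp: N_def j)
    qed
    ultimately show ?thesis by (auto simp: Gamma_def SpZ_def)
  qed
  \<comment> \<open>Points of the component lie in L^perp, where \<open>t\<close> and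
    \<open>s\<close> differ by vectors of L. Since \<open>s\<close> and \<open>t\<close> both map L
    onto itself, that difference is absorbed by changing the argument within L, which every point
    contains.\<close>
  have same: "(\<lambda>v. cm t * v) ` pair_span U q (cm E) m = (\<lambda>v. cm s * v) ` pair_span U q (cm E) m"
    if bp: "boundary_point n m E Ff q U c" for U c
  proof -
    interpret A: boundary_point n m E Ff q U c by fact
    have p0: "cm (idm (2*n) - Ff * B.K) * v = v" if "v \<in> A.X0" for v
      using A.X0_props[OF that] by (simp add: left_diff_distrib mult.assoc)
    have st: "cm t * v = cm s * v + cm E * (cm u * v)" if "v \<in> A.X0" for v
    proof -
      have "cm t * v = cm (t * (idm (2*n) - Ff * B.K)) * v" using p0[OF that] by (simp add: mult.assoc)
      also have "\<dots> = cm s * (cm (idm (2*n) - Ff * B.K) * v) + cm E * (cm u * v)"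
        unfolding t(10) by (simp add: distrib_right mult.assoc)
      finally show ?thesis unfolding p0[OF that] .
    qed
    have Eu: "cm E * (cm u * v) = cm E * (idm m * (cm u * v))" for v using E(2) by (simp add: mult.assoc[symmetric])
    show ?thesis
    proof (intro equalityI subsetI)
      fix y assume "y \<in> (\<lambda>v. cm t * v) ` A.X0"
      then obtain v where v: "v \<in> A.X0" "y = cm t * v" by blast
      let ?c = "cm a' * (idm m * (cm u * v))"
      have "cm E = cm s * cm E * cm a'" using arg_cong[OF rel(6), of cm] by simp
      then have "cm E * (cm u * v) = cm s * (cm E * ?c)" using Eu[of v] by (metis mult.assoc)
      then have "y = cm s * (v + cm E * ?c)" using v st by (simp add: distrib_left)
      moreover have "v + cm E * ?c \<in> A.X0" using A.X0_props[OF v(1)] rel(4) by (intro A.X0_add_E[OF v(1)]) auto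
      ultimately show "y \<in> (\<lambda>v. cm s * v) ` A.X0" by blast
    next
      fix y assume "y \<in> (\<lambda>v. cm s * v) ` A.X0"
      then obtain v where v: "v \<in> A.X0" "y = cm s * v" by blast
      let ?c = "- (cm b * (idm m * (cm u * v)))"
      have "cm t * cm E * cm b = cm E" using arg_cong[OF t(6), of cm] arg_cong[OF t(9), of cm] E(2) by (simp add: mult.assoc)
      then have "cm E * (cm u * v) = - (cm t * (cm E * ?c))"
        using Eu[of v] by (simp add: mult.assoc[symmetric])
      then have "y = cm t * (v + cm E * ?c)" using v st[OF v(1)] by (simp add: right_diff_distrib)
      moreover have "v + cm E * ?c \<in> A.X0" using A.X0_props[OF v(1)] t(7) by (intro A.X0_add_E[OF v(1)]) auto
      ultimately show "y \<in> (\<lambda>v. cm t * v) ` A.X0" by blast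
    qed
  qed
  have fixeq: "Ffix n F \<gamma> = Ffix n F (entry g1)"
  proof -
    have "tauP n x = act n \<gamma> x \<longleftrightarrow> tauP n x = act n (entry g1) x" if x: "x \<in> F" for x
    proof -
      obtain U c where U: "x = cv ` pair_span U q (cm E) m" "boundary_point n m E Ff q U c"
        using pts[OF x] fr by blast
      interpret A: boundary_point n m E Ff q U c by fact
      have S: "\<And>v. v \<in> A.X0 \<Longrightarrow> rws (2*n) v \<and> cls 1 v" using A.X0_props by blast
      have "\<gamma> = entry (eps n * s)" by (simp add: epss e\<gamma>)
      then show ?thesis unfolding U(1) g1_def
        using Ffix_iff[OF S sd] Ffix_iff[OF S t(1,2)] same[OF U(2)] by simp
    qed
    then show ?thesis by (auto simp: Ffix_def)
  qed
  have clos: "Ffix n F (entry g1) \<subseteq> satake_closure n (embZ n ` hfix n (entry g1))"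
  proof
    fix x assume "x \<in> Ffix n F (entry g1)"
    then have x: "x \<in> F" "tauP n x = act n (entry g1) x" by (auto simp: Ffix_def)
    \<comment> \<open>Only now is the complement made stable under \<open>t\<close>; integrality is
      no longer at stake.\<close>
    obtain F2 where F2: "frame n m E F2" "t * F2 = - (F2 * tr b)"
      using frame.involution_frame[OF fr t(1-4,6-9)] by blast
    obtain U c where U: "x = cv ` pair_span U q (cm E) m" "boundary_point n m E F2 q U c"
      using pts[OF x(1)] F2(1) by blast
    interpret A: boundary_point n m E F2 q U c by fact
    have S: "\<And>v. v \<in> A.X0 \<Longrightarrow> rws (2*n) v \<and> cls 1 v" using A.X0_props by blast
    have "(\<lambda>v. cm t * v) ` A.X0 = cj ` A.X0"
      using x(2) Ffix_iff[OF S t(1,2)] unfolding U(1) g1_def by simp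
    then have tX: "cj (cm t * v) \<in> A.X0" if "v \<in> A.X0" for v
    proof -
      have "cm t * v \<in> cj ` A.X0" using that \<open>(\<lambda>v. cm t * v) ` A.X0 = cj ` A.X0\<close> by blast
      then obtain w where "w \<in> A.X0" "cm t * v = cj w" by blast
      then show ?thesis by simp
    qed
    have "is_bcomp n F" by fact
    then have xh: "cv ` A.X0 \<in> hbar n" using x(1) U(1) by (auto simp: hbar_def)
    show "x \<in> satake_closure n (embZ n ` hfix n (entry g1))"
      unfolding U(1) g1_def
      by (rule A.boundary_in_closure[OF t(1-4,6) F2(2) t(7-9) tX q m_def xh])
  qed
  show ?thesis using G1 fixeq clos by blast
qed

end
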